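(* Let $X,Y\in\mathrm{Sym}^+(p)$ and let $(U,D)\in \mathcal{E}_X$, $(V,\Lambda)\in \mathcal{E}_Y$. Let $Z$ be any set of representatives of the double-coset space $\Gamma_{D}^0\backslash \tilde{S}_p^+/\Gamma_{\Lambda}^0$. Then the scaling-rotation distance from $X$ to $Y$ is given by $$d_{\mathcal{SR}}(X,Y)^2=\min_{g\in Z}\left\{k\left(\widehat{d}(g;(U,D),(V,\Lambda))\right)^2+\left\|\log\left(D^{-1}(\pi_g\cdot\Lambda)\right)\right\|^2\right\},$$ where $$\widehat{d}(g;(U,D),(V,\Lambda))=\min_{R_U\in G_D^0,\;R_V\in G_\Lambda^0}\left\{d_{SO}(UR_U,\,VR_VP_g^{-1})\right\}.$$ Moreover, every minimal smooth scaling-rotation (MSSR) curve from $X$ to $Y$ corresponds to some minimal pair whose first element lies in the connected component $[(U,D)]$ of $\mathcal{E}_X$.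
   Context: Let $p\ge 2$. $\mathrm{Sym}^+(p)$ is the set of $p\times p$ real symmetric positive-definite matrices, $\mathrm{Diag}^+(p)$ the set of $p\times p$ diagonal matrices with positive diagonal entries, $M(p)=SO(p)\times \mathrm{Diag}^+(p)$, $F:M(p)\to \mathrm{Sym}^+(p)$, $F(U,D)=UDU^T$, and $\mathcal{E}_X=F^{-1}(X)$. Metrics: $\|\cdot\|$ is the Frobenius norm. $SO(p)$ carries the bi-invariant Riemannian metric $g_{SO}$ given at the identity by $g_{SO}(A_1,A_2)=-\frac12\mathrm{tr}(A_1A_2)$ for $A_1,A_2\in\mathfrak{so}(p)$, with geodesic distance $d_{SO}$, so $d_{SO}(U,V)=\min\{\frac{1}{\sqrt2}\|A\| : A\in\mathfrak{so}(p),\ \exp(A)=U^{-1}V\}$. $\mathrm{Diag}^+(p)$ carries the metric $g_{\mathcal{D}^+}|_D(L_1,L_2)=\mathrm{tr}(D^{-1}L_1D^{-1}L_2)$. $M(p)$ carries the product metric $g_M=k\,g_{SO}\oplus g_{\mathcal{D}^+}$ with a fixed parameter $k>0$; its distance function $d_M$ satisfies $d_M((U,D),(V,\Lambda))^2=k\,d_{SO}(U,V)^2+\|\log(D^{-1}\Lambda)\|^2$. The scaling-rotation distance is $d_{\mathcal{SR}}(X,Y)=\inf\{d_M((U,D),(V,\Lambda)):(U,D)\in\mathcal{E}_X,(V,\Lambda)\in\mathcal{E}_Y\}$. An $F$-minimal geodesic from $\mathcal{E}_X$ to $\mathcal{E}_Y$ is a curve $\gamma:[0,1]\to M(p)$ that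 is a geodesic with $\gamma(0)\in\mathcal{E}_X$, $\gamma(1)\in\mathcal{E}_Y$ and length equal to $d_{\mathcal{SR}}(X,Y)$. A minimal pair in $\mathcal{E}_X\times\mathcal{E}_Y$ is a pair $(\gamma(0),\gamma(1))$ for some such $\gamma$. An MSSR curve from $X$ to $Y$ is a curve $\chi=F\circ\gamma$ with $\gamma$ an $F$-minimal geodesic from $\mathcal{E}_X$ to $\mathcal{E}_Y$; $\chi=F\circ\gamma$ is said to correspond to the minimal pair formed by the endpoints of $\gamma$. Groups: $\tilde{S}_p^+$ is the group of even signed-permutations, identified with the group of matrices in $SO(p)$ having exactly one nonzero entry in each row and column, each nonzero entry being $\pm1$; the matrix of $g\in\tilde{S}_p^+$ is written $P_g$, and $\pi_g\in S_p$ is the underlying permutation. $S_p$ acts on diagonal matrices by permuting diagonal entries, so that $\pi_g\cdot D=P_gDP_g^{-1}$. For a diagonal matrix $D$, $G_D=\{R\in SO(p):RDR^T=D\}$, $G_D^0$ is its identity component, and $\Gamma_D^0=\{g\in\tilde{S}_p^+:P_g\in G_D^0\}$. The connected component of $\mathcal{E}_X$ containing $(U,D)$ is $[(U,D)]=\{(UR,D):R\in G_D^0\}$. For subgroups $H_1,H_2$ of a group $G$, $H_1\backslash G/H_2$ is the set of equivalence classes for $g_1\sim g_2\iff g_2=h_1g_1h_2$ for some $h_i\in H_i$; a set of representatives contains exactly one element of each class. *)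

theory Defs
  imports "HOL-Analysis.Analysis"
begin

section \<open>Riemannian distance and geodesics\<close>

text \<open>
  A Riemannian manifold is given here by a subset \<open>M\<close> of a normed space (in the applications
  below an embedded submanifold) and a function \<open>g\<close>, where \<open>g x v w\<close> is the inner product of
  two vectors \<open>v\<close>, \<open>w\<close> tangent to \<open>M\<close> at \<open>x\<close>; for other \<open>v\<close>, \<open>w\<close> the value is irrelevant.
\<close>

definition speed ::
  "('a \<Rightarrow> 'a \<Rightarrow> 'a \<Rightarrow> real) \<Rightarrow> (real \<Rightarrow> 'a::real_normed_vector) \<Rightarrow> real \<Rightarrow> real" where
  "speed g \<gamma> t = sqrt (g (\<gamma> t) (vector_derivative \<gamma> (at t)) (vector_derivative \<gamma> (at t)))"

definition curve_length ::
  "('a \<Rightarrow> 'a \<Rightarrow> 'a \<Rightarrow> real) \<Rightarrow> (real \<Rightarrow> 'a::real_normed_vector) \<Rightarrow> real" where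
  "curve_length g \<gamma> = integral {0..1} (speed g \<gamma>)"

text \<open>
  The library's \<open>piecewise_C1_differentiable_on\<close> allows the derivative to be unbounded near the
  exceptional points. Integrability of the speed is therefore required explicitly:
  the integral of a non-integrable function is 0 by convention.
\<close>

definition admissible_curve ::
  "'a set \<Rightarrow> ('a \<Rightarrow> 'a \<Rightarrow> 'a \<Rightarrow> real) \<Rightarrow> (real \<Rightarrow> 'a::real_normed_vector) \<Rightarrow> bool" where
  "admissible_curve M g \<gamma> \<longleftrightarrow>
     \<gamma> piecewise_C1_differentiable_on {0..1} \<and> \<gamma> ` {0..1} \<subseteq> M \<and>
     speed g \<gamma> integrable_on {0..1}"

definition riem_dist ::
  "'a set \<Rightarrow> ('a \<Rightarrow> 'a \<Rightarrow> 'a \<Rightarrow> real) \<Rightarrow> 'a::real_normed_vector \<Rightarrow> 'a \<Rightarrow> real" where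
  "riem_dist M g x y =
     Inf {curve_length g \<gamma> | \<gamma>. admissible_curve M g \<gamma> \<and> \<gamma> 0 = x \<and> \<gamma> 1 = y}"

text \<open>
  Geodesics, parametrised on \<open>[0,1]\<close>, are the curves of constant speed \<open>c\<close> that locally
  minimise length; constant curves (\<open>c = 0\<close>) are included.
\<close>

definition geodesic ::
  "'a set \<Rightarrow> ('a \<Rightarrow> 'a \<Rightarrow> 'a \<Rightarrow> real) \<Rightarrow> (real \<Rightarrow> 'a::real_normed_vector) \<Rightarrow> bool" where
  "geodesic M g \<gamma> \<longleftrightarrow>
     admissible_curve M g \<gamma> \<and>
     (\<exists>c\<ge>0. \<forall>t\<in>{0..1}. \<exists>\<epsilon>>0. \<forall>s\<in>{0..1}. \<forall>s'\<in>{0..1}.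
        \<bar>s - t\<bar> < \<epsilon> \<longrightarrow> \<bar>s' - t\<bar> < \<epsilon> \<longrightarrow> riem_dist M g (\<gamma> s) (\<gamma> s') = c * \<bar>s - s'\<bar>)"


section \<open>The eigen-decomposition manifold\<close>

definition Sym_plus :: "(real^'n^'n) set" where
  "Sym_plus = {X. transpose X = X \<and> (\<forall>v. v \<noteq> 0 \<longrightarrow> v \<bullet> (X *v v) > 0)}"

definition Diag_plus :: "(real^'n^'n) set" where
  "Diag_plus = {D. (\<forall>i j. i \<noteq> j \<longrightarrow> D $ i $ j = 0) \<and> (\<forall>i. D $ i $ i > 0)}"

definition SO :: "(real^'n^'n) set" where
  "SO = {U. rotation_matrix U}"

type_synonym 'n matrix_pair = "(real^'n^'n) \<times> (real^'n^'n)"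

definition M_set :: "'n::finite matrix_pair set" where
  "M_set = SO \<times> Diag_plus"

definition F :: "'n::finite matrix_pair \<Rightarrow> real^'n^'n" where
  "F = (\<lambda>(U, D). U ** D ** transpose U)"

definition fibre :: "real^'n^'n \<Rightarrow> 'n::finite matrix_pair set" where
  "fibre X = {m \<in> M_set. F m = X}"

text \<open>Left translation extends the inner product on \<open>so(p)\<close> to the bi-invariant metric.\<close>

definition g_SO :: "real^'n^'n \<Rightarrow> real^'n^'n \<Rightarrow> real^'n^'n \<Rightarrow> real" where
  "g_SO U A\<^sub>1 A\<^sub>2 = - (1/2) * trace ((matrix_inv U ** A\<^sub>1) ** (matrix_inv U ** A\<^sub>2))"

definition g_Diag :: "real^'n^'n \<Rightarrow> real^'n^'n \<Rightarrow> real^'n^'n \<Rightarrow> real" where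
  "g_Diag D L\<^sub>1 L\<^sub>2 = trace (matrix_inv D ** L\<^sub>1 ** matrix_inv D ** L\<^sub>2)"

definition g_M ::
  "real \<Rightarrow> 'n::finite matrix_pair \<Rightarrow> 'n matrix_pair \<Rightarrow> 'n matrix_pair \<Rightarrow> real" where
  "g_M k = (\<lambda>(U, D) (A\<^sub>1, L\<^sub>1) (A\<^sub>2, L\<^sub>2). k * g_SO U A\<^sub>1 A\<^sub>2 + g_Diag D L\<^sub>1 L\<^sub>2)"

definition d_SO :: "real^'n^'n \<Rightarrow> real^'n^'n \<Rightarrow> real" where
  "d_SO = riem_dist SO g_SO"

definition d_M :: "real \<Rightarrow> 'n::finite matrix_pair \<Rightarrow> 'n matrix_pair \<Rightarrow> real" where
  "d_M k = riem_dist M_set (g_M k)"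


section \<open>Scaling-rotation distance and minimal smooth scaling-rotation curves\<close>

definition d_SR :: "real \<Rightarrow> real^'n^'n \<Rightarrow> real^'n^'n \<Rightarrow> real" where
  "d_SR k X Y = Inf {d_M k a b | a b. a \<in> fibre X \<and> b \<in> fibre Y}"

definition F_minimal_geodesic ::
  "real \<Rightarrow> real^'n^'n \<Rightarrow> real^'n^'n \<Rightarrow> (real \<Rightarrow> 'n::finite matrix_pair) \<Rightarrow> bool" where
  "F_minimal_geodesic k X Y \<gamma> \<longleftrightarrow>
     geodesic M_set (g_M k) \<gamma> \<and> \<gamma> 0 \<in> fibre X \<and> \<gamma> 1 \<in> fibre Y \<and>
     curve_length (g_M k) \<gamma> = d_SR k X Y"

definition minimal_pair ::
  "real \<Rightarrow> real^'n^'n \<Rightarrow> real^'n^'n \<Rightarrow> 'n::finite matrix_pair \<Rightarrow> 'n matrix_pair \<Rightarrow> bool" where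
  "minimal_pair k X Y a b \<longleftrightarrow> (\<exists>\<gamma>. F_minimal_geodesic k X Y \<gamma> \<and> \<gamma> 0 = a \<and> \<gamma> 1 = b)"

text \<open>Curves are functions on \<open>[0,1]\<close>; their values at other arguments are not constrained.\<close>

definition MSSR_curve ::
  "real \<Rightarrow> real^'n^'n \<Rightarrow> real^'n^'n \<Rightarrow> (real \<Rightarrow> real^'n^'n) \<Rightarrow> bool" where
  "MSSR_curve k X Y \<eta> \<longleftrightarrow>
     (\<exists>\<gamma>. F_minimal_geodesic k X Y \<gamma> \<and> (\<forall>t\<in>{0..1}. \<eta> t = F (\<gamma> t)))"

definition corresponds_to_pair ::
  "real \<Rightarrow> real^'n^'n \<Rightarrow> real^'n^'n \<Rightarrow> (real \<Rightarrow> real^'n^'n) \<Rightarrow>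
   'n::finite matrix_pair \<Rightarrow> 'n matrix_pair \<Rightarrow> bool" where
  "corresponds_to_pair k X Y \<eta> a b \<longleftrightarrow>
     (\<exists>\<gamma>. F_minimal_geodesic k X Y \<gamma> \<and> (\<forall>t\<in>{0..1}. \<eta> t = F (\<gamma> t)) \<and>
          \<gamma> 0 = a \<and> \<gamma> 1 = b)"


section \<open>Even signed permutations and stabilisers\<close>

text \<open>An even signed permutation \<open>g\<close> is identified with its matrix \<open>P\<^sub>g\<close>.\<close>

definition even_signed_perms :: "(real^'n^'n) set" where
  "even_signed_perms =
     {P \<in> SO. (\<forall>i. \<exists>!j. P $ i $ j \<noteq> 0) \<and> (\<forall>j. \<exists>!i. P $ i $ j \<noteq> 0) \<and>
              (\<forall>i j. P $ i $ j \<in> {-1, 0, 1})}"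

text \<open>
  \<open>P\<close> sends the basis vector \<open>e\<^sub>j\<close> to \<open>\<plusminus>e\<^sub>i\<close> with \<open>i = underlying_perm P j\<close>. A permutation moves
  the \<open>j\<close>-th diagonal entry to position \<open>\<pi> j\<close>, so that \<open>underlying_perm P\<close> acts on diagonal
  matrices as conjugation by \<open>P\<close>.
\<close>

definition underlying_perm :: "real^'n^'n \<Rightarrow> 'n \<Rightarrow> 'n" where
  "underlying_perm P j = (THE i. P $ i $ j \<noteq> 0)"

definition perm_diag :: "('n \<Rightarrow> 'n) \<Rightarrow> real^'n^'n \<Rightarrow> real^'n^'n" where
  "perm_diag \<pi> D = (\<chi> i j. if i = j then D $ (inv \<pi> i) $ (inv \<pi> i) else 0)"

definition stab :: "real^'n^'n \<Rightarrow> (real^'n^'n) set" where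
  "stab D = {R \<in> SO. R ** D ** transpose R = D}"

definition stab0 :: "real^'n^'n \<Rightarrow> (real^'n^'n) set" where
  "stab0 D = connected_component_set (stab D) (mat 1)"

definition Gamma0 :: "real^'n^'n \<Rightarrow> (real^'n^'n) set" where
  "Gamma0 D = even_signed_perms \<inter> stab0 D"

definition double_cosets ::
  "(real^'n^'n) set \<Rightarrow> (real^'n^'n) set \<Rightarrow> (real^'n^'n) set \<Rightarrow> (real^'n^'n) set set" where
  "double_cosets H\<^sub>1 G H\<^sub>2 =
     G // {(g\<^sub>1, g\<^sub>2). g\<^sub>1 \<in> G \<and> g\<^sub>2 \<in> G \<and> (\<exists>h\<^sub>1\<in>H\<^sub>1. \<exists>h\<^sub>2\<in>H\<^sub>2. g\<^sub>2 = h\<^sub>1 ** g\<^sub>1 ** h\<^sub>2)}"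

definition set_of_representatives :: "'a set \<Rightarrow> 'a set set \<Rightarrow> bool" where
  "set_of_representatives Z \<C> \<longleftrightarrow> Z \<subseteq> \<Union>\<C> \<and> (\<forall>C\<in>\<C>. \<exists>!z. z \<in> Z \<inter> C)"


section \<open>The quantities in the distance formula\<close>

text \<open>The matrix logarithm on diagonal matrices with positive diagonal entries.\<close>

definition log_diag :: "real^'n^'n \<Rightarrow> real^'n^'n" where
  "log_diag D = (\<chi> i j. if i = j then ln (D $ i $ i) else 0)"

text \<open>\<open>minimum S m\<close> includes the assertion that the minimum is attained.\<close>

definition minimum :: "real set \<Rightarrow> real \<Rightarrow> bool" where
  "minimum S m \<longleftrightarrow> m \<in> S \<and> (\<forall>s\<in>S. m \<le> s)"

definition d_hat_values ::
  "real^'n^'n \<Rightarrow> 'n::finite matrix_pair \<Rightarrow> 'n matrix_pair \<Rightarrow> real set" where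
  "d_hat_values P = (\<lambda>(U, D) (V, \<Lambda>).
     {d_SO (U ** R\<^sub>U) (V ** R\<^sub>V ** matrix_inv P) | R\<^sub>U R\<^sub>V. R\<^sub>U \<in> stab0 D \<and> R\<^sub>V \<in> stab0 \<Lambda>})"

definition d_hat ::
  "real^'n^'n \<Rightarrow> 'n::finite matrix_pair \<Rightarrow> 'n matrix_pair \<Rightarrow> real" where
  "d_hat P a b = Inf (d_hat_values P a b)"

end

theory Submission
  imports Defs
begin

text \<open>
  Write \<open>P\<close> for the matrix of an even signed permutation. The map
  \<open>(A, L) \<mapsto> (A P, P\<^sup>T L P)\<close> is an isometry of \<open>M(p)\<close> that leaves \<open>F\<close> unchanged
  (\<open>perm_action_isometry\<close>), and every point of the fibre \<open>\<E>\<^sub>X\<close> has the form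
  \<open>(U R P\<^sup>T, P D P\<^sup>T)\<close> with \<open>R \<in> G\<^sub>D\<^sup>0\<close> (\<open>fibre_structure\<close>). Hence one of these isometries moves a
  given point of \<open>\<E>\<^sub>X\<close> into the component \<open>[(U, D)]\<close>. Applied to a whole minimal geodesic, it changes
  neither length nor image under \<open>F\<close>, which is the statement about MSSR curves. Applied to a pair
  in \<open>\<E>\<^sub>X \<times> \<E>\<^sub>Y\<close>, whose second point is \<open>(V R\<^sub>V Q\<^sup>T, Q \<Lambda> Q\<^sup>T)\<close>, it turns the pair into
  \<open>(U R\<^sub>U, D)\<close>, \<open>(V R\<^sub>V g\<^sup>-\<^sup>1, g \<Lambda> g\<^sup>-\<^sup>1)\<close> with \<open>g = P\<^sup>T Q\<close>; so only the relative permutation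
  matters (\<open>d_M_fibres\<close>). Since the distance of the product manifold is Pythagorean (\<open>d_M_eq\<close>), the
  infimum over the rotations \<open>R\<^sub>U, R\<^sub>V\<close> gives \<open>k d\<^sup>2 + l\<^sup>2\<close> with \<open>d\<close> the quantity \<open>d_hat\<close> and \<open>l\<close>
  the logarithmic distance of the diagonal parts. It is attained because \<open>d_SO\<close> is continuous and
  the identity components of the stabilisers are compact. The value depends on the double coset of
  \<open>g\<close> only, because elements of \<open>\<Gamma>\<^sub>D\<^sup>0\<close> and \<open>\<Gamma>\<^sub>\<Lambda>\<^sup>0\<close> can be absorbed into \<open>R\<^sub>U\<close> and \<open>R\<^sub>V\<close>, and there
  are finitely many signed permutations, so a minimum over representatives remains.

  Three facts carry this argument. The first is that each element of \<open>G\<^sub>D\<close> is an element of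
  \<open>G\<^sub>D\<^sup>0\<close> times a diagonal matrix of signs (\<open>stab0_diagonalise\<close>). It is obtained variationally,
  without describing \<open>G\<^sub>D\<close> as a group of block matrices: a weighted trace is maximised over the
  compact set \<open>G\<^sub>D\<^sup>0 R\<close>, and rotations in coordinate planes show that a maximiser is diagonal. The
  case \<open>D = I\<close> also yields the connectedness of \<open>SO(p)\<close>. The second is that \<open>d_SO\<close>, an infimum of
  lengths of curves, is finite and continuous; nearby rotations are joined by the short curves of the
  Cayley transform (\<open>cayley_curve\<close>). The third is the Pythagorean formula \<open>d_M_eq\<close>. Its lower bound is
  the Cauchy-Schwarz inequality under the integral; for the upper bound, the diagonal part runs along
  its logarithmic segment at a rate given by the arc length of the rotation part.
\<close>

section \<open>Lengths and distances under isometries, reversal and concatenation\<close>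

text \<open>
  The speed may take arbitrary values at the finitely many points where a curve has no
  derivative; it is enough to know it off a finite set.
\<close>

lemma admissible_by_speed:
  assumes "\<gamma> piecewise_C1_differentiable_on {0..1}" "\<gamma> ` {0..1} \<subseteq> M"
    and "finite S" "\<And>t. t \<in> {0..1} - S \<Longrightarrow> speed g \<gamma> t = f t" "(f has_integral l) {0..1}"
  shows "admissible_curve M g \<gamma>" "curve_length g \<gamma> = l"
proof -
  have *: "(speed g \<gamma> has_integral l) {0..1}"
    using has_integral_spike_finite[of S "{0..1}" "speed g \<gamma>" f l] assms(3-5) by simp
  show "admissible_curve M g \<gamma>"
    using assms(1,2) * unfolding admissible_curve_def by blast
  show "curve_length g \<gamma> = l"
    using * by (simp add: curve_length_def integral_unique)
qed

text \<open>
  Including the endpoints in the exceptional set confines attention to interior times, where a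
  two-sided derivative is determined by the values of the curve in \<open>M\<close>.
\<close>

lemma piecewise_C1_regular:
  assumes "\<gamma> piecewise_C1_differentiable_on {0..1::real}"
  obtains S where "finite S" "0 \<in> S" "1 \<in> S"
    "\<And>t. t \<in> {0..1} - S \<Longrightarrow> (\<gamma> has_vector_derivative vector_derivative \<gamma> (at t)) (at t)"
    "continuous_on ({0..1} - S) (\<lambda>t. vector_derivative \<gamma> (at t))"
proof -
  obtain S where S: "finite S" "\<gamma> C1_differentiable_on ({0..1} - S)"
    using assms unfolding piecewise_C1_differentiable_on_def by auto
  show thesis
  proof (rule that[of "S \<union> {0,1}"])
    show "continuous_on ({0..1} - (S \<union> {0, 1})) (\<lambda>t. vector_derivative \<gamma> (at t))"
      using S(2) unfolding C1_differentiable_on_eq by (rule conjE) (erule continuous_on_subset, auto)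
    show "(\<gamma> has_vector_derivative vector_derivative \<gamma> (at t)) (at t)"
      if "t \<in> {0..1} - (S \<union> {0, 1})" for t
      using S(2) that unfolding C1_differentiable_on_eq by (auto simp: vector_derivative_works)
  qed (use S in auto)
qed

lemma has_integral_speed:
  assumes "admissible_curve M g \<gamma>"
  shows "(speed g \<gamma> has_integral curve_length g \<gamma>) {0..1}"
  using assms unfolding admissible_curve_def curve_length_def by (simp add: integrable_integral)

lemma C1_differentiable_bounded_linear:
  assumes "bounded_linear T" "\<gamma> C1_differentiable_on S"
  shows "(T \<circ> \<gamma>) C1_differentiable_on S"
proof -
  obtain D where D: "\<And>x. x \<in> S \<Longrightarrow> (\<gamma> has_vector_derivative D x) (at x)" "continuous_on S D"
    using assms(2) unfolding C1_differentiable_on_def by auto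
  have "(T \<circ> \<gamma> has_vector_derivative T (D x)) (at x)" if "x \<in> S" for x
    using bounded_linear.has_vector_derivative[OF assms(1) D(1)[OF that]] unfolding o_def .
  moreover have "continuous_on S (\<lambda>x. T (D x))"
    by (rule bounded_linear.continuous_on[OF assms(1) D(2)])
  ultimately show ?thesis
    unfolding C1_differentiable_on_def by (intro exI[of _ "\<lambda>x. T (D x)"] conjI ballI)
qed

lemma piecewise_C1_bounded_linear:
  assumes "bounded_linear T" "\<gamma> piecewise_C1_differentiable_on S"
  shows "(T \<circ> \<gamma>) piecewise_C1_differentiable_on S"
proof -
  obtain N where N: "continuous_on S \<gamma>" "finite N" "\<gamma> C1_differentiable_on (S - N)"
    using assms(2) unfolding piecewise_C1_differentiable_on_def by blast
  have "continuous_on S (T \<circ> \<gamma>)"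
    using bounded_linear.continuous_on[OF assms(1) N(1)] by (simp add: o_def)
  then show ?thesis
    using C1_differentiable_bounded_linear[OF assms(1) N(3)] N(2)
    unfolding piecewise_C1_differentiable_on_def by blast
qed

text \<open>
  Linear isometries suffice here: translations of \<open>SO\<close> and the action of the signed
  permutations on \<open>M(p)\<close> are restrictions of linear maps of the ambient space.
\<close>

lemma isometry_admissible:
  assumes T: "bounded_linear T" and "T ` M \<subseteq> M'"
    and iso: "\<And>x v. x \<in> M \<Longrightarrow> g' (T x) (T v) (T v) = g x v v"
    and adm: "admissible_curve M g \<gamma>"
  shows "admissible_curve M' g' (T \<circ> \<gamma>)" "curve_length g' (T \<circ> \<gamma>) = curve_length g \<gamma>"
proof -
  have pc: "\<gamma> piecewise_C1_differentiable_on {0..1}" and M: "\<gamma> ` {0..1} \<subseteq> M"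
    using adm unfolding admissible_curve_def by auto
  obtain S where S: "finite S"
    "\<And>t. t \<in> {0..1} - S \<Longrightarrow> (\<gamma> has_vector_derivative vector_derivative \<gamma> (at t)) (at t)"
    using piecewise_C1_regular[OF pc] by metis
  have sp: "speed g' (T \<circ> \<gamma>) t = speed g \<gamma> t" if t: "t \<in> {0..1} - S" for t
  proof -
    have "vector_derivative (T \<circ> \<gamma>) (at t) = T (vector_derivative \<gamma> (at t))"
      using bounded_linear.has_vector_derivative[OF T S(2)[OF t]]
      by (simp add: o_def vector_derivative_at)
    moreover have "\<gamma> t \<in> M" using M t by auto
    ultimately show ?thesis by (simp add: speed_def iso)
  qed
  have M': "(T \<circ> \<gamma>) ` {0..1} \<subseteq> M'" using M assms(2) by fastforce
  note * = admissible_by_speed[OF piecewise_C1_bounded_linear[OF T pc] M' S(1) sp has_integral_speed[OF adm]]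
  show "admissible_curve M' g' (T \<circ> \<gamma>)" "curve_length g' (T \<circ> \<gamma>) = curve_length g \<gamma>"
    using * by auto
qed

lemma riem_dist_isometry:
  assumes T: "bounded_linear T" "T ` M \<subseteq> M" "\<And>x v. x \<in> M \<Longrightarrow> g (T x) (T v) (T v) = g x v v"
    and T': "bounded_linear T'" "T' ` M \<subseteq> M" "\<And>x v. x \<in> M \<Longrightarrow> g (T' x) (T' v) (T' v) = g x v v"
    and inv: "\<And>x. T' (T x) = x" "\<And>x. T (T' x) = x"
  shows "riem_dist M g (T x) (T y) = riem_dist M g x y"
proof -
  have "{curve_length g \<gamma> | \<gamma>. admissible_curve M g \<gamma> \<and> \<gamma> 0 = T x \<and> \<gamma> 1 = T y}
      = {curve_length g \<gamma> | \<gamma>. admissible_curve M g \<gamma> \<and> \<gamma> 0 = x \<and> \<gamma> 1 = y}" (is "?A = ?B")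
  proof
    show "?A \<subseteq> ?B"
    proof
      fix l assume "l \<in> ?A"
      then obtain \<gamma> where \<gamma>: "l = curve_length g \<gamma>" "admissible_curve M g \<gamma>" "\<gamma> 0 = T x" "\<gamma> 1 = T y"
        by auto
      show "l \<in> ?B"
        using isometry_admissible[OF T'(1,2), of g g \<gamma>] T'(3) \<gamma> inv
        by (intro CollectI exI[of _ "T' \<circ> \<gamma>"]) auto
    qed
    show "?B \<subseteq> ?A"
    proof
      fix l assume "l \<in> ?B"
      then obtain \<gamma> where \<gamma>: "l = curve_length g \<gamma>" "admissible_curve M g \<gamma>" "\<gamma> 0 = x" "\<gamma> 1 = y"
        by auto
      show "l \<in> ?A"
        using isometry_admissible[OF T(1,2), of g g \<gamma>] T(3) \<gamma> inv
        by (intro CollectI exI[of _ "T \<circ> \<gamma>"]) auto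
    qed
  qed
  then show ?thesis unfolding riem_dist_def by simp
qed

lemma geodesic_isometry:
  assumes T: "bounded_linear T" "T ` M \<subseteq> M" "\<And>x v. x \<in> M \<Longrightarrow> g (T x) (T v) (T v) = g x v v"
    and T': "bounded_linear T'" "T' ` M \<subseteq> M" "\<And>x v. x \<in> M \<Longrightarrow> g (T' x) (T' v) (T' v) = g x v v"
    and inv: "\<And>x. T' (T x) = x" "\<And>x. T (T' x) = x"
    and geo: "geodesic M g \<gamma>"
  shows "geodesic M g (T \<circ> \<gamma>)"
proof -
  have "riem_dist M g ((T \<circ> \<gamma>) s) ((T \<circ> \<gamma>) s') = riem_dist M g (\<gamma> s) (\<gamma> s')" for s s'
    using riem_dist_isometry[where g=g and M=M, OF T(1,2) _ T'(1,2) _ inv, of "\<gamma> s" "\<gamma> s'"] T(3) T'(3)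
    by simp
  moreover have "admissible_curve M g (T \<circ> \<gamma>)"
    using isometry_admissible(1)[OF T(1,2), of g g \<gamma>] T(3) geo unfolding geodesic_def by auto
  ultimately show ?thesis using geo unfolding geodesic_def by simp
qed

text \<open>
  The only part of bilinearity that reparametrising a curve requires; it must hold for all
  vectors, tangent or not.
\<close>

definition quadratic_metric :: "('a \<Rightarrow> 'a \<Rightarrow> 'a::real_normed_vector \<Rightarrow> real) \<Rightarrow> bool" where
  "quadratic_metric g \<longleftrightarrow> (\<forall>x v c. g x (c *\<^sub>R v) (c *\<^sub>R v) = c\<^sup>2 * g x v v)"

text \<open>
  The hypothesis on \<open>\<delta>\<close> is local so that the lemma applies to each half of a concatenated curve
  away from the junction.
\<close>

lemma speed_affine:
  assumes "quadratic_metric g" "(\<gamma> has_vector_derivative vector_derivative \<gamma> (at (m * t + c))) (at (m * t + c))"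
    and "\<delta> t = \<gamma> (m * t + c)" "e > 0" "\<And>s. \<bar>s - t\<bar> < e \<Longrightarrow> \<delta> s = \<gamma> (m * s + c)"
  shows "speed g \<delta> t = \<bar>m\<bar> * speed g \<gamma> (m * t + c)"
proof -
  have 1: "((\<lambda>s. m * s + c) has_vector_derivative m) (at t)"
    unfolding has_real_derivative_iff_has_vector_derivative[symmetric]
    by (rule derivative_eq_intros refl | simp)+
  have "(\<gamma> \<circ> (\<lambda>s. m * s + c) has_vector_derivative m *\<^sub>R vector_derivative \<gamma> (at (m * t + c))) (at t)"
    using vector_diff_chain_at[where f="\<lambda>s. m * s + c" and g=\<gamma> and x=t, OF 1] assms(2) by blast
  then have "(\<delta> has_vector_derivative m *\<^sub>R vector_derivative \<gamma> (at (m * t + c))) (at t)"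
    by (rule has_vector_derivative_transform_within[OF _ assms(4)])
       (simp_all only: UNIV_I o_def dist_real_def assms(5))
  then have "vector_derivative \<delta> (at t) = m *\<^sub>R vector_derivative \<gamma> (at (m * t + c))"
    by (rule vector_derivative_at)
  moreover have "g x (m *\<^sub>R v) (m *\<^sub>R v) = m\<^sup>2 * g x v v" for x v
    using assms(1) unfolding quadratic_metric_def by blast
  ultimately show ?thesis
    unfolding speed_def assms(3) by (simp only: real_sqrt_mult real_sqrt_abs)
qed

lemma admissible_reverse:
  assumes "quadratic_metric g" "admissible_curve M g \<gamma>"
  shows "admissible_curve M g (reversepath \<gamma>)" "curve_length g (reversepath \<gamma>) = curve_length g \<gamma>"
proof -
  have pc: "\<gamma> piecewise_C1_differentiable_on {0..1}" and M: "\<gamma> ` {0..1} \<subseteq> M"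
    using assms unfolding admissible_curve_def by auto
  obtain S where S: "finite S"
    "\<And>t. t \<in> {0..1} - S \<Longrightarrow> (\<gamma> has_vector_derivative vector_derivative \<gamma> (at t)) (at t)"
    using piecewise_C1_regular[OF pc] by metis
  have sp: "speed g (reversepath \<gamma>) t = speed g \<gamma> (1 - t)" if t: "t \<in> {0..1} - (-) 1 ` S" for t
  proof -
    have "1 - t \<in> {0..1} - S" using t by (auto simp: image_iff)
    from S(2)[OF this] show ?thesis
      using speed_affine[of g \<gamma> "-1" t 1 "reversepath \<gamma>" 1] assms(1) by (simp add: reversepath_def)
  qed
  have "(speed g \<gamma> has_integral curve_length g \<gamma>) (cbox 0 1)"
    using has_integral_speed[OF assms(2)] by simp
  from has_integral_affinity[OF this, of "-1" 1]
  have int: "((\<lambda>t. speed g \<gamma> (1 - t)) has_integral curve_length g \<gamma>) {0..1}"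
    by (simp add: image_affinity_atLeastAtMost_diff)
  have "reversepath \<gamma> piecewise_C1_differentiable_on {0..1}"
    using valid_path_imp_reverse pc unfolding valid_path_def by blast
  moreover have "reversepath \<gamma> ` {0..1} \<subseteq> M" using M by (auto simp: reversepath_def)
  ultimately show "admissible_curve M g (reversepath \<gamma>)"
      "curve_length g (reversepath \<gamma>) = curve_length g \<gamma>"
    using admissible_by_speed[of "reversepath \<gamma>" M "(-) 1 ` S" g "\<lambda>t. speed g \<gamma> (1 - t)"] S(1) sp int
    by auto
qed

lemma admissible_join:
  assumes g: "quadratic_metric g" and adm: "admissible_curve M g \<gamma>" "admissible_curve M g \<delta>"
    and "\<gamma> 1 = \<delta> 0"
  shows "admissible_curve M g (\<gamma> +++ \<delta>)"
    "curve_length g (\<gamma> +++ \<delta>) = curve_length g \<gamma> + curve_length g \<delta>"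
proof -
  have pc: "\<gamma> piecewise_C1_differentiable_on {0..1}" "\<delta> piecewise_C1_differentiable_on {0..1}"
    and M: "\<gamma> ` {0..1} \<subseteq> M" "\<delta> ` {0..1} \<subseteq> M"
    using adm unfolding admissible_curve_def by auto
  obtain S where S: "finite S"
    "\<And>t. t \<in> {0..1} - S \<Longrightarrow> (\<gamma> has_vector_derivative vector_derivative \<gamma> (at t)) (at t)"
    using piecewise_C1_regular[OF pc(1)] by metis
  obtain T where T: "finite T"
    "\<And>t. t \<in> {0..1} - T \<Longrightarrow> (\<delta> has_vector_derivative vector_derivative \<delta> (at t)) (at t)"
    using piecewise_C1_regular[OF pc(2)] by metis
  define E where "E = {1/2} \<union> (\<lambda>x. x / 2) ` S \<union> (\<lambda>x. (x + 1) / 2) ` T"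
  define f where "f = (\<lambda>t. if t \<le> 1/2 then 2 * speed g \<gamma> (2 * t) else 2 * speed g \<delta> (2 * t - 1))"
  have fin: "finite E" using S T by (simp add: E_def)
  have sp: "speed g (\<gamma> +++ \<delta>) t = f t" if t: "t \<in> {0..1} - E" for t
  proof (cases "t < 1/2")
    case True
    have "2 * t \<notin> S"
    proof
      assume "2 * t \<in> S"
      then have "(2 * t) / 2 \<in> E" unfolding E_def by blast
      then show False using t by simp
    qed
    then have "2 * t + 0 \<in> {0..1} - S" using True t by auto
    moreover have "(\<gamma> +++ \<delta>) s = \<gamma> (2 * s + 0)" if "\<bar>s - t\<bar> < 1/2 - t" for s
      using that by (auto simp: joinpaths_def)
    ultimately show ?thesis
      using speed_affine[OF g S(2), of 2 t 0 "\<gamma> +++ \<delta>" "1/2 - t"] True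
      by (simp add: f_def joinpaths_def)
  next
    case False
    then have gt: "t > 1/2" using t by (cases "t = 1/2") (auto simp: E_def)
    have "2 * t - 1 \<notin> T"
    proof
      assume "2 * t - 1 \<in> T"
      then have "((2 * t - 1) + 1) / 2 \<in> E" unfolding E_def by blast
      then show False using t by simp
    qed
    then have "2 * t + (-1) \<in> {0..1} - T" using gt t by auto
    moreover have "(\<gamma> +++ \<delta>) s = \<delta> (2 * s + (-1))" if "\<bar>s - t\<bar> < t - 1/2" for s
      using that by (auto simp: joinpaths_def)
    ultimately show ?thesis
      using speed_affine[OF g T(2), of 2 t "-1" "\<gamma> +++ \<delta>" "t - 1/2"] gt
      by (simp add: f_def joinpaths_def)
  qed
  have i1: "((\<lambda>t. 2 * speed g \<gamma> (2 * t)) has_integral curve_length g \<gamma>) {0..1/2}"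
    using has_integral_affinity01[OF has_integral_speed[OF adm(1)], where m= 2 and c=0, THEN has_integral_cmul [where c=2]]
    by (simp_all only: image_affinity_atLeastAtMost_div_diff, simp_all)
  have i2: "((\<lambda>t. 2 * speed g \<delta> (2 * t - 1)) has_integral curve_length g \<delta>) {1/2..1}"
    using has_integral_affinity01[OF has_integral_speed[OF adm(2)], where m= 2 and c="-1", THEN has_integral_cmul [where c=2]]
    by (simp_all only: image_affinity_atLeastAtMost_div_diff, simp_all)
  have "(f has_integral curve_length g \<gamma>) {0..1/2}"
    by (rule has_integral_spike_finite[OF _ _ i1, of "{}"]) (auto simp: f_def)
  moreover have "(f has_integral curve_length g \<delta>) {1/2..1}"
    by (rule has_integral_spike_finite[OF _ _ i2, of "{1/2}"]) (auto simp: f_def)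
  ultimately have int: "(f has_integral (curve_length g \<gamma> + curve_length g \<delta>)) {0..1}"
    using has_integral_combine[of 0 "1/2" 1 f] by simp
  have "\<gamma> +++ \<delta> piecewise_C1_differentiable_on {0..1}"
    using valid_path_join[of \<gamma> \<delta>] pc assms(4)
    by (auto simp: valid_path_def pathfinish_def pathstart_def)
  moreover have "(\<gamma> +++ \<delta>) ` {0..1} \<subseteq> M"
    using M by (auto simp: joinpaths_def image_subset_iff)
  ultimately show "admissible_curve M g (\<gamma> +++ \<delta>)"
    "curve_length g (\<gamma> +++ \<delta>) = curve_length g \<gamma> + curve_length g \<delta>"
    using admissible_by_speed[OF _ _ fin sp int] by auto
qed


lemma riem_dist_le:
  assumes nn: "\<And>\<gamma>. admissible_curve M g \<gamma> \<Longrightarrow> 0 \<le> curve_length g \<gamma>"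
    and "admissible_curve M g \<gamma>" "\<gamma> 0 = x" "\<gamma> 1 = y"
  shows "riem_dist M g x y \<le> curve_length g \<gamma>"
  unfolding riem_dist_def
  by (rule cInf_lower) (use assms in \<open>auto intro!: bdd_belowI[of _ 0]\<close>)

text \<open>
  Here and below the given curve ensures that the infimum is taken over a nonempty set.
\<close>

lemma riem_dist_ge:
  assumes "admissible_curve M g \<gamma>" "\<gamma> 0 = x" "\<gamma> 1 = y"
    and "\<And>\<gamma>. admissible_curve M g \<gamma> \<Longrightarrow> \<gamma> 0 = x \<Longrightarrow> \<gamma> 1 = y \<Longrightarrow> c \<le> curve_length g \<gamma>"
  shows "c \<le> riem_dist M g x y"
  unfolding riem_dist_def
  by (rule cInf_greatest) (use assms in auto)

lemma riem_dist_less: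
  assumes "admissible_curve M g \<gamma>" "\<gamma> 0 = x" "\<gamma> 1 = y" "riem_dist M g x y < c"
  obtains \<delta> where "admissible_curve M g \<delta>" "\<delta> 0 = x" "\<delta> 1 = y" "curve_length g \<delta> < c"
proof -
  let ?L = "{curve_length g \<gamma> | \<gamma>. admissible_curve M g \<gamma> \<and> \<gamma> 0 = x \<and> \<gamma> 1 = y}"
  have "?L \<noteq> {}" using assms by auto
  from cInf_lessD[OF this assms(4)[unfolded riem_dist_def]] show thesis using that by auto
qed

lemma riem_dist_triangle:
  assumes nn: "\<And>\<gamma>. admissible_curve M g \<gamma> \<Longrightarrow> 0 \<le> curve_length g \<gamma>"
    and ex: "\<And>x y. x \<in> M \<Longrightarrow> y \<in> M \<Longrightarrow> \<exists>\<gamma>. admissible_curve M g \<gamma> \<and> \<gamma> 0 = x \<and> \<gamma> 1 = y"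
    and g: "quadratic_metric g" and M: "x \<in> M" "y \<in> M" "z \<in> M"
  shows "riem_dist M g x z \<le> riem_dist M g x y + riem_dist M g y z"
proof (rule field_le_epsilon)
  fix e :: real assume e: "e > 0"
  obtain \<gamma> where \<gamma>: "admissible_curve M g \<gamma>" "\<gamma> 0 = x" "\<gamma> 1 = y"
      "curve_length g \<gamma> < riem_dist M g x y + e / 2"
    using ex[OF M(1,2)] e by (auto intro: riem_dist_less[where c="riem_dist M g x y + e / 2"])
  obtain \<delta> where \<delta>: "admissible_curve M g \<delta>" "\<delta> 0 = y" "\<delta> 1 = z"
      "curve_length g \<delta> < riem_dist M g y z + e / 2"
    using ex[OF M(2,3)] e by (auto intro: riem_dist_less[where c="riem_dist M g y z + e / 2"])
  have "riem_dist M g x z \<le> curve_length g (\<gamma> +++ \<delta>)"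
    by (rule riem_dist_le[OF nn])
       (use \<gamma> \<delta> admissible_join[OF g] in \<open>auto simp: joinpaths_def\<close>)
  then show "riem_dist M g x z \<le> riem_dist M g x y + riem_dist M g y z + e"
    using admissible_join(2)[OF g \<gamma>(1) \<delta>(1)] \<gamma> \<delta> by simp
qed

lemma riem_dist_sym:
  assumes g: "quadratic_metric g"
  shows "riem_dist M g y x = riem_dist M g x y"
proof -
  have "{curve_length g \<gamma> | \<gamma>. admissible_curve M g \<gamma> \<and> \<gamma> 0 = x \<and> \<gamma> 1 = y}
     \<subseteq> {curve_length g \<gamma> | \<gamma>. admissible_curve M g \<gamma> \<and> \<gamma> 0 = y \<and> \<gamma> 1 = x}" for x y
  proof clarify
    fix \<gamma> assume "admissible_curve M g \<gamma>"
    then show "\<exists>\<gamma>'. curve_length g \<gamma> = curve_length g \<gamma>' \<and> admissible_curve M g \<gamma>' \<and>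
                  \<gamma>' 0 = \<gamma> 1 \<and> \<gamma>' 1 = \<gamma> 0"
      using admissible_reverse[OF g] by (intro exI[of _ "reversepath \<gamma>"]) (simp add: reversepath_def)
  qed
  then show ?thesis unfolding riem_dist_def by (metis (no_types, lifting) subset_antisym)
qed

section \<open>Rotation matrices\<close>

lemma bounded_bilinear_matrix_mult: "bounded_bilinear ((**) :: real^'n^'m \<Rightarrow> real^'k^'n \<Rightarrow> real^'k^'m)"
  unfolding bilinear_conv_bounded_bilinear[symmetric] bilinear_def
  by (intro conjI allI linearI)
     (simp_all add: vec_eq_iff matrix_matrix_mult_def sum.distrib algebra_simps sum_distrib_left)

lemma bounded_linear_transpose: "bounded_linear (transpose :: real^'n^'m \<Rightarrow> real^'m^'n)"
  unfolding linear_conv_bounded_linear[symmetric]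
  by (intro linearI) (simp_all add: vec_eq_iff transpose_def)

lemmas matrix_minus_ldistrib = bounded_bilinear.diff_right[OF bounded_bilinear_matrix_mult]
lemmas matrix_minus_rdistrib = bounded_bilinear.diff_left[OF bounded_bilinear_matrix_mult]
lemmas matrix_plus_rdistrib = bounded_bilinear.add_left[OF bounded_bilinear_matrix_mult]
lemmas matrix_scaleR_left = bounded_bilinear.scaleR_left[OF bounded_bilinear_matrix_mult]
lemmas matrix_scaleR_right = bounded_bilinear.scaleR_right[OF bounded_bilinear_matrix_mult]
lemmas transpose_plus = linear_add[OF bounded_linear.linear[OF bounded_linear_transpose]]
lemmas transpose_minus = linear_diff[OF bounded_linear.linear[OF bounded_linear_transpose]]
lemmas transpose_scaleR = linear_scale[OF bounded_linear.linear[OF bounded_linear_transpose]]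

lemma continuous_on_matrix_mult [continuous_intros]:
  fixes f :: "'a::topological_space \<Rightarrow> real^'n^'m" and g :: "'a \<Rightarrow> real^'k^'n"
  shows "continuous_on S f \<Longrightarrow> continuous_on S g \<Longrightarrow> continuous_on S (\<lambda>x. f x ** g x)"
  by (rule bounded_bilinear.continuous_on[OF bounded_bilinear_matrix_mult])

lemma continuous_on_transpose [continuous_intros]:
  fixes f :: "'a::topological_space \<Rightarrow> real^'n^'m"
  shows "continuous_on S f \<Longrightarrow> continuous_on S (\<lambda>x. transpose (f x))"
  by (rule bounded_linear.continuous_on[OF bounded_linear_transpose])

lemma inner_matrix_trace: "(A::real^'n^'m) \<bullet> B = trace (transpose A ** B)"
  unfolding trace_def matrix_matrix_mult_def inner_vec_def transpose_def
  by (simp, subst sum.swap) simp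

lemma SO_iff: "U \<in> SO \<longleftrightarrow> transpose U ** U = mat 1 \<and> det U = 1"
  by (simp add: SO_def rotation_matrix_def orthogonal_matrix)

lemma SO_transpose_mult: "U \<in> SO \<Longrightarrow> transpose U ** U = mat 1"
  by (simp add: SO_iff)

lemma SO_mult_transpose: "U \<in> SO \<Longrightarrow> U ** transpose U = mat 1"
  by (simp add: SO_iff matrix_left_right_inverse)

lemma SO_one: "mat 1 \<in> SO"
  by (simp add: SO_iff)

lemma SO_transpose: "U \<in> SO \<Longrightarrow> transpose U \<in> SO"
  by (simp add: SO_iff matrix_left_right_inverse)

lemma SO_mult: "U \<in> SO \<Longrightarrow> V \<in> SO \<Longrightarrow> U ** V \<in> SO"
  unfolding SO_def rotation_matrix_def by (simp add: orthogonal_matrix_mul det_mul)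

lemma matrix_inv_unique:
  fixes A :: "real^'n^'n"
  assumes "B ** A = mat 1"
  shows "matrix_inv A = B"
proof -
  have AB: "A ** B = mat 1" using assms by (simp add: matrix_left_right_inverse)
  have inv: "invertible A" using assms AB unfolding invertible_def by blast
  have "A ** matrix_inv A = mat 1"
    using someI_ex[OF inv[unfolded invertible_def]] by (simp add: matrix_inv_def)
  have "matrix_inv A = (B ** A) ** matrix_inv A" by (simp add: assms)
  also have "\<dots> = B ** (A ** matrix_inv A)" by (simp add: matrix_mul_assoc)
  also have "\<dots> = B" using \<open>A ** matrix_inv A = mat 1\<close> by simp
  finally show ?thesis .
qed

lemma SO_matrix_inv: "U \<in> SO \<Longrightarrow> matrix_inv U = transpose U"
  by (rule matrix_inv_unique) (rule SO_transpose_mult)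

lemma SO_cancel:
  assumes "U \<in> SO"
  shows "transpose U ** (U ** A) = A" "U ** (transpose U ** A) = A"
    "(A ** U) ** transpose U = A" "(A ** transpose U) ** U = A"
  using SO_transpose_mult[OF assms] SO_mult_transpose[OF assms]
  by (simp_all add: matrix_mul_assoc) (simp_all flip: matrix_mul_assoc)

lemma norm_SO_mult:
  assumes "U \<in> SO"
  shows "norm (U ** (A::real^'n^'n)) = norm A"
  unfolding norm_eq_sqrt_inner inner_matrix_trace matrix_transpose_mul
  by (simp only: SO_cancel(1)[OF assms] flip: matrix_mul_assoc)

lemma continuous_on_det [continuous_intros]:
  fixes f :: "'a::topological_space \<Rightarrow> real^'n^'n"
  assumes "continuous_on S f"
  shows "continuous_on S (\<lambda>x. det (f x))"
  unfolding det_def by (intro continuous_intros assms)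

lemma compact_SO: "compact (SO :: (real^'n^'n) set)"
proof -
  have "closed (SO :: (real^'n^'n) set)"
  proof -
    have "SO = {U::real^'n^'n. transpose U ** U = mat 1} \<inter> {U. det U = 1}"
      by (auto simp: SO_iff)
    also have "closed \<dots>"
      by (intro closed_Int closed_Collect_eq continuous_intros)
    finally show ?thesis .
  qed
  moreover have "bounded (SO :: (real^'n^'n) set)"
    unfolding bounded_iff
  proof (intro exI ballI)
    fix U :: "real^'n^'n" assume "U \<in> SO"
    then show "norm U \<le> norm (mat 1 :: real^'n^'n)"
      using norm_SO_mult[of U "mat 1"] by simp
  qed
  ultimately show ?thesis by (simp add: compact_eq_bounded_closed)
qed

section \<open>Stabilisers and their identity components\<close>

lemma stab_iff: "R \<in> stab D \<longleftrightarrow> R \<in> SO \<and> R ** D = D ** R"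
proof
  assume "R \<in> stab D"
  then have R: "R \<in> SO" "R ** D ** transpose R = D" by (auto simp: stab_def)
  have "R ** D = (R ** D ** transpose R) ** R" by (simp only: SO_cancel(4)[OF R(1)])
  then show "R \<in> SO \<and> R ** D = D ** R" using R by simp
next
  assume "R \<in> SO \<and> R ** D = D ** R"
  then show "R \<in> stab D"
    using SO_cancel(3) by (auto simp: stab_def)
qed

lemma compact_stab: "compact (stab D)"
proof -
  have "stab D = SO \<inter> {R. R ** D ** transpose R = D}" by (auto simp: stab_def)
  also have "compact \<dots>"
    by (intro compact_Int_closed closed_Collect_eq continuous_intros compact_SO)
  finally show ?thesis .
qed

lemma stab_one: "mat 1 \<in> stab D"
  by (simp add: stab_iff SO_one)

lemma stab_mult: "R \<in> stab D \<Longrightarrow> S \<in> stab D \<Longrightarrow> R ** S \<in> stab D"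
  unfolding stab_iff by (metis SO_mult matrix_mul_assoc)

lemma stab_transpose:
  assumes "R \<in> stab D"
  shows "transpose R \<in> stab D"
proof -
  have R: "R \<in> SO" "R ** D = D ** R" using assms by (auto simp: stab_iff)
  have "transpose R ** D = transpose R ** (D ** R) ** transpose R"
    using SO_cancel(3)[OF R(1), of "transpose R ** D"] by (simp add: matrix_mul_assoc)
  also have "\<dots> = D ** transpose R"
    using SO_cancel(1)[OF R(1), of D] by (simp flip: R(2))
  finally show ?thesis using R SO_transpose by (simp add: stab_iff)
qed

lemma stab0_subset: "stab0 D \<subseteq> stab D"
  by (simp add: stab0_def connected_component_subset)

lemma stab0_SO: "R \<in> stab0 D \<Longrightarrow> R \<in> SO"
  using stab0_subset stab_iff by blast

lemma stab0_one: "mat 1 \<in> stab0 D"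
  by (simp add: stab0_def connected_component_refl stab_one)

text \<open>
  How membership in the identity component is established throughout: join the element by a
  connected subset of the stabiliser to one already known to belong.
\<close>

lemma stab0_maximal:
  assumes "connected T" "T \<subseteq> stab D" "x \<in> T" "x \<in> stab0 D" "y \<in> T"
  shows "y \<in> stab0 D"
  using assms connected_component_maximal[of x T "stab D"] connected_component_eq[of x "stab D" "mat 1"]
  unfolding stab0_def by blast

lemma connected_stab0: "connected (stab0 D)"
  by (simp add: stab0_def)

lemma compact_stab0: "compact (stab0 D)"
proof -
  have "closed (stab0 D)"
    unfolding stab0_def by (intro closed_connected_component compact_imp_closed compact_stab)
  then have "compact (stab D \<inter> stab0 D)" by (intro compact_Int_closed compact_stab)
  then show ?thesis using stab0_subset[of D] by (simp add: Int_absorb1)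
qed

lemma stab0_mult:
  assumes "R \<in> stab0 D" "S \<in> stab0 D"
  shows "R ** S \<in> stab0 D"
proof (rule stab0_maximal)
  show "connected ((\<lambda>S. R ** S) ` stab0 D)"
    by (intro connected_continuous_image continuous_intros connected_stab0)
  show "(\<lambda>S. R ** S) ` stab0 D \<subseteq> stab D"
    using assms(1) stab0_subset stab_mult by blast
  show "R \<in> (\<lambda>S. R ** S) ` stab0 D"
    using stab0_one by (intro image_eqI[of _ _ "mat 1"]) auto
qed (use assms in auto)

lemma stab0_transpose:
  assumes "R \<in> stab0 D"
  shows "transpose R \<in> stab0 D"
proof (rule stab0_maximal)
  show "connected (transpose ` stab0 D)"
    by (intro connected_continuous_image continuous_intros connected_stab0)
  show "transpose ` stab0 D \<subseteq> stab D"
    using stab0_subset stab_transpose by blast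
  show "mat 1 \<in> transpose ` stab0 D"
    using stab0_one by (intro image_eqI[of _ _ "mat 1"]) auto
qed (use assms stab0_one in auto)

section \<open>Diagonalising a stabiliser element by plane rotations\<close>

definition diagonal_matrix :: "real^'n^'n \<Rightarrow> bool" where
  "diagonal_matrix D \<longleftrightarrow> (\<forall>i j. i \<noteq> j \<longrightarrow> D $ i $ j = 0)"

lemma diagonal_mult:
  assumes "diagonal_matrix D"
  shows "(D ** A) $ r $ s = D $ r $ r * A $ r $ s" "(A ** D) $ r $ s = A $ r $ s * D $ s $ s"
proof -
  have "(\<Sum>k\<in>UNIV. D $ r $ k * A $ k $ s) = (\<Sum>k\<in>UNIV. if k = r then D $ r $ r * A $ r $ s else 0)"
    using assms by (intro sum.cong) (auto simp: diagonal_matrix_def)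
  then show "(D ** A) $ r $ s = D $ r $ r * A $ r $ s" by (simp add: matrix_matrix_mult_def)
  have "(\<Sum>k\<in>UNIV. A $ r $ k * D $ k $ s) = (\<Sum>k\<in>UNIV. if k = s then A $ r $ s * D $ s $ s else 0)"
    using assms by (intro sum.cong) (auto simp: diagonal_matrix_def)
  then show "(A ** D) $ r $ s = A $ r $ s * D $ s $ s" by (simp add: matrix_matrix_mult_def)
qed

definition plane_rotation :: "'n::finite \<Rightarrow> 'n \<Rightarrow> real \<Rightarrow> real^'n^'n" where
  "plane_rotation i j \<theta> = (\<chi> r s.
     if r = i then (if s = i then cos \<theta> else if s = j then - sin \<theta> else 0)
     else if r = j then (if s = i then sin \<theta> else if s = j then cos \<theta> else 0)
     else if r = s then 1 else 0)"

lemma plane_rotation_mult: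
  assumes "i \<noteq> j"
  shows "(plane_rotation i j \<theta> ** A) $ r $ s =
     (if r = i then cos \<theta> * A $ i $ s - sin \<theta> * A $ j $ s
      else if r = j then sin \<theta> * A $ i $ s + cos \<theta> * A $ j $ s
      else A $ r $ s)"
proof -
  have *: "(\<Sum>k\<in>UNIV. (if k = i then a else if k = j then b else 0) * A $ k $ s) = a * A $ i $ s + b * A $ j $ s"
    for a b
  proof -
    have "(if k = i then a else if k = j then b else 0) * A $ k $ s =
       (if k = i then a * A $ i $ s else 0) + (if k = j then b * A $ j $ s else 0)" for k
      using assms by simp
    then show ?thesis by (simp add: sum.distrib)
  qed
  have **: "(\<Sum>k\<in>UNIV. (if r = k then 1 else 0) * A $ k $ s) = A $ r $ s"
  proof -
    have "(if r = k then 1 else 0) * A $ k $ s = (if k = r then A $ k $ s else 0)" for k by simp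
    then show ?thesis by simp
  qed
  show ?thesis
    using assms unfolding matrix_matrix_mult_def plane_rotation_def
    by (simp add: * **)
qed

lemma plane_rotation_add:
  assumes "i \<noteq> j"
  shows "plane_rotation i j \<alpha> ** plane_rotation i j \<beta> = plane_rotation i j (\<alpha> + \<beta>)"
  unfolding vec_eq_iff plane_rotation_mult[OF assms]
  using assms by (auto simp: plane_rotation_def cos_add sin_add)

lemma plane_rotation_0: "plane_rotation i j 0 = mat 1"
  by (auto simp: plane_rotation_def mat_def vec_eq_iff)

lemma transpose_plane_rotation: "transpose (plane_rotation i j \<theta>) = plane_rotation i j (- \<theta>)"
  by (auto simp: plane_rotation_def transpose_def vec_eq_iff)

text \<open>
  The determinant is a square by the addition formula, which excludes the value \<open>-1\<close>.
\<close>

lemma plane_rotation_SO: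
  assumes "i \<noteq> j"
  shows "plane_rotation i j \<theta> \<in> SO"
proof -
  have orth: "transpose (plane_rotation i j t) ** plane_rotation i j t = mat 1" for t
    by (simp add: transpose_plane_rotation plane_rotation_add[OF assms] plane_rotation_0)
  have "det (plane_rotation i j (\<theta> / 2)) = 1 \<or> det (plane_rotation i j (\<theta> / 2)) = -1"
    by (rule det_orthogonal_matrix) (simp add: orthogonal_matrix orth)
  moreover have "plane_rotation i j \<theta> = plane_rotation i j (\<theta> / 2) ** plane_rotation i j (\<theta> / 2)"
    by (simp add: plane_rotation_add[OF assms])
  ultimately have "det (plane_rotation i j \<theta>) = 1" by (auto simp: det_mul)
  then show ?thesis using orth by (simp add: SO_iff)
qed

lemma continuous_on_plane_rotation: "continuous_on S (plane_rotation i j)"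
  unfolding plane_rotation_def
proof (intro continuous_on_vec_lambda)
  fix r s
  show "continuous_on S (\<lambda>\<theta>. if r = i then if s = i then cos \<theta> else if s = j then - sin \<theta> else 0
      else if r = j then if s = i then sin \<theta> else if s = j then cos \<theta> else 0
      else if r = s then 1 else 0)"
    by (cases "r = i"; cases "r = j"; cases "s = i"; cases "s = j"; simp; intro continuous_intros)
qed

lemma plane_rotation_stab:
  assumes "i \<noteq> j" "diagonal_matrix D" "D $ i $ i = D $ j $ j"
  shows "plane_rotation i j \<theta> \<in> stab D"
proof -
  have "plane_rotation i j \<theta> ** D = D ** plane_rotation i j \<theta>"
  proof (unfold vec_eq_iff diagonal_mult[OF assms(2)], intro allI)
    fix r s
    show "plane_rotation i j \<theta> $ r $ s * D $ s $ s = D $ r $ r * plane_rotation i j \<theta> $ r $ s"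
      using assms(1,3)
      by (cases "r = i"; cases "r = j"; cases "s = i"; cases "s = j") (simp_all add: plane_rotation_def)
  qed
  then show ?thesis using plane_rotation_SO[OF assms(1)] by (simp add: stab_iff)
qed

lemma plane_rotation_stab0:
  assumes "i \<noteq> j" "diagonal_matrix D" "D $ i $ i = D $ j $ j" "Q \<in> stab0 D"
  shows "plane_rotation i j \<theta> ** Q \<in> stab0 D"
proof (rule stab0_maximal)
  let ?T = "range (\<lambda>\<theta>. plane_rotation i j \<theta> ** Q)"
  show "connected ?T"
    by (intro connected_continuous_image continuous_intros continuous_on_plane_rotation) simp
  show "?T \<subseteq> stab D"
    using plane_rotation_stab[OF assms(1-3)] stab_mult stab0_subset assms(4) by blast
  show "Q \<in> ?T"
    by (rule image_eqI[of _ _ 0]) (simp_all add: plane_rotation_0)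
qed (use assms in auto)

text \<open>
  The left-hand side attains \<open>\<surd>(a\<^sup>2 + b\<^sup>2)\<close>, which exceeds \<open>a\<close> unless \<open>b = 0\<close> and \<open>a \<ge> 0\<close>.
\<close>

lemma trig_max_at_0:
  assumes "\<And>\<theta>. a * cos \<theta> + b * sin \<theta> \<le> (a::real)"
  shows "a \<ge> 0" "b = 0"
proof -
  show a: "a \<ge> 0" using assms[of pi] by simp
  define N where "N = sqrt (a\<^sup>2 + b\<^sup>2)"
  show "b = 0"
  proof (rule ccontr)
    assume "b \<noteq> 0"
    then have pos: "a\<^sup>2 + b\<^sup>2 > 0" by (simp add: add_nonneg_pos)
    then have N: "N > 0" "N\<^sup>2 = a\<^sup>2 + b\<^sup>2" unfolding N_def by (simp_all only: real_sqrt_gt_0_iff real_sqrt_pow2 less_imp_le)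
    have "(a / N)\<^sup>2 + (b / N)\<^sup>2 = (a\<^sup>2 + b\<^sup>2) / N\<^sup>2"
      by (simp add: power_divide add_divide_distrib)
    also have "\<dots> = 1" unfolding N(2)[symmetric] using N(1) by simp
    finally have "(a / N)\<^sup>2 + (b / N)\<^sup>2 = 1" .
    then obtain \<theta> where "a / N = cos \<theta>" "b / N = sin \<theta>"
      using sincos_total_2pi by metis
    then have "a * (a / N) + b * (b / N) \<le> a" using assms by simp
    moreover have "a * (a / N) + b * (b / N) = N\<^sup>2 / N"
      unfolding N(2) by (simp add: power2_eq_square add_divide_distrib)
    ultimately have "N \<le> a" using N(1) by (simp add: power2_eq_square)
    then have "N\<^sup>2 \<le> a\<^sup>2" using N(1) by (intro power_mono) auto
    then show False using N(2) \<open>b \<noteq> 0\<close> by simp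
  qed
qed

text \<open>
  With \<open>N\<close> the diagonal matrix of the weights, the hypothesis says that \<open>A N\<close> is symmetric.
  For orthogonal \<open>A\<close> this makes \<open>A\<close> commute with \<open>N\<^sup>2\<close>, whose diagonal entries are distinct.
\<close>

lemma weighted_symmetric_imp_diagonal:
  fixes A :: "real^'n^'n"
  assumes A: "A \<in> SO" and n: "inj n" "\<And>i. n i > 0"
    and sym: "\<And>i j. n j * A $ i $ j = n i * A $ j $ i" and "i \<noteq> j"
  shows "A $ i $ j = 0"
proof -
  define N :: "real^'n^'n" where "N = (\<chi> i j. if i = j then n i else 0)"
  have N: "diagonal_matrix N" by (simp add: N_def diagonal_matrix_def)
  have NN: "N $ i $ i = n i" for i by (simp add: N_def)
  have 1: "A ** N = N ** transpose A"
    unfolding vec_eq_iff diagonal_mult[OF N] NN using sym by (simp add: transpose_def mult.commute)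
  have 2: "N = A ** (N ** A)"
    using SO_transpose_mult[OF A] 1 by (metis matrix_mul_assoc matrix_mul_rid)
  have 3: "transpose A ** N = N ** A"
    using SO_cancel(1)[OF A, of "N ** A"] 2 by simp
  have "N ** (N ** A) = (A ** N) ** N"
    using 1 3 by (metis matrix_mul_assoc)
  then have "(N ** (N ** A)) $ i $ j = ((A ** N) ** N) $ i $ j" by simp
  then have "n i * (n i * A $ i $ j) = A $ i $ j * n j * n j"
    by (simp only: diagonal_mult[OF N] NN)
  then have "A $ i $ j * ((n i)\<^sup>2 - (n j)\<^sup>2) = 0"
    by (simp add: power2_eq_square algebra_simps)
  moreover have "(n i)\<^sup>2 \<noteq> (n j)\<^sup>2"
    using n assms(5) by (metis inj_eq less_eq_real_def power2_eq_iff_nonneg)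
  ultimately show ?thesis by simp
qed

text \<open>
  Let \<open>Q\<close> maximise the trace of \<open>N Q R\<close> over the compact set \<open>G\<^sub>D\<^sup>0\<close>, where \<open>N\<close> is diagonal with
  distinct positive weights. If \<open>D\<^sub>i\<^sub>i = D\<^sub>j\<^sub>j\<close>, multiplication of \<open>Q\<close> by a rotation in the plane of the
  coordinates \<open>i, j\<close> stays in \<open>G\<^sub>D\<^sup>0\<close>, and the trace varies as \<open>a cos \<theta> + b sin \<theta>\<close> plus a constant. So
  \<open>b = 0\<close>, the hypothesis of the preceding lemma, and \<open>a \<ge> 0\<close>, which allows at most one negative
  diagonal entry for each eigenvalue of \<open>D\<close>.
\<close>

lemma stab0_diagonalise:
  fixes D :: "real^'n^'n"
  assumes D: "diagonal_matrix D" and R: "R \<in> stab D"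
  obtains Q where "Q \<in> stab0 D" "diagonal_matrix (Q ** R)"
    "\<And>i j. i \<noteq> j \<Longrightarrow> D $ i $ i = D $ j $ j \<Longrightarrow> (Q ** R) $ i $ i < 0 \<Longrightarrow> (Q ** R) $ j $ j \<ge> 0"
proof -
  obtain f :: "'n \<Rightarrow> nat" where f: "inj f"
    using finite_imp_inj_to_nat_seg[of "UNIV :: 'n set"] by auto
  define n where "n i = real (Suc (f i))" for i
  have n: "inj n" "\<And>i. n i > 0"
    using f by (auto simp: n_def inj_def)
  define h where "h Q = (\<Sum>i\<in>UNIV. n i * (Q ** R) $ i $ i)" for Q
  have "continuous_on (stab0 D) h"
    unfolding h_def by (intro continuous_intros)
  then obtain Q where Q: "Q \<in> stab0 D" "\<And>Q'. Q' \<in> stab0 D \<Longrightarrow> h Q' \<le> h Q"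
    using continuous_attains_sup[OF compact_stab0, of D h] stab0_one by blast
  define A where "A = Q ** R"
  have A: "A \<in> stab D" unfolding A_def using Q(1) R stab0_subset stab_mult by blast
  have crit: "n i * A $ i $ i + n j * A $ j $ j \<ge> 0" "n j * A $ i $ j - n i * A $ j $ i = 0"
    if ij: "i \<noteq> j" "D $ i $ i = D $ j $ j" for i j
  proof -
    have "(n i * A $ i $ i + n j * A $ j $ j) * cos \<theta> + (n j * A $ i $ j - n i * A $ j $ i) * sin \<theta>
      \<le> n i * A $ i $ i + n j * A $ j $ j" for \<theta>
    proof -
      let ?G = "plane_rotation i j \<theta>"
      have eq: "n r * (?G ** A) $ r $ r = n r * A $ r $ r
         + (if r = i then n i * ((cos \<theta> - 1) * A $ i $ i - sin \<theta> * A $ j $ i) else 0)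
         + (if r = j then n j * (sin \<theta> * A $ i $ j + (cos \<theta> - 1) * A $ j $ j) else 0)" for r
        unfolding plane_rotation_mult[OF ij(1)] using ij(1) by (auto simp: algebra_simps)
      have "h (?G ** Q) = (\<Sum>r\<in>UNIV. n r * (?G ** A) $ r $ r)"
        by (simp add: h_def A_def matrix_mul_assoc)
      also have "\<dots> = h Q + n i * ((cos \<theta> - 1) * A $ i $ i - sin \<theta> * A $ j $ i)
         + n j * (sin \<theta> * A $ i $ j + (cos \<theta> - 1) * A $ j $ j)"
        unfolding eq by (simp add: sum.distrib h_def A_def)
      finally show ?thesis
        using Q(2)[OF plane_rotation_stab0[OF ij(1) D ij(2) Q(1)], of \<theta>]
        by (simp add: algebra_simps)
    qed
    from trig_max_at_0[OF this]
    show "n i * A $ i $ i + n j * A $ j $ j \<ge> 0" "n j * A $ i $ j - n i * A $ j $ i = 0"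
      by auto
  qed
  have sym: "n j * A $ i $ j = n i * A $ j $ i" for i j
  proof (cases "i = j \<or> D $ i $ i = D $ j $ j")
    case True
    then show ?thesis using crit(2)[of i j] by fastforce
  next
    case False
    have *: "A $ r $ s * D $ s $ s = D $ r $ r * A $ r $ s" for r s
    proof -
      have "A ** D = D ** A" using A by (simp add: stab_iff)
      then have "(A ** D) $ r $ s = (D ** A) $ r $ s" by simp
      then show ?thesis by (simp only: diagonal_mult[OF D])
    qed
    show ?thesis using *[of i j] *[of j i] False by auto
  qed
  have "A \<in> SO" using A by (simp add: stab_iff)
  then have diag: "diagonal_matrix A"
    using weighted_symmetric_imp_diagonal[OF _ n sym] by (simp add: diagonal_matrix_def)
  show thesis
  proof (rule that[OF Q(1)], fold A_def)
    fix i j assume "i \<noteq> j" "D $ i $ i = D $ j $ j" "A $ i $ i < 0"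
    then have "n i * A $ i $ i < 0" "n i * A $ i $ i + n j * A $ j $ j \<ge> 0"
      using crit(1) n(2) by (auto simp: mult_pos_neg)
    then have "n j * A $ j $ j > 0" by linarith
    then show "A $ j $ j \<ge> 0" using n(2)[of j] by (simp add: zero_less_mult_iff)
  qed (rule diag)
qed

lemma orthogonal_diagonal_entries:
  fixes A :: "real^'n^'n"
  assumes "A \<in> SO" "diagonal_matrix A"
  shows "A $ i $ i = 1 \<or> A $ i $ i = -1"
proof -
  have "(transpose A ** A) $ i $ i = 1"
    using SO_transpose_mult[OF assms(1)] by (simp add: mat_def)
  then have "A $ i $ i * A $ i $ i = 1"
    by (simp add: diagonal_mult(2)[OF assms(2)] transpose_def)
  then show ?thesis by (simp add: square_eq_1_iff)
qed

text \<open>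
  For \<open>D = I\<close> the diagonalisation leaves at most one entry \<open>-1\<close> on the diagonal, and the
  determinant excludes even that. So every rotation lies in the identity component.
\<close>

lemma connected_SO: "connected (SO :: (real^'n^'n) set)"
proof -
  have "R \<in> stab0 (mat 1)" if R: "R \<in> SO" for R :: "real^'n^'n"
  proof -
    have "R \<in> stab (mat 1)" using R by (simp add: stab_iff)
    then obtain Q where Q: "Q \<in> stab0 (mat 1)" "diagonal_matrix (Q ** R)"
      "\<And>i j. i \<noteq> j \<Longrightarrow> (Q ** R) $ i $ i < 0 \<Longrightarrow> (Q ** R) $ j $ j \<ge> 0"
      using stab0_diagonalise[of "mat 1" R] by (auto simp: mat_def diagonal_matrix_def)
    have SO: "Q ** R \<in> SO" using Q(1) stab0_SO SO_mult R by blast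
    note e = orthogonal_diagonal_entries[OF SO Q(2)]
    have pr: "(\<Prod>i\<in>UNIV. (Q ** R) $ i $ i) = 1"
      using SO det_diagonal[of "Q ** R"] Q(2) by (simp add: SO_iff diagonal_matrix_def)
    have "(Q ** R) $ i $ i = 1" for i
    proof (rule ccontr)
      assume "(Q ** R) $ i $ i \<noteq> 1"
      then have i: "(Q ** R) $ i $ i = -1" using e by blast
      have "(Q ** R) $ j $ j = 1" if "j \<noteq> i" for j
        using Q(3)[of i j] that i e[of j] by auto
      then have "(\<Prod>j\<in>UNIV - {i}. (Q ** R) $ j $ j) = 1" by (intro prod.neutral) auto
      then show False using pr prod.remove[of UNIV i "\<lambda>j. (Q ** R) $ j $ j"] i by simp
    qed
    then have "Q ** R = mat 1" using Q(2) by (auto simp: vec_eq_iff mat_def diagonal_matrix_def)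
    then have "R = transpose Q"
      using SO_cancel(1)[OF stab0_SO[OF Q(1)], of R] by simp
    then show ?thesis using stab0_transpose Q(1) by simp
  qed
  then have "SO = stab0 (mat 1 :: real^'n^'n)" using stab0_SO by blast
  then show ?thesis using connected_stab0[of "mat 1 :: real^'n^'n"] by simp
qed

section \<open>The distance on the rotation group\<close>

lemma matrix_neg_left: "(- A) ** (B::real^'n^'n) = - (A ** B)"
  by (rule bounded_bilinear.minus_left[OF bounded_bilinear_matrix_mult])
lemma matrix_neg_right: "(A::real^'n^'n) ** (- B) = - (A ** B)"
  by (rule bounded_bilinear.minus_right[OF bounded_bilinear_matrix_mult])
lemma trace_neg: "trace (- A :: real^'n^'n) = - trace A"
  by (simp add: trace_def sum_negf)
lemmas matrix_ring = matrix_add_ldistrib matrix_plus_rdistrib matrix_minus_ldistrib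
  matrix_minus_rdistrib matrix_scaleR_left matrix_scaleR_right matrix_neg_left matrix_neg_right

lemma g_SO_tangent:
  assumes "U \<in> SO" "transpose A ** U + transpose U ** A = 0"
  shows "g_SO U A A = (norm A)\<^sup>2 / 2"
proof -
  have *: "transpose U ** A = - (transpose A ** U)"
    using assms(2) by (simp add: add_eq_0_iff)
  have "(transpose U ** A) ** (transpose U ** A) = - (transpose A ** (U ** (transpose U ** A)))"
    by (subst (1) *) (simp add: matrix_neg_left matrix_mul_assoc)
  also have "\<dots> = - (transpose A ** A)" by (simp only: SO_cancel(2)[OF assms(1)])
  finally show ?thesis
    unfolding g_SO_def SO_matrix_inv[OF assms(1)]
    by (simp add: trace_neg power2_norm_eq_inner inner_matrix_trace)
qed

lemma quadratic_metric_g_SO: "quadratic_metric g_SO"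
  by (simp add: quadratic_metric_def g_SO_def matrix_ring trace_def sum_distrib_left
      power2_eq_square mult.assoc)

text \<open>
  Differentiating \<open>\<gamma>\<^sup>T \<gamma> = I\<close> shows that \<open>\<gamma>\<^sup>T \<gamma>'\<close> is skew, and on skew matrices the form
  \<open>-tr(A\<^sup>2)/2\<close> is half the squared Frobenius norm.
\<close>

lemma speed_SO:
  assumes "\<gamma> ` {0..1} \<subseteq> SO" "t \<in> {0<..<1}" "(\<gamma> has_vector_derivative \<gamma>') (at t)"
  shows "speed g_SO \<gamma> t = norm \<gamma>' / sqrt 2"
proof -
  have "((\<lambda>s. transpose (\<gamma> s) ** \<gamma> s) has_vector_derivative
      (transpose (\<gamma> t) ** \<gamma>' + transpose \<gamma>' ** \<gamma> t)) (at t)"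
    by (intro bounded_bilinear.has_vector_derivative[OF bounded_bilinear_matrix_mult]
        bounded_linear.has_vector_derivative[OF bounded_linear_transpose] assms(3))
  moreover have "((\<lambda>s. transpose (\<gamma> s) ** \<gamma> s) has_vector_derivative 0) (at t)"
  proof (rule has_vector_derivative_transform_within_open)
    show "((\<lambda>s. mat 1 :: real^'a^'a) has_vector_derivative 0) (at t)" by simp
    show "open {0<..<1::real}" by simp
    fix s :: real assume "s \<in> {0<..<1}"
    then have "\<gamma> s \<in> SO" using assms(1) by (simp add: image_subset_iff)
    then show "mat 1 = transpose (\<gamma> s) ** \<gamma> s" by (simp add: SO_transpose_mult)
  qed (rule assms)
  ultimately have "transpose (\<gamma> t) ** \<gamma>' + transpose \<gamma>' ** \<gamma> t = 0"
    by (rule vector_derivative_unique_at)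
  moreover have "\<gamma> t \<in> SO" using assms(1,2) by (simp add: image_subset_iff)
  ultimately have "g_SO (\<gamma> t) \<gamma>' \<gamma>' = (norm \<gamma>')\<^sup>2 / 2"
    by (intro g_SO_tangent) (simp_all only: add.commute)
  then show ?thesis
    unfolding speed_def vector_derivative_at[OF assms(3)] by (simp only: real_sqrt_divide real_sqrt_abs abs_norm_cancel)
qed

lemma curve_length_SO_nonneg:
  assumes "admissible_curve SO g_SO \<gamma>"
  shows "0 \<le> curve_length g_SO \<gamma>"
proof -
  have pc: "\<gamma> piecewise_C1_differentiable_on {0..1}" and M: "\<gamma> ` {0..1} \<subseteq> SO"
    using assms unfolding admissible_curve_def by auto
  obtain S where S: "finite S" "0 \<in> S" "1 \<in> S"
    "\<And>t. t \<in> {0..1} - S \<Longrightarrow> (\<gamma> has_vector_derivative vector_derivative \<gamma> (at t)) (at t)"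
    using piecewise_C1_regular[OF pc] by metis
  have "speed g_SO \<gamma> t = norm (vector_derivative \<gamma> (at t)) / sqrt 2" if t: "t \<in> {0..1} - S" for t
  proof -
    have "t \<in> {0<..<1}" using t S(2,3) by (cases "t = 0"; cases "t = 1"; auto)
    then show ?thesis by (rule speed_SO[OF M _ S(4)[OF t]])
  qed
  then have "((\<lambda>t. norm (vector_derivative \<gamma> (at t)) / sqrt 2) has_integral curve_length g_SO \<gamma>) {0..1}"
    by (intro has_integral_spike_finite[OF S(1) _ has_integral_speed[OF assms]]) auto
  then show ?thesis by (rule has_integral_nonneg) simp
qed

lemma inner_skew:
  fixes A X :: "real^'n^'n"
  assumes "transpose A = - A"
  shows "X \<bullet> (A ** X) = 0"
proof -
  have "X \<bullet> (A ** X) = (A ** X) \<bullet> X" by (rule inner_commute)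
  also have "\<dots> = trace (transpose X ** transpose A ** X)"
    by (simp add: inner_matrix_trace matrix_transpose_mul)
  also have "\<dots> = - (X \<bullet> (A ** X))"
    unfolding assms inner_matrix_trace by (simp add: matrix_ring trace_neg matrix_mul_assoc)
  finally show ?thesis by simp
qed

text \<open>
  For skew \<open>A\<close> the matrices \<open>X\<close> and \<open>A X\<close> are orthogonal.
\<close>

lemma skew_expanding:
  fixes A X :: "real^'n^'n"
  assumes "transpose A = - A"
  shows "norm X \<le> norm ((mat 1 + A) ** X)"
proof -
  have "X \<bullet> ((mat 1 + A) ** X) = (norm X)\<^sup>2"
    by (simp add: matrix_ring inner_add_right inner_skew[OF assms] power2_norm_eq_inner)
  then have "norm X * norm X \<le> norm X * norm ((mat 1 + A) ** X)"
    using norm_cauchy_schwarz[of X "(mat 1 + A) ** X"] by (simp add: power2_eq_square)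
  then show ?thesis by (cases "norm X = 0") (simp_all add: mult_le_cancel_left)
qed

text \<open>
  Left multiplication by \<open>M\<close> is an injective linear map of the space of matrices into itself,
  hence surjective; a preimage of the identity is the inverse.
\<close>

lemma expanding_imp_invertible:
  fixes M :: "real^'n^'n"
  assumes "\<And>X :: real^'n^'n. norm X \<le> norm (M ** X)"
  obtains B where "M ** B = mat 1" "B ** M = mat 1" "\<And>X :: real^'n^'n. norm (B ** X) \<le> norm X"
proof -
  have lin: "linear (\<lambda>X :: real^'n^'n. M ** X)"
    by (rule bounded_linear.linear[OF bounded_bilinear.bounded_linear_right[OF bounded_bilinear_matrix_mult]])
  have "inj (\<lambda>X :: real^'n^'n. M ** X)"
    unfolding linear_injective_0[OF lin] using assms by (metis norm_le_zero_iff norm_zero)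
  then have "surj (\<lambda>X :: real^'n^'n. M ** X)" by (rule linear_injective_imp_surjective[OF lin _ refl])
  then obtain B where B: "M ** B = mat 1" by (metis surjD)
  then have B': "B ** M = mat 1" by (simp add: matrix_left_right_inverse)
  have "norm (B ** X) \<le> norm X" for X :: "real^'n^'n"
    using assms[of "B ** X"] B by (simp add: matrix_mul_assoc)
  then show thesis using that B B' by blast
qed

text \<open>
  The curve is the Cayley transform \<open>t \<mapsto> (I - t A)(I + t A)\<^sup>-\<^sup>1 = 2 (I + t A)\<^sup>-\<^sup>1 - I\<close>. Since
  \<open>I + t A\<close> does not decrease norms for skew \<open>A\<close>, its inverse is a contraction, which bounds the
  derivative \<open>-2 (I + t A)\<^sup>-\<^sup>1 A (I + t A)\<^sup>-\<^sup>1\<close> by \<open>2 \<parallel>A\<parallel>\<close>.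
\<close>

lemma cayley_curve:
  fixes A :: "real^'n^'n"
  assumes A: "transpose A = - A"
  obtains \<gamma> where "admissible_curve SO g_SO \<gamma>" "\<gamma> 0 = mat 1" "(mat 1 + A) ** (mat 1 + \<gamma> 1) = 2 *\<^sub>R mat 1"
    "curve_length g_SO \<gamma> \<le> sqrt 2 * norm A"
proof -
  have skew: "transpose (t *\<^sub>R A) = - (t *\<^sub>R A)" for t by (simp add: transpose_scaleR A)
  have "\<exists>B. (mat 1 + t *\<^sub>R A) ** B = mat 1 \<and> B ** (mat 1 + t *\<^sub>R A) = mat 1 \<and> (\<forall>X::real^'n^'n. norm (B ** X) \<le> norm X)" for t
    by (rule expanding_imp_invertible[OF skew_expanding[OF skew[of t]]]) blast
  then obtain B where B: "\<And>t. (mat 1 + t *\<^sub>R A) ** B t = mat 1" "\<And>t. B t ** (mat 1 + t *\<^sub>R A) = mat 1"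
    "\<And>t (X::real^'n^'n). norm (B t ** X) \<le> norm X" by metis
  \<comment> \<open>Commutation turns a bound for multiplication by \<open>B t\<close> from the left into one from the right.\<close>
  have comm: "A ** B t = B t ** A" for t
  proof -
    have "A ** B t = (B t ** (mat 1 + t *\<^sub>R A)) ** A ** B t" by (simp add: B)
    also have "\<dots> = B t ** A ** ((mat 1 + t *\<^sub>R A) ** B t)"
      by (simp add: matrix_ring flip: matrix_mul_assoc)
    finally show ?thesis by (simp add: B)
  qed
  \<comment> \<open>The resolvent identity.\<close>
  have diff: "B s - B t = (t - s) *\<^sub>R (B s ** A ** B t)" for s t
  proof -
    have "(t - s) *\<^sub>R (B s ** A ** B t) = B s ** ((mat 1 + t *\<^sub>R A) - (mat 1 + s *\<^sub>R A)) ** B t"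
      by (simp add: matrix_ring scaleR_diff_left)
    also have "\<dots> = B s ** ((mat 1 + t *\<^sub>R A) ** B t) - (B s ** (mat 1 + s *\<^sub>R A)) ** B t"
      by (simp only: matrix_minus_ldistrib matrix_minus_rdistrib matrix_mul_assoc)
    finally show ?thesis by (simp add: B)
  qed
  define B' where "B' t = - (B t ** A ** B t)" for t
  have derB: "(B has_vector_derivative B' t) (at t)" for t
    unfolding has_vector_derivative_def
  proof (rule has_derivativeI_sandwich[of 1])
    let ?K = "norm (A ** B t ** A ** B t)"
    show "bounded_linear (\<lambda>h. h *\<^sub>R B' t)" by (rule bounded_linear_scaleR_left)
    show "norm (B s - B t - (s - t) *\<^sub>R B' t) / norm (s - t) \<le> \<bar>s - t\<bar> * ?K" if "s \<noteq> t" for s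
    proof -
      have "B s - B t - (s - t) *\<^sub>R B' t = (t - s) *\<^sub>R ((B s - B t) ** A ** B t)"
      proof -
        have "B s - B t - (s - t) *\<^sub>R B' t
            = (t - s) *\<^sub>R (B s ** A ** B t) + (s - t) *\<^sub>R (B t ** A ** B t)"
          by (simp only: diff[of s t] B'_def scaleR_minus_right diff_minus_eq_add)
        then show ?thesis by (simp add: matrix_ring algebra_simps)
      qed
      also have "\<dots> = ((t - s) * (t - s)) *\<^sub>R (B s ** (A ** B t ** A ** B t))"
        unfolding diff by (simp add: matrix_ring matrix_mul_assoc)
      finally have "norm (B s - B t - (s - t) *\<^sub>R B' t) \<le> \<bar>s - t\<bar> * \<bar>s - t\<bar> * ?K"
        using B(3)[of s "A ** B t ** A ** B t"]
        by (simp add: abs_mult abs_minus_commute mult_left_mono)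
      then show ?thesis using that by (simp add: divide_simps mult_ac)
    qed
    have "((\<lambda>s. \<bar>s - t\<bar> * ?K) \<longlongrightarrow> \<bar>t - t\<bar> * ?K) (at t)"
      by (intro tendsto_intros)
    then show "((\<lambda>s. \<bar>s - t\<bar> * ?K) \<longlongrightarrow> 0) (at t)" by simp
  qed simp
  define \<gamma> where "\<gamma> t = 2 *\<^sub>R B t - mat 1" for t
  have der: "(\<gamma> has_vector_derivative 2 *\<^sub>R B' t) (at t)" for t
    unfolding \<gamma>_def by (auto intro!: derivative_eq_intros derB)
  have contB: "continuous_on S B" for S
    using derB by (intro differentiable_imp_continuous_on)
      (auto simp: differentiable_on_def has_vector_derivative_def differentiable_def intro: has_derivative_at_withinI)
  have contB': "continuous_on S B'" for S
    unfolding B'_def by (intro continuous_intros contB)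
  have "\<gamma> C1_differentiable_on {0..1}"
    unfolding C1_differentiable_on_def
    by (rule exI[of _ "\<lambda>t. 2 *\<^sub>R B' t"]) (auto intro!: der continuous_intros contB')
  moreover have "continuous_on {0..1} \<gamma>"
    unfolding \<gamma>_def by (intro continuous_intros contB)
  ultimately have pc: "\<gamma> piecewise_C1_differentiable_on {0..1}"
    unfolding piecewise_C1_differentiable_on_def by (intro conjI exI[of _ "{}"]) auto
  have \<gamma>: "\<gamma> t = (mat 1 - t *\<^sub>R A) ** B t" for t
  proof -
    have "\<gamma> t = 2 *\<^sub>R B t - (mat 1 + t *\<^sub>R A) ** B t" by (simp add: \<gamma>_def B)
    then show ?thesis by (simp add: matrix_ring algebra_simps scaleR_2)
  qed
  have tr: "transpose (mat 1 + t *\<^sub>R A) = mat 1 - t *\<^sub>R A" "transpose (mat 1 - t *\<^sub>R A) = mat 1 + t *\<^sub>R A" for t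
    by (simp_all add: transpose_plus transpose_minus transpose_scaleR A)
  have SO: "\<gamma> t \<in> SO" for t
  proof -
    have sw: "(mat 1 + t *\<^sub>R A) ** (mat 1 - t *\<^sub>R A) = (mat 1 - t *\<^sub>R A) ** (mat 1 + t *\<^sub>R A)"
      by (simp add: matrix_ring algebra_simps)
    have "transpose (\<gamma> t) ** \<gamma> t = transpose (B t) ** ((mat 1 + t *\<^sub>R A) ** (mat 1 - t *\<^sub>R A)) ** B t"
      unfolding \<gamma> matrix_transpose_mul tr by (simp only: matrix_mul_assoc)
    also have "\<dots> = (transpose (B t) ** (mat 1 - t *\<^sub>R A)) ** ((mat 1 + t *\<^sub>R A) ** B t)"
      unfolding sw by (simp only: matrix_mul_assoc)
    also have "\<dots> = transpose (B t) ** (mat 1 - t *\<^sub>R A)"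
      by (simp only: B(1) matrix_mul_rid)
    also have "\<dots> = transpose ((mat 1 + t *\<^sub>R A) ** B t)"
      by (simp only: matrix_transpose_mul tr)
    finally have "transpose (\<gamma> t) ** \<gamma> t = mat 1" by (simp add: B)
    moreover have "det (\<gamma> t) = det (mat 1 + t *\<^sub>R A) * det (B t)"
      unfolding \<gamma> det_mul tr(1)[symmetric] det_transpose ..
    then have "det (\<gamma> t) = 1" by (simp add: B flip: det_mul)
    ultimately show ?thesis by (simp add: SO_iff)
  qed
  let ?f = "\<lambda>t. norm (2 *\<^sub>R B' t) / sqrt 2"
  have "?f integrable_on {0..1}"
    by (intro integrable_continuous_real continuous_intros contB') auto
  then have int: "(?f has_integral integral {0..1} ?f) {0..1}" by (rule integrable_integral)
  have im: "\<gamma> ` {0..1} \<subseteq> SO" using SO by auto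
  have sp: "speed g_SO \<gamma> t = ?f t" if "t \<in> {0..1} - {0,1}" for t
    using that by (intro speed_SO[OF im _ der]) auto
  have "finite {0, 1::real}" by simp
  note adm = admissible_by_speed[OF pc im this sp int]
  have "norm (B' t) \<le> norm A" for t
  proof -
    have "norm (B' t) = norm (B t ** (A ** B t))" by (simp add: B'_def matrix_mul_assoc)
    also have "\<dots> \<le> norm (A ** B t)" by (rule B)
    also have "\<dots> = norm (B t ** A)" by (simp add: comm)
    also have "\<dots> \<le> norm A" by (rule B)
    finally show ?thesis .
  qed
  moreover have "?f t = sqrt 2 * norm (B' t)" for t
    by (simp add: real_div_sqrt flip: times_divide_eq_left)
  ultimately have "?f t \<le> sqrt 2 * norm A" for t by simp
  then have "integral {0..1} ?f \<le> sqrt 2 * norm A"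
    using has_integral_le[OF int has_integral_const_real[of "sqrt 2 * norm A" 0 1]] by simp
  moreover have "\<gamma> 0 = mat 1"
    using B(1)[of 0] by (simp add: \<gamma>_def scaleR_2)
  moreover have "(mat 1 + A) ** (mat 1 + \<gamma> 1) = 2 *\<^sub>R mat 1"
    using B(1)[of 1] by (simp add: \<gamma>_def matrix_scaleR_right)
  ultimately show thesis using that[of \<gamma>] adm by simp
qed

text \<open>
  A rotation \<open>R\<close> near the identity is the value at time 1 of the Cayley curve of
  \<open>A = (I - R)(I + R)\<^sup>-\<^sup>1\<close>, and \<open>\<parallel>A\<parallel>\<close> is at most a constant times \<open>\<parallel>R - I\<parallel>\<close>.
\<close>

lemma local_SO_curve:
  obtains \<delta> K where "\<delta> > 0" "K > 0"
    "\<And>R :: real^'n^'n. R \<in> SO \<Longrightarrow> norm (R - mat 1) < \<delta> \<Longrightarrow>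
       \<exists>\<gamma>. admissible_curve SO g_SO \<gamma> \<and> \<gamma> 0 = mat 1 \<and> \<gamma> 1 = R \<and> curve_length g_SO \<gamma> \<le> K * norm (R - mat 1)"
proof -
  obtain K where K: "K > 0" "\<And>(X :: real^'n^'n) (Y :: real^'n^'n). norm (X ** Y) \<le> norm X * norm Y * K"
    using bounded_bilinear.pos_bounded[OF bounded_bilinear_matrix_mult] by metis
  show thesis
  proof (rule that)
    show "1 / K > 0" "sqrt 2 * (norm (mat 1 :: real^'n^'n) * K) + 1 > 0"
      using K(1) by (auto intro!: add_nonneg_pos)
    fix R :: "real^'n^'n" assume R: "R \<in> SO" "norm (R - mat 1) < 1 / K"
    have "norm X \<le> norm ((mat 1 + R) ** X)" for X :: "real^'n^'n"
    proof -
      have "norm ((R - mat 1) ** X) \<le> norm (R - mat 1) * norm X * K" by (rule K)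
      also have "\<dots> \<le> (1 / K) * norm X * K"
        using R(2) K(1) by (intro mult_right_mono) auto
      finally have 1: "norm ((R - mat 1) ** X) \<le> norm X" using K(1) by simp
      have "(mat 1 + R) ** X = 2 *\<^sub>R X + (R - mat 1) ** X"
        by (simp add: matrix_ring scaleR_2)
      then have "norm ((mat 1 + R) ** X) \<ge> norm (2 *\<^sub>R X) - norm ((R - mat 1) ** X)"
        by (metis norm_diff_ineq)
      then show ?thesis using 1 by simp
    qed
    then obtain C where C: "(mat 1 + R) ** C = mat 1" "C ** (mat 1 + R) = mat 1"
      "\<And>X :: real^'n^'n. norm (C ** X) \<le> norm X"
      by (rule expanding_imp_invertible[of "mat 1 + R"]) blast
    define A where "A = (mat 1 - R) ** C"
    \<comment> \<open>Thus \<open>I + A = 2 C\<close>, the relation that inverts the Cayley transform.\<close>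
    have A2: "A = 2 *\<^sub>R C - mat 1"
    proof -
      have "A = 2 *\<^sub>R C - (mat 1 + R) ** C" by (simp add: A_def matrix_ring scaleR_2)
      then show ?thesis by (simp add: C)
    qed
    have RR: "transpose R ** R = mat 1" by (rule SO_transpose_mult[OF R(1)])
    \<comment> \<open>Both \<open>(I - R\<^sup>T)(I + R)\<close> and \<open>(I + R\<^sup>T)(R - I)\<close> equal \<open>R - R\<^sup>T\<close>, so \<open>A\<close> is skew.\<close>
    have "transpose A = transpose C ** (mat 1 - transpose R)"
      by (simp add: A_def matrix_transpose_mul transpose_minus)
    also have "\<dots> = transpose C ** ((mat 1 - transpose R) ** (mat 1 + R)) ** C"
      using C(1) by (simp flip: matrix_mul_assoc)
    also have "(mat 1 - transpose R) ** (mat 1 + R) = (mat 1 + transpose R) ** (R - mat 1)"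
      by (simp add: matrix_ring RR)
    also have "transpose C ** ((mat 1 + transpose R) ** (R - mat 1)) ** C
        = transpose ((mat 1 + R) ** C) ** ((R - mat 1) ** C)"
      by (simp add: matrix_transpose_mul transpose_plus matrix_mul_assoc)
    also have "\<dots> = - A" unfolding C(1) A_def by (simp add: matrix_ring)
    finally have skew: "transpose A = - A" .
    have "norm A \<le> norm (mat 1 - R) * norm C * K" unfolding A_def by (rule K)
    also have "\<dots> \<le> norm (mat 1 - R) * norm (mat 1 :: real^'n^'n) * K"
      using C(3)[of "mat 1"] K(1) by (intro mult_right_mono mult_left_mono) auto
    finally have nA: "norm A \<le> norm (mat 1 :: real^'n^'n) * K * norm (R - mat 1)"
      by (simp add: norm_minus_commute mult_ac)
    obtain \<gamma> where \<gamma>: "admissible_curve SO g_SO \<gamma>" "\<gamma> 0 = mat 1"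
      "(mat 1 + A) ** (mat 1 + \<gamma> 1) = 2 *\<^sub>R mat 1" "curve_length g_SO \<gamma> \<le> sqrt 2 * norm A"
      using cayley_curve[OF skew] by metis
    have "2 *\<^sub>R (C ** (mat 1 + \<gamma> 1)) = 2 *\<^sub>R mat 1"
      using \<gamma>(3) by (simp add: A2 matrix_scaleR_left)
    then have "C ** (mat 1 + \<gamma> 1) = mat 1" by simp
    then have "(mat 1 + R) ** (C ** (mat 1 + \<gamma> 1)) = mat 1 + R" by simp
    then have "\<gamma> 1 = R" by (simp add: matrix_mul_assoc C)
    moreover have "sqrt 2 * norm A \<le> (sqrt 2 * (norm (mat 1 :: real^'n^'n) * K) + 1) * norm (R - mat 1)"
    proof -
      have "sqrt 2 * norm A \<le> sqrt 2 * (norm (mat 1 :: real^'n^'n) * K * norm (R - mat 1))"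
        using nA by (intro mult_left_mono) auto
      also have "\<dots> \<le> sqrt 2 * (norm (mat 1 :: real^'n^'n) * K * norm (R - mat 1)) + norm (R - mat 1)"
        by simp
      also have "\<dots> = (sqrt 2 * (norm (mat 1 :: real^'n^'n) * K) + 1) * norm (R - mat 1)"
        by (simp add: distrib_right mult.assoc)
      finally show ?thesis .
    qed
    ultimately show "\<exists>\<gamma>. admissible_curve SO g_SO \<gamma> \<and> \<gamma> 0 = mat 1 \<and> \<gamma> 1 = R \<and>
        curve_length g_SO \<gamma> \<le> (sqrt 2 * (norm (mat 1 :: real^'n^'n) * K) + 1) * norm (R - mat 1)"
      using \<gamma> by (intro exI[of _ \<gamma>]) auto
  qed
qed


lemma left_translation_SO:
  assumes "Q \<in> SO"
  shows "bounded_linear (\<lambda>U. Q ** U)" "(\<lambda>U. Q ** U) ` SO \<subseteq> SO"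
    "U \<in> SO \<Longrightarrow> g_SO (Q ** U) (Q ** A) (Q ** A) = g_SO U A A"
proof -
  show "bounded_linear (\<lambda>U. Q ** U)"
    by (rule bounded_bilinear.bounded_linear_right[OF bounded_bilinear_matrix_mult])
  show "(\<lambda>U. Q ** U) ` SO \<subseteq> SO" using SO_mult[OF assms] by auto
  show "U \<in> SO \<Longrightarrow> g_SO (Q ** U) (Q ** A) (Q ** A) = g_SO U A A"
    by (simp add: g_SO_def SO_matrix_inv SO_mult assms matrix_transpose_mul SO_cancel(1)[OF assms]
        flip: matrix_mul_assoc)
qed

text \<open>
  The metric is left invariant by construction. Right invariance comes from the invariance of
  the trace under conjugation.
\<close>

lemma right_translation_SO:
  assumes "Q \<in> SO"
  shows "bounded_linear (\<lambda>U. U ** Q)" "(\<lambda>U. U ** Q) ` SO \<subseteq> SO"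
    "U \<in> SO \<Longrightarrow> g_SO (U ** Q) (A ** Q) (A ** Q) = g_SO U A A"
proof -
  show "bounded_linear (\<lambda>U. U ** Q)"
    by (rule bounded_bilinear.bounded_linear_left[OF bounded_bilinear_matrix_mult])
  show "(\<lambda>U. U ** Q) ` SO \<subseteq> SO" using SO_mult[OF _ assms] by auto
  assume U: "U \<in> SO"
  let ?W = "transpose U ** A ** (transpose U ** A)"
  have "transpose (U ** Q) ** (A ** Q) ** (transpose (U ** Q) ** (A ** Q))
      = (transpose Q ** (transpose U ** A)) ** (Q ** (transpose Q ** ((transpose U ** A) ** Q)))"
    by (simp add: matrix_transpose_mul matrix_mul_assoc)
  also have "\<dots> = transpose Q ** (?W ** Q)"
    unfolding SO_cancel(2)[OF assms] by (simp only: matrix_mul_assoc)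
  also have "trace \<dots> = trace ((?W ** Q) ** transpose Q)" by (rule trace_mul_sym)
  also have "\<dots> = trace ?W" by (simp only: SO_cancel(3)[OF assms])
  finally show "g_SO (U ** Q) (A ** Q) (A ** Q) = g_SO U A A"
    by (simp add: g_SO_def SO_matrix_inv SO_mult U assms)
qed

lemma d_SO_right:
  assumes "Q \<in> SO"
  shows "d_SO (U ** Q) (V ** Q) = d_SO U V"
  unfolding d_SO_def
  using right_translation_SO[OF assms] right_translation_SO[OF SO_transpose[OF assms]]
  by (intro riem_dist_isometry[of "\<lambda>U. U ** Q" SO g_SO "\<lambda>U. U ** transpose Q"])
     (simp_all only: SO_cancel[OF assms])

lemma local_SO_curve_at:
  obtains \<delta> K where "\<delta> > 0" "K > 0"
    "\<And>U V :: real^'n^'n. U \<in> SO \<Longrightarrow> V \<in> SO \<Longrightarrow> norm (V - U) < \<delta> \<Longrightarrow>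
       \<exists>\<gamma>. admissible_curve SO g_SO \<gamma> \<and> \<gamma> 0 = U \<and> \<gamma> 1 = V \<and> curve_length g_SO \<gamma> \<le> K * norm (V - U)"
proof -
  obtain \<delta> K where *: "\<delta> > 0" "K > 0"
    "\<And>R :: real^'n^'n. R \<in> SO \<Longrightarrow> norm (R - mat 1) < \<delta> \<Longrightarrow>
       \<exists>\<gamma>. admissible_curve SO g_SO \<gamma> \<and> \<gamma> 0 = mat 1 \<and> \<gamma> 1 = R \<and> curve_length g_SO \<gamma> \<le> K * norm (R - mat 1)"
    using local_SO_curve by blast
  show thesis
  proof (rule that[OF *(1,2)])
    fix U V :: "real^'n^'n" assume UV: "U \<in> SO" "V \<in> SO" "norm (V - U) < \<delta>"
    have "transpose U ** V - mat 1 = transpose U ** (V - U)"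
      by (simp add: matrix_minus_ldistrib SO_transpose_mult[OF UV(1)])
    then have n: "norm (transpose U ** V - mat 1) = norm (V - U)"
      by (simp add: norm_SO_mult[OF SO_transpose[OF UV(1)]])
    then obtain \<gamma> where \<gamma>: "admissible_curve SO g_SO \<gamma>" "\<gamma> 0 = mat 1" "\<gamma> 1 = transpose U ** V"
        "curve_length g_SO \<gamma> \<le> K * norm (V - U)"
      using *(3)[of "transpose U ** V"] UV SO_mult SO_transpose by metis
    have "admissible_curve SO g_SO ((\<lambda>A. U ** A) \<circ> \<gamma>)"
         "curve_length g_SO ((\<lambda>A. U ** A) \<circ> \<gamma>) = curve_length g_SO \<gamma>"
      using isometry_admissible[of "\<lambda>A. U ** A" SO SO g_SO g_SO \<gamma>] left_translation_SO[OF UV(1)] \<gamma>(1)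
      by auto
    then show "\<exists>\<gamma>. admissible_curve SO g_SO \<gamma> \<and> \<gamma> 0 = U \<and> \<gamma> 1 = V \<and> curve_length g_SO \<gamma> \<le> K * norm (V - U)"
      using \<gamma> SO_cancel(2)[OF UV(1)] by (intro exI[of _ "(\<lambda>A. U ** A) \<circ> \<gamma>"]) simp
  qed
qed

text \<open>
  Joinability is an equivalence relation with open classes on the connected set \<open>SO\<close>. Without
  this the distance could be the infimum of an empty set.
\<close>

lemma SO_curve_exists:
  fixes U V :: "real^'n^'n"
  assumes "U \<in> SO" "V \<in> SO"
  shows "\<exists>\<gamma>. admissible_curve SO g_SO \<gamma> \<and> \<gamma> 0 = U \<and> \<gamma> 1 = V"
proof (rule connected_equivalence_relation[OF connected_SO assms])
  fix x y z :: "real^'n^'n"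
  assume "\<exists>\<gamma>. admissible_curve SO g_SO \<gamma> \<and> \<gamma> 0 = x \<and> \<gamma> 1 = y"
  then obtain \<gamma> where \<gamma>: "admissible_curve SO g_SO \<gamma>" "\<gamma> 0 = x" "\<gamma> 1 = y" by blast
  show "\<exists>\<gamma>. admissible_curve SO g_SO \<gamma> \<and> \<gamma> 0 = y \<and> \<gamma> 1 = x"
    using admissible_reverse(1)[OF quadratic_metric_g_SO \<gamma>(1)] \<gamma>(2,3)
    by (intro exI[of _ "reversepath \<gamma>"]) (simp add: reversepath_def)
  assume "\<exists>\<gamma>. admissible_curve SO g_SO \<gamma> \<and> \<gamma> 0 = y \<and> \<gamma> 1 = z"
  then obtain \<delta> where \<delta>: "admissible_curve SO g_SO \<delta>" "\<delta> 0 = y" "\<delta> 1 = z" by blast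
  show "\<exists>\<gamma>. admissible_curve SO g_SO \<gamma> \<and> \<gamma> 0 = x \<and> \<gamma> 1 = z"
    using admissible_join(1)[OF quadratic_metric_g_SO \<gamma>(1) \<delta>(1)] \<gamma>(2,3) \<delta>(2,3)
    by (intro exI[of _ "\<gamma> +++ \<delta>"]) (simp add: joinpaths_def)
next
  fix a :: "real^'n^'n" assume a: "a \<in> SO"
  obtain \<delta> K where *: "\<delta> > 0" "K > 0"
    "\<And>U V :: real^'n^'n. U \<in> SO \<Longrightarrow> V \<in> SO \<Longrightarrow> norm (V - U) < \<delta> \<Longrightarrow>
       \<exists>\<gamma>. admissible_curve SO g_SO \<gamma> \<and> \<gamma> 0 = U \<and> \<gamma> 1 = V \<and> curve_length g_SO \<gamma> \<le> K * norm (V - U)"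
    using local_SO_curve_at by blast
  have "openin (top_of_set SO) (SO \<inter> ball a \<delta>)" by (simp add: openin_open_Int)
  then show "\<exists>T. openin (top_of_set SO) T \<and> a \<in> T \<and>
      (\<forall>x\<in>T. \<exists>\<gamma>. admissible_curve SO g_SO \<gamma> \<and> \<gamma> 0 = a \<and> \<gamma> 1 = x)"
    using *(1) a
  proof (intro exI[of _ "SO \<inter> ball a \<delta>"] conjI ballI)
    fix x assume "x \<in> SO \<inter> ball a \<delta>"
    then show "\<exists>\<gamma>. admissible_curve SO g_SO \<gamma> \<and> \<gamma> 0 = a \<and> \<gamma> 1 = x"
      using *(3)[OF a, of x] by (auto simp: dist_norm norm_minus_commute)
  qed auto
qed

lemma d_SO_nonneg:
  assumes "U \<in> SO" "V \<in> SO"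
  shows "0 \<le> d_SO U V"
proof -
  obtain \<gamma> where "admissible_curve SO g_SO \<gamma>" "\<gamma> 0 = U" "\<gamma> 1 = V"
    using SO_curve_exists[OF assms] by blast
  then show ?thesis unfolding d_SO_def by (rule riem_dist_ge) (rule curve_length_SO_nonneg)
qed

lemma d_SO_triangle:
  assumes "U \<in> SO" "V \<in> SO" "W \<in> SO"
  shows "d_SO U W \<le> d_SO U V + d_SO V W"
  unfolding d_SO_def
  by (rule riem_dist_triangle[OF curve_length_SO_nonneg SO_curve_exists quadratic_metric_g_SO assms])

lemma d_SO_sym: "d_SO U V = d_SO V U"
  unfolding d_SO_def by (rule riem_dist_sym[OF quadratic_metric_g_SO])

lemma d_SO_locally_Lipschitz:
  obtains \<delta> K where "\<delta> > 0" "K > 0"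
    "\<And>U V :: real^'n^'n. U \<in> SO \<Longrightarrow> V \<in> SO \<Longrightarrow> norm (V - U) < \<delta> \<Longrightarrow> d_SO U V \<le> K * norm (V - U)"
proof -
  obtain \<delta> K where *: "\<delta> > 0" "K > 0"
    "\<And>U V :: real^'n^'n. U \<in> SO \<Longrightarrow> V \<in> SO \<Longrightarrow> norm (V - U) < \<delta> \<Longrightarrow>
       \<exists>\<gamma>. admissible_curve SO g_SO \<gamma> \<and> \<gamma> 0 = U \<and> \<gamma> 1 = V \<and> curve_length g_SO \<gamma> \<le> K * norm (V - U)"
    using local_SO_curve_at by blast
  show thesis
  proof (rule that[OF *(1,2)])
    fix U V :: "real^'n^'n" assume "U \<in> SO" "V \<in> SO" "norm (V - U) < \<delta>"
    from *(3)[OF this] obtain \<gamma> where \<gamma>: "admissible_curve SO g_SO \<gamma>" "\<gamma> 0 = U" "\<gamma> 1 = V"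
      "curve_length g_SO \<gamma> \<le> K * norm (V - U)" by blast
    have "d_SO U V \<le> curve_length g_SO \<gamma>"
      unfolding d_SO_def by (rule riem_dist_le[OF curve_length_SO_nonneg \<gamma>(1-3)])
    then show "d_SO U V \<le> K * norm (V - U)" using \<gamma>(4) by simp
  qed
qed

text \<open>
  By the triangle inequality it is enough that \<open>d_SO\<close> is small on nearby pairs.
\<close>

lemma continuous_on_d_SO:
  fixes f g :: "'a::metric_space \<Rightarrow> real^'n^'n"
  assumes f: "continuous_on S f" "f ` S \<subseteq> SO" and g: "continuous_on S g" "g ` S \<subseteq> SO"
  shows "continuous_on S (\<lambda>x. d_SO (f x) (g x))"
  unfolding continuous_on_def
proof
  fix x assume x: "x \<in> S"
  obtain \<delta> K where *: "\<delta> > 0" "K > 0"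
    "\<And>U V :: real^'n^'n. U \<in> SO \<Longrightarrow> V \<in> SO \<Longrightarrow> norm (V - U) < \<delta> \<Longrightarrow> d_SO U V \<le> K * norm (V - U)"
    using d_SO_locally_Lipschitz by blast
  have tf: "(f \<longlongrightarrow> f x) (at x within S)" and tg: "(g \<longlongrightarrow> g x) (at x within S)"
    using f(1) g(1) x by (auto simp: continuous_on_def)
  have SO: "f y \<in> SO" "g y \<in> SO" if "y \<in> S" for y using f(2) g(2) that by auto
  show "((\<lambda>y. d_SO (f y) (g y)) \<longlongrightarrow> d_SO (f x) (g x)) (at x within S)"
  proof (rule Lim_transform_bound[where g="\<lambda>y. K * norm (f y - f x) + K * norm (g y - g x)", THEN Lim_null[THEN iffD2]])
    have "\<forall>\<^sub>F y in at x within S. norm (f y - f x) < \<delta>" "\<forall>\<^sub>F y in at x within S. norm (g y - g x) < \<delta>"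
      using tendstoD[OF tf *(1)] tendstoD[OF tg *(1)] by (simp_all add: dist_norm)
    moreover have "\<forall>\<^sub>F y in at x within S. y \<in> S" by (simp add: eventually_at_filter)
    ultimately show "\<forall>\<^sub>F y in at x within S. norm (d_SO (f y) (g y) - d_SO (f x) (g x))
        \<le> norm (K * norm (f y - f x) + K * norm (g y - g x))"
    proof eventually_elim
      case (elim y)
      have "d_SO (f x) (f y) \<le> K * norm (f y - f x)" "d_SO (g x) (g y) \<le> K * norm (g y - g x)"
        using *(3) SO elim x by auto
      moreover have "d_SO (f y) (g y) \<le> d_SO (f y) (f x) + (d_SO (f x) (g x) + d_SO (g x) (g y))"
        using d_SO_triangle[of "f y" "f x" "g y"] d_SO_triangle[of "f x" "g x" "g y"] SO elim x by force
      moreover have "d_SO (f x) (g x) \<le> d_SO (f x) (f y) + (d_SO (f y) (g y) + d_SO (g y) (g x))"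
        using d_SO_triangle[of "f x" "f y" "g x"] d_SO_triangle[of "f y" "g y" "g x"] SO elim x by force
      ultimately show ?case
        using d_SO_sym[of "f y" "f x"] d_SO_sym[of "g y" "g x"] by (simp add: abs_le_iff)
    qed
    have "((\<lambda>y. K * norm (f y - f x) + K * norm (g y - g x)) \<longlongrightarrow>
        K * norm (f x - f x) + K * norm (g x - g x)) (at x within S)"
      by (intro tendsto_intros tf tg)
    then show "((\<lambda>y. K * norm (f y - f x) + K * norm (g y - g x)) \<longlongrightarrow> 0) (at x within S)" by simp
  qed
qed

section \<open>The product distance\<close>

definition log_vec :: "real^'n^'n \<Rightarrow> real^'n" where
  "log_vec D = (\<chi> i. ln (D $ i $ i))"

lemma has_vector_derivative_vec:
  fixes f :: "real \<Rightarrow> 'a::euclidean_space^'n"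
  assumes "\<And>i. ((\<lambda>x. f x $ i) has_vector_derivative f' $ i) net"
  shows "(f has_vector_derivative f') net"
proof -
  have e: "(\<Sum>i\<in>UNIV. axis i (x $ i)) = x" for x :: "'a^'n"
    by (simp add: vec_eq_iff axis_def sum_component)
  have "bounded_linear (axis i :: 'a \<Rightarrow> 'a^'n)" for i
    unfolding linear_conv_bounded_linear[symmetric]
    by (intro linearI) (simp_all add: vec_eq_iff axis_def)
  then have "((\<lambda>x. \<Sum>i\<in>UNIV. axis i (f x $ i) :: 'a^'n) has_vector_derivative
      (\<Sum>i\<in>UNIV. axis i (f' $ i))) net"
    by (intro has_vector_derivative_sum bounded_linear.has_vector_derivative[OF _ assms])
  then show ?thesis by (simp only: e)
qed

lemma has_vector_derivative_entry:
  fixes f :: "real \<Rightarrow> real^'n^'m"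
  assumes "(f has_vector_derivative f') net"
  shows "((\<lambda>x. f x $ i $ j) has_vector_derivative f' $ i $ j) net"
  by (intro bounded_linear.has_vector_derivative[OF bounded_linear_vec_nth] assms)

lemma Diag_plus_diagonal: "D \<in> Diag_plus \<Longrightarrow> diagonal_matrix D"
  by (simp add: Diag_plus_def diagonal_matrix_def)

lemma Diag_plus_pos: "D \<in> Diag_plus \<Longrightarrow> D $ i $ i > 0"
  by (simp add: Diag_plus_def)

lemma Diag_plus_inv:
  assumes "D \<in> Diag_plus"
  shows "matrix_inv D = (\<chi> i j. if i = j then 1 / D $ i $ i else 0)" (is "_ = ?B")
    "diagonal_matrix (matrix_inv D)" "matrix_inv D $ i $ i = 1 / D $ i $ i"
proof -
  have B: "diagonal_matrix ?B" by (simp add: diagonal_matrix_def)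
  have "?B ** D = mat 1"
    unfolding vec_eq_iff diagonal_mult(1)[OF B]
    using assms by (auto simp: mat_def Diag_plus_def) (metis less_irrefl)
  then show *: "matrix_inv D = ?B" by (rule matrix_inv_unique)
  show "diagonal_matrix (matrix_inv D)" "matrix_inv D $ i $ i = 1 / D $ i $ i"
    unfolding * by (simp_all add: diagonal_matrix_def)
qed

text \<open>
  In logarithmic coordinates the metric of \<open>Diag\<^sup>+\<close> is the Euclidean one.
\<close>

lemma g_Diag_tangent:
  assumes D: "D \<in> Diag_plus" and L: "diagonal_matrix L"
  shows "g_Diag D L L = (norm ((\<chi> i. L $ i $ i / D $ i $ i) :: real^'n))\<^sup>2"
proof -
  note I = Diag_plus_inv(2)[OF D]
  have "(matrix_inv D ** L ** matrix_inv D ** L) $ i $ i = (L $ i $ i / D $ i $ i)\<^sup>2" for i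
    by (simp add: matrix_mul_assoc[symmetric] diagonal_mult(1)[OF I] diagonal_mult(1)[OF L]
        Diag_plus_inv(3)[OF D] power2_eq_square)
  then have "g_Diag D L L = (\<Sum>i\<in>UNIV. (L $ i $ i / D $ i $ i)\<^sup>2)"
    by (simp only: g_Diag_def trace_def)
  then show ?thesis
    unfolding power2_norm_eq_inner by (simp add: inner_vec_def power2_eq_square)
qed

text \<open>
  At an interior time where the derivative exists, the derivative of the diagonal part is again
  diagonal. So the speed is expressed through the rotation speed and the velocity \<open>\<xi>\<close> of the
  logarithmic coordinates.
\<close>

lemma M_curve_tangent:
  fixes \<gamma> :: "real \<Rightarrow> 'n::finite matrix_pair"
  assumes \<gamma>: "\<gamma> ` {0..1} \<subseteq> M_set" and t: "t \<in> {0<..<1}" and der: "(\<gamma> has_vector_derivative w) (at t)"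
  defines "\<xi> \<equiv> (\<chi> i. snd w $ i $ i / snd (\<gamma> t) $ i $ i) :: real^'n"
  shows "speed g_SO (fst \<circ> \<gamma>) t = norm (fst w) / sqrt 2"
    "((\<lambda>s. log_vec (snd (\<gamma> s))) has_vector_derivative \<xi>) (at t)"
    "speed (g_M k) \<gamma> t = sqrt (k * (norm (fst w) / sqrt 2)\<^sup>2 + (norm \<xi>)\<^sup>2)"
proof -
  have M: "fst (\<gamma> s) \<in> SO" "snd (\<gamma> s) \<in> Diag_plus" if "s \<in> {0<..<1}" for s
  proof -
    have "\<gamma> s \<in> M_set" using \<gamma> that by (auto simp: image_subset_iff)
    then show "fst (\<gamma> s) \<in> SO" "snd (\<gamma> s) \<in> Diag_plus" by (auto simp: M_set_def)
  qed
  have du: "((fst \<circ> \<gamma>) has_vector_derivative fst w) (at t)"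
    using bounded_linear.has_vector_derivative[OF bounded_linear_fst der] by (simp only: o_def)
  have dd: "((\<lambda>s. snd (\<gamma> s)) has_vector_derivative snd w) (at t)"
    by (rule bounded_linear.has_vector_derivative[OF bounded_linear_snd der])
  have imu: "(fst \<circ> \<gamma>) ` {0..1} \<subseteq> SO" using \<gamma> by (auto simp: M_set_def image_subset_iff)
  show sp: "speed g_SO (fst \<circ> \<gamma>) t = norm (fst w) / sqrt 2"
    by (rule speed_SO[OF imu t du])
  have "snd w $ i $ j = 0" if "i \<noteq> j" for i j
  proof -
    have "((\<lambda>s. snd (\<gamma> s) $ i $ j) has_vector_derivative 0) (at t)"
    proof (rule has_vector_derivative_transform_within_open[OF _ _ t])
      show "((\<lambda>s. 0::real) has_vector_derivative 0) (at t)" by simp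
      fix s :: real assume "s \<in> {0<..<1}"
      then show "0 = snd (\<gamma> s) $ i $ j"
        using Diag_plus_diagonal[OF M(2)] that by (simp add: diagonal_matrix_def)
    qed simp
    then show ?thesis using has_vector_derivative_entry[OF dd] vector_derivative_unique_at by blast
  qed
  then have L: "diagonal_matrix (snd w)" by (simp add: diagonal_matrix_def)
  have "speed g_SO (fst \<circ> \<gamma>) t = sqrt (g_SO (fst (\<gamma> t)) (fst w) (fst w))"
    unfolding speed_def vector_derivative_at[OF du] by simp
  then have "sqrt (g_SO (fst (\<gamma> t)) (fst w) (fst w)) = norm (fst w) / sqrt 2" by (simp only: sp)
  then have gs: "g_SO (fst (\<gamma> t)) (fst w) (fst w) = (norm (fst w) / sqrt 2)\<^sup>2"
    using real_sqrt_ge_0_iff[of "g_SO (fst (\<gamma> t)) (fst w) (fst w)"]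
      real_sqrt_pow2[of "g_SO (fst (\<gamma> t)) (fst w) (fst w)"] by simp
  show "speed (g_M k) \<gamma> t = sqrt (k * (norm (fst w) / sqrt 2)\<^sup>2 + (norm \<xi>)\<^sup>2)"
    unfolding speed_def vector_derivative_at[OF der] g_M_def \<xi>_def
    by (simp only: case_prod_beta gs g_Diag_tangent[OF M(2)[OF t] L])
  show "((\<lambda>s. log_vec (snd (\<gamma> s))) has_vector_derivative \<xi>) (at t)"
  proof (rule has_vector_derivative_vec)
    fix i
    have "((\<lambda>s. snd (\<gamma> s) $ i $ i) has_real_derivative snd w $ i $ i) (at t)"
      using has_vector_derivative_entry[OF dd] by (simp only: has_real_derivative_iff_has_vector_derivative)
    from DERIV_chain2[OF DERIV_ln this] Diag_plus_pos[OF M(2)[OF t], of i]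
    show "((\<lambda>s. log_vec (snd (\<gamma> s)) $ i) has_vector_derivative \<xi> $ i) (at t)"
      by (simp add: log_vec_def \<xi>_def has_real_derivative_iff_has_vector_derivative[symmetric] divide_inverse mult.commute)
  qed
qed

text \<open>
  The speed of a curve in \<open>M(p)\<close> dominates those of its two components up to constants. For these to be
  integrable only measurability remains, which piecewise continuity supplies.
\<close>

lemma integrable_piecewise_continuous:
  fixes f :: "real \<Rightarrow> 'a::euclidean_space"
  assumes S: "finite S" and f: "continuous_on ({0..1} - S) f"
    and le: "\<And>t. t \<in> {0..1} - S \<Longrightarrow> norm (f t) \<le> h t" and h: "h integrable_on {0..1::real}"
  shows "f integrable_on {0..1}"
proof -
  have neg: "negligible S" using S by (rule negligible_finite)
  have sets: "{0..1} - S \<in> sets lebesgue"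
    using neg by (intro sets.Diff) (auto simp: negligible_imp_sets)
  have "h integrable_on ({0..1} - S)"
    by (rule integrable_spike_set[OF h]; rule negligible_subset[OF neg]; auto)
  then have "f integrable_on ({0..1} - S)"
    by (intro measurable_bounded_by_integrable_imp_integrable[OF _ _ le sets]
        continuous_imp_measurable_on_sets_lebesgue f sets) auto
  then show ?thesis
    by (rule integrable_spike_set; intro negligible_subset[OF neg]; auto)
qed

definition log_dist :: "real^'n^'n \<Rightarrow> real^'n^'n \<Rightarrow> real" where
  "log_dist D E = norm (log_vec E - log_vec D)"

text \<open>
  Let \<open>p\<close> be the rotation speed and \<open>q\<close> the logarithmic speed of the curve, with integrals at least
  \<open>d\<close> and \<open>L\<close>, the distances between the endpoints. By Cauchy-Schwarz
  \<open>k d p + L q \<le> \<surd>(k d\<^sup>2 + L\<^sup>2) \<surd>(k p\<^sup>2 + q\<^sup>2)\<close> pointwise, and integrating this gives the bound.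
\<close>

lemma curve_length_M_ge:
  fixes \<gamma> :: "real \<Rightarrow> 'n::finite matrix_pair"
  assumes k: "k > 0" and adm: "admissible_curve M_set (g_M k) \<gamma>"
    and ends: "\<gamma> 0 = (U, D)" "\<gamma> 1 = (V, E)"
  shows "sqrt (k * (d_SO U V)\<^sup>2 + (log_dist D E)\<^sup>2) \<le> curve_length (g_M k) \<gamma>"
proof -
  have pc: "\<gamma> piecewise_C1_differentiable_on {0..1}" and M: "\<gamma> ` {0..1} \<subseteq> M_set"
    using adm unfolding admissible_curve_def by auto
  obtain S where S: "finite S" "0 \<in> S" "1 \<in> S"
    "\<And>t. t \<in> {0..1} - S \<Longrightarrow> (\<gamma> has_vector_derivative vector_derivative \<gamma> (at t)) (at t)"
    "continuous_on ({0..1} - S) (\<lambda>t. vector_derivative \<gamma> (at t))"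
    using piecewise_C1_regular[OF pc] by metis
  define w where "w t = vector_derivative \<gamma> (at t)" for t
  define p where "p t = norm (fst (w t)) / sqrt 2" for t
  define \<xi> where "\<xi> t = ((\<chi> i. snd (w t) $ i $ i / snd (\<gamma> t) $ i $ i) :: real^'n)" for t
  have int: "t \<in> {0<..<1}" if "t \<in> {0..1} - S" for t
    using that S(2,3) by (cases "t = 0"; cases "t = 1"; auto)
  note tan = M_curve_tangent[OF M int S(4), folded w_def, folded p_def \<xi>_def]
  have speed: "speed (g_M k) \<gamma> t = sqrt (k * (p t)\<^sup>2 + (norm (\<xi> t))\<^sup>2)" if "t \<in> {0..1} - S" for t
    using tan(3)[OF that that] .
  have SD: "fst (\<gamma> t) \<in> SO" "snd (\<gamma> t) \<in> Diag_plus" if "t \<in> {0..1}" for t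
  proof -
    have "\<gamma> t \<in> M_set" using M that by (auto simp: image_subset_iff)
    then show "fst (\<gamma> t) \<in> SO" "snd (\<gamma> t) \<in> Diag_plus" by (auto simp: M_set_def)
  qed
  have ends': "U \<in> SO" "V \<in> SO" using SD(1)[of 0] SD(1)[of 1] ends by auto
  have hint: "(\<lambda>t. sqrt (k * (p t)\<^sup>2 + (norm (\<xi> t))\<^sup>2)) integrable_on {0..1}"
    by (rule integrable_spike_finite[OF S(1), of _ _ "speed (g_M k) \<gamma>"])
       (use speed adm in \<open>auto simp: admissible_curve_def\<close>)
  have len: "curve_length (g_M k) \<gamma> = integral {0..1} (\<lambda>t. sqrt (k * (p t)\<^sup>2 + (norm (\<xi> t))\<^sup>2))"
    unfolding curve_length_def by (rule integral_spike[OF negligible_finite[OF S(1)]]) (simp add: speed)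
  have cg: "continuous_on {0..1} \<gamma>" using pc by (simp add: piecewise_C1_differentiable_on_def)
  have cw: "continuous_on ({0..1} - S) w" using S(5) by (simp add: w_def[abs_def])
  have cp: "continuous_on ({0..1} - S) p"
    unfolding p_def by (intro continuous_intros cw) auto
  have cxi: "continuous_on ({0..1} - S) \<xi>"
    unfolding \<xi>_def
    by (intro continuous_intros cw continuous_on_subset[OF cg])
       (use Diag_plus_pos[OF SD(2)] in \<open>auto simp: less_imp_neq[symmetric]\<close>)
  have pint: "p integrable_on {0..1}"
  proof (rule integrable_piecewise_continuous[OF S(1) cp])
    show "(\<lambda>t. (1 / sqrt k) * sqrt (k * (p t)\<^sup>2 + (norm (\<xi> t))\<^sup>2)) integrable_on {0..1}"
      by (intro integrable_on_mult_right hint)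
    fix t
    have p0: "p t \<ge> 0" by (simp add: p_def)
    then have "sqrt k * p t = sqrt (k * (p t)\<^sup>2)" by (simp add: real_sqrt_mult)
    also have "\<dots> \<le> sqrt (k * (p t)\<^sup>2 + (norm (\<xi> t))\<^sup>2)" by simp
    finally show "norm (p t) \<le> (1 / sqrt k) * sqrt (k * (p t)\<^sup>2 + (norm (\<xi> t))\<^sup>2)"
      using k p0 by (simp add: divide_simps mult.commute)
  qed
  have xint: "\<xi> integrable_on {0..1}"
    using k by (intro integrable_piecewise_continuous[OF S(1) cxi _ hint]) (simp add: real_le_rsqrt)
  have nxint: "(\<lambda>t. norm (\<xi> t)) integrable_on {0..1}"
    using k by (intro integrable_piecewise_continuous[OF S(1) _ _ hint] continuous_intros cxi)
      (simp add: real_le_rsqrt)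
  have dl: "d_SO U V \<le> integral {0..1} p"
  proof -
    have "admissible_curve SO g_SO (fst \<circ> \<gamma>)" "curve_length g_SO (fst \<circ> \<gamma>) = integral {0..1} p"
      using admissible_by_speed[OF piecewise_C1_bounded_linear[OF bounded_linear_fst pc] _ S(1) tan(1)
        integrable_integral[OF pint], of SO] SD(1) by (simp_all add: image_subset_iff)
    then show ?thesis
      unfolding d_SO_def
      using riem_dist_le[OF curve_length_SO_nonneg, where \<gamma>="fst \<circ> \<gamma>" and x=U and y=V] ends by simp
  qed
  have Ll: "log_dist D E \<le> integral {0..1} (\<lambda>t. norm (\<xi> t))"
  proof -
    have "continuous_on {0..1} (\<lambda>t. log_vec (snd (\<gamma> t)))"
      unfolding log_vec_def
      by (intro continuous_intros cg) (use Diag_plus_pos[OF SD(2)] in \<open>auto simp: less_imp_neq[symmetric]\<close>)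
    then have "(\<xi> has_integral (log_vec (snd (\<gamma> 1)) - log_vec (snd (\<gamma> 0)))) {0..1}"
      by (intro fundamental_theorem_of_calculus_interior_strong[OF S(1)])
         (use tan(2) in auto)
    then have "log_dist D E = norm (integral {0..1} \<xi>)"
      by (simp add: log_dist_def integral_unique ends)
    also have "\<dots> \<le> integral {0..1} (\<lambda>t. norm (\<xi> t))"
      by (rule integral_norm_bound_integral[OF xint nxint]) simp
    finally show ?thesis .
  qed
  let ?d = "d_SO U V" and ?L = "log_dist D E"
  define N where "N = sqrt (k * ?d\<^sup>2 + ?L\<^sup>2)"
  have d0: "?d \<ge> 0" using d_SO_nonneg[OF ends'] .
  have L0: "?L \<ge> 0" by (simp add: log_dist_def)
  have N2: "N\<^sup>2 = k * ?d * ?d + ?L * ?L"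
    using k by (simp add: N_def power2_eq_square mult.assoc)
  have N0: "N \<ge> 0" by (simp add: N_def k less_imp_le)
  have "N\<^sup>2 \<le> k * ?d * integral {0..1} p + ?L * integral {0..1} (\<lambda>t. norm (\<xi> t))"
    unfolding N2 using dl Ll d0 L0 k by (intro add_mono mult_left_mono) auto
  also have "\<dots> = integral {0..1} (\<lambda>t. k * ?d * p t + ?L * norm (\<xi> t))"
    using pint nxint by (simp add: integral_add integrable_on_mult_right)
  also have "\<dots> \<le> integral {0..1} (\<lambda>t. N * sqrt (k * (p t)\<^sup>2 + (norm (\<xi> t))\<^sup>2))"
  proof (rule integral_le)
    fix t
    show "k * ?d * p t + ?L * norm (\<xi> t) \<le> N * sqrt (k * (p t)\<^sup>2 + (norm (\<xi> t))\<^sup>2)"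
    proof -
    \<comment> \<open>The Lagrange identity behind the Cauchy-Schwarz inequality.\<close>
      have "(k * ?d * p t + ?L * norm (\<xi> t))\<^sup>2 + k * (?d * norm (\<xi> t) - ?L * p t)\<^sup>2
         = (k * ?d\<^sup>2 + ?L\<^sup>2) * (k * (p t)\<^sup>2 + (norm (\<xi> t))\<^sup>2)"
        by (simp add: power2_eq_square algebra_simps)
      moreover have "k * (?d * norm (\<xi> t) - ?L * p t)\<^sup>2 \<ge> 0" using k by simp
      ultimately have "(k * ?d * p t + ?L * norm (\<xi> t))\<^sup>2 \<le> (k * ?d\<^sup>2 + ?L\<^sup>2) * (k * (p t)\<^sup>2 + (norm (\<xi> t))\<^sup>2)"
        by linarith
      then show ?thesis unfolding N_def real_sqrt_mult[symmetric] by (rule real_le_rsqrt)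
    qed
  qed (intro integrable_add integrable_on_mult_right pint nxint hint)+
  also have "\<dots> = N * curve_length (g_M k) \<gamma>" by (simp add: len)
  finally have NN: "N * N \<le> N * curve_length (g_M k) \<gamma>" by (simp add: power2_eq_square)
  have "0 \<le> curve_length (g_M k) \<gamma>"
    unfolding len using k by (intro integral_nonneg hint) auto
  then show ?thesis
    using NN N0 by (cases "N = 0") (simp_all add: N_def[symmetric] mult_le_cancel_left)
qed


lemma Diag_plus_eqI:
  assumes "D \<in> Diag_plus" "E \<in> Diag_plus" "log_vec D = log_vec E"
  shows "D = E"
  unfolding vec_eq_iff
proof (intro allI)
  fix i j
  show "D $ i $ j = E $ i $ j"
  proof (cases "i = j")
    case True
    have "ln (D $ i $ i) = ln (E $ i $ i)" using assms(3) by (simp add: log_vec_def vec_eq_iff)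
    then show ?thesis using True Diag_plus_pos[OF assms(1), of i] Diag_plus_pos[OF assms(2), of i] by simp
  next
    case False
    then show ?thesis using assms(1,2) by (simp add: Diag_plus_def)
  qed
qed

text \<open>
  The diagonal part moves along its logarithmic segment, at the rate \<open>\<phi>\<close> that is the
  fraction of arc length covered by the rotation part. Then the two speeds are nearly proportional and
  the lengths combine by Pythagoras, and \<open>u\<close> itself need not be reparametrised. The positive \<open>e\<close> keeps the
  fraction defined when \<open>u\<close> has length zero.
\<close>

lemma M_curve_along_rotation_curve:
  fixes u :: "real \<Rightarrow> real^'n^'n"
  assumes k: "k > 0" and e: "e > 0" and adm: "admissible_curve SO g_SO u"
    and D: "D \<in> Diag_plus" and E: "E \<in> Diag_plus"
  obtains \<gamma> where "admissible_curve M_set (g_M k) \<gamma>" "\<gamma> 0 = (u 0, D)" "\<gamma> 1 = (u 1, E)"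
    "curve_length (g_M k) \<gamma> \<le> sqrt (k * (curve_length g_SO u + e)\<^sup>2 + (log_dist D E)\<^sup>2)"
proof -
  have pc: "u piecewise_C1_differentiable_on {0..1}" and M: "u ` {0..1} \<subseteq> SO"
    using adm unfolding admissible_curve_def by auto
  obtain S where S: "finite S" "0 \<in> S" "1 \<in> S"
    "\<And>t. t \<in> {0..1} - S \<Longrightarrow> (u has_vector_derivative vector_derivative u (at t)) (at t)"
    "continuous_on ({0..1} - S) (\<lambda>t. vector_derivative u (at t))"
    using piecewise_C1_regular[OF pc] by metis
  have int: "t \<in> {0<..<1}" if "t \<in> {0..1} - S" for t
    using that S(2,3) by (cases "t = 0"; cases "t = 1"; auto)
  define u' where "u' t = vector_derivative u (at t)" for t
  define p where "p t = norm (u' t) / sqrt 2" for t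
  define l where "l = curve_length g_SO u"
  define L where "L = log_dist D E"
  have l0: "l \<ge> 0" using curve_length_SO_nonneg[OF adm] by (simp add: l_def)
  have le: "l + e > 0" using l0 e by simp
  have du: "(u has_vector_derivative u' t) (at t)" if "t \<in> {0..1} - S" for t
    using S(4)[OF that] by (simp add: u'_def)
  have cp: "continuous_on ({0..1} - S) p"
    unfolding p_def u'_def by (intro continuous_intros S(5)) auto
  have pl: "(p has_integral l) {0..1}"
    unfolding l_def
    by (rule has_integral_spike_finite[OF S(1) _ has_integral_speed[OF adm]])
       (simp add: p_def speed_SO[OF M int du])
  then have pint: "p integrable_on {0..1}" by blast
  define \<phi> where "\<phi> t = (integral {0..t} p + e * t) / (l + e)" for t
  define \<phi>' where "\<phi>' t = (p t + e) / (l + e)" for t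
  have \<phi>01: "\<phi> 0 = 0" "\<phi> 1 = 1"
    using le pl by (simp_all add: \<phi>_def integral_unique)
  have c\<phi>: "continuous_on {0..1} \<phi>"
    unfolding \<phi>_def using le by (intro continuous_intros indefinite_integral_continuous_1 pint) auto
  have d\<phi>: "(\<phi> has_vector_derivative \<phi>' t) (at t)" if t: "t \<in> {0..1} - S" for t
  proof -
    have "((\<lambda>s. integral {0..s} p) has_vector_derivative p t) (at t within ({0..1} - S))"
      by (rule integral_has_vector_derivative_continuous_at[OF pint t S(1)])
         (use cp t in \<open>auto simp: continuous_on_eq_continuous_within\<close>)
    moreover have "at t within ({0..1} - S) = at t"
      by (rule at_within_open_subset[of t "{0<..<1} - S"])
         (use int[OF t] t S(1) in \<open>auto intro!: open_Diff finite_imp_closed\<close>)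
    ultimately have "((\<lambda>s. integral {0..s} p) has_real_derivative p t) (at t)"
      by (simp add: has_real_derivative_iff_has_vector_derivative)
    then have "(\<phi> has_real_derivative (p t + e * 1) / (l + e)) (at t)"
      unfolding \<phi>_def by (intro DERIV_cdivide DERIV_add DERIV_cmult DERIV_ident)
    then show ?thesis by (simp add: has_real_derivative_iff_has_vector_derivative \<phi>'_def)
  qed
  define v where "v = log_vec E - log_vec D"
  \<comment> \<open>The logarithmic segment from \<open>D\<close> to \<open>E\<close>.\<close>
  define G where "G s = (\<chi> i j. if i = j then exp (log_vec D $ i + s * v $ i) else 0 :: real^'n^'n)" for s
  define G' where "G' s = (\<chi> i j. if i = j then exp (log_vec D $ i + s * v $ i) * v $ i else 0 :: real^'n^'n)" for s
  have GD: "G s \<in> Diag_plus" for s by (simp add: G_def Diag_plus_def)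
  have logG: "log_vec (G s) = log_vec D + s *\<^sub>R v" for s
    by (simp add: vec_eq_iff log_vec_def G_def)
  have G01: "G 0 = D" "G 1 = E"
    by (rule Diag_plus_eqI[OF GD D], simp add: logG) (rule Diag_plus_eqI[OF GD E], simp add: logG v_def)
  have dG: "(G has_vector_derivative G' s) (at s)" for s
  proof (intro has_vector_derivative_vec)
    fix i j
    have "((\<lambda>s. exp (log_vec D $ i + s * v $ i)) has_real_derivative
        exp (log_vec D $ i + s * v $ i) * v $ i) (at s)"
      by (rule derivative_eq_intros refl | simp)+
    then show "((\<lambda>s. G s $ i $ j) has_vector_derivative G' s $ i $ j) (at s)"
      by (cases "i = j") (simp_all add: G_def G'_def has_real_derivative_iff_has_vector_derivative)
  qed
  have cG: "continuous_on T G" "continuous_on T G'" for T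
  proof -
    show "continuous_on T G"
      by (rule continuous_on_vector_derivative[of T G G']) (rule has_vector_derivative_at_within[OF dG])
    show "continuous_on T G'"
      unfolding G'_def
    proof (intro continuous_on_vec_lambda)
      fix i j
      show "continuous_on T (\<lambda>s. if i = j then exp (log_vec D $ i + s * v $ i) * v $ i else 0)"
        by (cases "i = j") (simp_all, intro continuous_intros)
    qed
  qed
  define \<gamma> where "\<gamma> t = (u t, G (\<phi> t))" for t
  define w where "w t = (u' t, \<phi>' t *\<^sub>R G' (\<phi> t))" for t
  have d\<gamma>: "(\<gamma> has_vector_derivative w t) (at t)" if t: "t \<in> {0..1} - S" for t
  proof -
    have "((\<lambda>t. G (\<phi> t)) has_vector_derivative \<phi>' t *\<^sub>R G' (\<phi> t)) (at t)"
      using vector_diff_chain_at[OF d\<phi>[OF t] dG] by (simp only: o_def)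
    then show ?thesis
      unfolding \<gamma>_def w_def by (intro has_vector_derivative_Pair du t)
  qed
  have cont: "continuous_on {0..1} \<gamma>"
    unfolding \<gamma>_def
    using pc c\<phi> by (intro continuous_on_Pair continuous_on_compose2[OF cG(1)[of UNIV]])
       (auto simp: piecewise_C1_differentiable_on_def)
  have c\<phi>': "continuous_on ({0..1} - S) \<phi>'"
    unfolding \<phi>'_def using le by (intro continuous_intros cp) auto
  have "continuous_on ({0..1} - S) w"
    unfolding w_def u'_def
    by (intro continuous_on_Pair S(5) continuous_on_scaleR c\<phi>' continuous_on_compose2[OF cG(2)[of UNIV]]
        continuous_on_subset[OF c\<phi>]) auto
  then have "\<gamma> C1_differentiable_on ({0..1} - S)"
    unfolding C1_differentiable_on_def using d\<gamma> by blast
  then have pc\<gamma>: "\<gamma> piecewise_C1_differentiable_on {0..1}"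
    unfolding piecewise_C1_differentiable_on_def using cont S(1) by blast
  have im: "\<gamma> ` {0..1} \<subseteq> M_set"
    using M GD by (auto simp: \<gamma>_def M_set_def image_subset_iff)
  define f where "f t = sqrt (k * (p t)\<^sup>2 + (\<phi>' t * L)\<^sup>2)" for t
  have sp: "speed (g_M k) \<gamma> t = f t" if t: "t \<in> {0..1} - S" for t
  proof -
    have "((\<chi> i. snd (w t) $ i $ i / snd (\<gamma> t) $ i $ i) :: real^'n) = \<phi>' t *\<^sub>R v"
      by (simp add: vec_eq_iff w_def \<gamma>_def G_def G'_def)
    then show ?thesis
      using M_curve_tangent(3)[OF im int[OF t] d\<gamma>[OF t], of k]
      by (simp add: f_def p_def w_def L_def log_dist_def v_def power_mult_distrib)
  qed
  define c where "c = sqrt (k + (L / (l + e))\<^sup>2)"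
  have fle: "norm (f t) \<le> (p t + e) * c" for t
  proof -
    have p0: "p t \<ge> 0" by (simp add: p_def)
    have "k * (p t)\<^sup>2 + (\<phi>' t * L)\<^sup>2 \<le> k * (p t + e)\<^sup>2 + (\<phi>' t * L)\<^sup>2"
      using k e p0 by (intro add_right_mono mult_left_mono power_mono) auto
    also have "\<dots> = (p t + e)\<^sup>2 * (k + (L / (l + e))\<^sup>2)"
    proof -
      have "\<phi>' t * L = (p t + e) * (L / (l + e))" by (simp add: \<phi>'_def)
      then show ?thesis by (simp only: power_mult_distrib distrib_left mult.commute[of k])
    qed
    finally have "f t \<le> sqrt ((p t + e)\<^sup>2 * (k + (L / (l + e))\<^sup>2))"
      unfolding f_def by (rule real_sqrt_le_mono)
    then show ?thesis using p0 e k by (simp add: real_sqrt_mult c_def f_def)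
  qed
  have hint: "((\<lambda>t. (p t + e) * c) has_integral (l + e) * c) {0..1}"
    using has_integral_mult_left[OF has_integral_add[OF pl has_integral_const_real[of e 0 1]], of c] by simp
  have "continuous_on ({0..1} - S) f"
    unfolding f_def by (intro continuous_intros cp c\<phi>')
  then have fint: "f integrable_on {0..1}"
    using integrable_piecewise_continuous[of S f "\<lambda>t. (p t + e) * c"] S(1) fle hint by blast
  have "integral {0..1} f \<le> (l + e) * c"
    using fle by (intro has_integral_le[OF integrable_integral[OF fint] hint]) (metis abs_le_D1 real_norm_def)
  also have "(l + e) * c = sqrt ((l + e)\<^sup>2 * (k + (L / (l + e))\<^sup>2))"
    using le by (simp add: c_def real_sqrt_mult)
  also have "(l + e)\<^sup>2 * (k + (L / (l + e))\<^sup>2) = k * (l + e)\<^sup>2 + L\<^sup>2"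
    using le by (simp add: power_divide distrib_left)
  finally have len: "integral {0..1} f \<le> sqrt (k * (l + e)\<^sup>2 + L\<^sup>2)" .
  show thesis
    using that[of \<gamma>] admissible_by_speed[OF pc\<gamma> im S(1) sp integrable_integral[OF fint]] len
    by (simp add: \<gamma>_def \<phi>01 G01 l_def L_def)
qed

text \<open>
  The lower bound holds for each curve. For the upper bound, curves in \<open>SO\<close> of length less than
  \<open>d_SO U V + e\<close> are lifted to \<open>M(p)\<close>, and \<open>e\<close> tends to \<open>0\<close>.
\<close>

lemma d_M_eq:
  fixes U V D E :: "real^'n^'n"
  assumes k: "k > 0" and U: "U \<in> SO" and V: "V \<in> SO" and D: "D \<in> Diag_plus" and E: "E \<in> Diag_plus"
  shows "d_M k (U, D) (V, E) = sqrt (k * (d_SO U V)\<^sup>2 + (log_dist D E)\<^sup>2)"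
proof (rule antisym)
  have nn: "0 \<le> curve_length (g_M k) \<gamma>" if adm: "admissible_curve M_set (g_M k) \<gamma>" for \<gamma> :: "real \<Rightarrow> 'n matrix_pair"
  proof -
    obtain U0 D0 U1 D1 where ends: "\<gamma> 0 = (U0, D0)" "\<gamma> 1 = (U1, D1)" by (meson surj_pair)
    have "0 \<le> sqrt (k * (d_SO U0 U1)\<^sup>2 + (log_dist D0 D1)\<^sup>2)" using k by simp
    also have "\<dots> \<le> curve_length (g_M k) \<gamma>" by (rule curve_length_M_ge[OF k adm ends])
    finally show ?thesis .
  qed
  obtain u where u: "admissible_curve SO g_SO u" "u 0 = U" "u 1 = V"
    using SO_curve_exists[OF U V] by blast
  have ub: "d_M k (U, D) (V, E) \<le> sqrt (k * (d_SO U V + e + e)\<^sup>2 + (log_dist D E)\<^sup>2)" if e: "e > 0" for e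
  proof -
    have "riem_dist SO g_SO U V < d_SO U V + e" using e by (simp add: d_SO_def)
    then obtain u' where u': "admissible_curve SO g_SO u'" "u' 0 = U" "u' 1 = V"
      "curve_length g_SO u' < d_SO U V + e"
      using riem_dist_less[OF u] by metis
    obtain \<gamma> where \<gamma>: "admissible_curve M_set (g_M k) \<gamma>" "\<gamma> 0 = (u' 0, D)" "\<gamma> 1 = (u' 1, E)"
      "curve_length (g_M k) \<gamma> \<le> sqrt (k * (curve_length g_SO u' + e)\<^sup>2 + (log_dist D E)\<^sup>2)"
      using M_curve_along_rotation_curve[OF k e u'(1) D E] by metis
    have "d_M k (U, D) (V, E) \<le> curve_length (g_M k) \<gamma>"
      unfolding d_M_def using riem_dist_le[OF nn \<gamma>(1)] \<gamma>(2,3) u'(2,3) by simp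
    also note \<gamma>(4)
    also have "sqrt (k * (curve_length g_SO u' + e)\<^sup>2 + (log_dist D E)\<^sup>2)
       \<le> sqrt (k * (d_SO U V + e + e)\<^sup>2 + (log_dist D E)\<^sup>2)"
      using u'(4) e k curve_length_SO_nonneg[OF u'(1)]
      by (intro real_sqrt_le_mono add_right_mono mult_left_mono power_mono) auto
    finally show ?thesis .
  qed
  have "((\<lambda>e. sqrt (k * (d_SO U V + e + e)\<^sup>2 + (log_dist D E)\<^sup>2)) \<longlongrightarrow>
     sqrt (k * (d_SO U V + 0 + 0)\<^sup>2 + (log_dist D E)\<^sup>2)) (at_right 0)"
    by (intro tendsto_intros)
  moreover have "\<forall>\<^sub>F e in at_right 0. d_M k (U, D) (V, E) \<le> sqrt (k * (d_SO U V + e + e)\<^sup>2 + (log_dist D E)\<^sup>2)"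
    using eventually_at_right_less[of "0::real"] by eventually_elim (rule ub)
  ultimately have "d_M k (U, D) (V, E) \<le> sqrt (k * (d_SO U V + 0 + 0)\<^sup>2 + (log_dist D E)\<^sup>2)"
    by (rule tendsto_lowerbound) simp
  then show "d_M k (U, D) (V, E) \<le> sqrt (k * (d_SO U V)\<^sup>2 + (log_dist D E)\<^sup>2)" by simp
  obtain \<gamma> :: "real \<Rightarrow> 'n matrix_pair" where \<gamma>: "admissible_curve M_set (g_M k) \<gamma>" "\<gamma> 0 = (u 0, D)" "\<gamma> 1 = (u 1, E)"
    using M_curve_along_rotation_curve[OF k zero_less_one u(1) D E] by metis
  show "sqrt (k * (d_SO U V)\<^sup>2 + (log_dist D E)\<^sup>2) \<le> d_M k (U, D) (V, E)"
    unfolding d_M_def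
    by (rule riem_dist_ge[OF \<gamma>(1)]) (use \<gamma> u curve_length_M_ge[OF k] in auto)
qed

section \<open>Even signed permutations\<close>

lemma sum_01_eq_1:
  fixes f :: "'n::finite \<Rightarrow> real"
  assumes "\<And>j. f j = 0 \<or> f j = 1" "(\<Sum>j\<in>UNIV. f j) = 1"
  shows "\<exists>!j. f j \<noteq> 0"
proof -
  have "(\<Sum>j\<in>UNIV. f j) = (\<Sum>j\<in>{j. f j \<noteq> 0}. f j)"
    by (rule sum.mono_neutral_right) auto
  also have "\<dots> = (\<Sum>j\<in>{j. f j \<noteq> 0}. 1)"
    using assms(1) by (intro sum.cong) auto
  finally have "card {j. f j \<noteq> 0} = 1" using assms(2) by simp
  then obtain m where "{j. f j \<noteq> 0} = {m}" by (auto simp: card_1_singleton_iff)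
  then have "f j \<noteq> 0 \<longleftrightarrow> j = m" for j by blast
  then show ?thesis by simp
qed

text \<open>
  For an orthogonal matrix with entries in \<open>{-1, 0, 1}\<close> the rows and columns are unit vectors, so
  each has exactly one nonzero entry.
\<close>

lemma even_signed_perms_iff:
  "P \<in> even_signed_perms \<longleftrightarrow> P \<in> SO \<and> (\<forall>i j. P $ i $ j \<in> {-1, 0, 1})"
proof
  assume P: "P \<in> SO \<and> (\<forall>i j. P $ i $ j \<in> {-1, 0, 1})"
  have sq: "(P $ i $ j)\<^sup>2 = 0 \<or> (P $ i $ j)\<^sup>2 = 1" for i j
    using P by (metis insertE power2_minus power_one singletonD zero_power2)
  have "\<exists>!j. (P $ i $ j)\<^sup>2 \<noteq> 0" for i
  proof (rule sum_01_eq_1[OF sq])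
    have "(P ** transpose P) $ i $ i = 1" using SO_mult_transpose[of P] P by (simp add: mat_def)
    then show "(\<Sum>j\<in>UNIV. (P $ i $ j)\<^sup>2) = 1"
      by (simp add: matrix_matrix_mult_def transpose_def power2_eq_square)
  qed
  moreover have "\<exists>!i. (P $ i $ j)\<^sup>2 \<noteq> 0" for j
  proof (rule sum_01_eq_1[OF sq])
    have "(transpose P ** P) $ j $ j = 1" using SO_transpose_mult[of P] P by (simp add: mat_def)
    then show "(\<Sum>i\<in>UNIV. (P $ i $ j)\<^sup>2) = 1"
      by (simp add: matrix_matrix_mult_def transpose_def power2_eq_square)
  qed
  ultimately show "P \<in> even_signed_perms" using P by (simp add: even_signed_perms_def)
qed (simp add: even_signed_perms_def)

lemma signed_perm_SO: "P \<in> even_signed_perms \<Longrightarrow> P \<in> SO"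
  by (simp add: even_signed_perms_iff)

lemma signed_perm_one: "mat 1 \<in> even_signed_perms"
  unfolding even_signed_perms_iff using SO_one by (auto simp: mat_def)

lemma signed_perm_transpose: "P \<in> even_signed_perms \<Longrightarrow> transpose P \<in> even_signed_perms"
  unfolding even_signed_perms_iff using SO_transpose by (auto simp: transpose_def)

lemma signed_perm_mult:
  assumes P: "P \<in> even_signed_perms" and Q: "Q \<in> even_signed_perms"
  shows "P ** Q \<in> even_signed_perms"
proof -
  have "(P ** Q) $ i $ j \<in> {-1, 0, 1}" for i j
  proof -
    obtain m where m: "\<And>k. P $ i $ k \<noteq> 0 \<Longrightarrow> k = m"
    proof -
      have "\<exists>!j. P $ i $ j \<noteq> 0" using P by (simp add: even_signed_perms_def)
      then show thesis using that by blast
    qed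
    have "(P ** Q) $ i $ j = (\<Sum>k\<in>UNIV. if k = m then P $ i $ m * Q $ m $ j else 0)"
      unfolding matrix_matrix_mult_def vec_lambda_beta using m by (intro sum.cong) auto
    then have "(P ** Q) $ i $ j = P $ i $ m * Q $ m $ j" by simp
    moreover have "P $ i $ m \<in> {-1, 0, 1}" "Q $ m $ j \<in> {-1, 0, 1}"
      using P Q by (simp_all only: even_signed_perms_iff)
    ultimately show ?thesis by auto
  qed
  moreover have "P ** Q \<in> SO" using P Q by (intro SO_mult) (simp_all only: even_signed_perms_iff)
  ultimately show ?thesis unfolding even_signed_perms_iff by blast
qed

lemma finite_signed_perms: "finite (even_signed_perms :: (real^'n^'n) set)"
proof (rule finite_subset)
  show "even_signed_perms \<subseteq> (\<lambda>f. \<chi> i j. f (i, j) :: real^'n^'n) ` (UNIV \<rightarrow>\<^sub>E {-1, 0, 1})"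
  proof
    fix P :: "real^'n^'n" assume "P \<in> even_signed_perms"
    then have "(\<lambda>(i, j). P $ i $ j) \<in> UNIV \<rightarrow>\<^sub>E {-1, 0, 1}" by (auto simp: even_signed_perms_iff)
    then show "P \<in> (\<lambda>f. \<chi> i j. f (i, j)) ` (UNIV \<rightarrow>\<^sub>E {-1, 0, 1})"
      by (rule rev_image_eqI) (simp add: vec_eq_iff)
  qed
  show "finite ((\<lambda>f. \<chi> i j. f (i, j) :: real^'n^'n) ` (UNIV \<rightarrow>\<^sub>E {-1, 0, 1}))"
    by (intro finite_imageI finite_PiE) auto
qed

lemma underlying_perm_iff:
  assumes "P \<in> even_signed_perms"
  shows "P $ i $ j \<noteq> 0 \<longleftrightarrow> i = underlying_perm P j"
proof -
  have "\<exists>!i. P $ i $ j \<noteq> 0" using assms by (simp add: even_signed_perms_def)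
  from theI'[OF this] this show ?thesis unfolding underlying_perm_def by blast
qed

lemma bij_underlying_perm:
  assumes "P \<in> even_signed_perms"
  shows "bij (underlying_perm P)"
proof -
  have "inj (underlying_perm P)"
  proof (rule injI)
    fix i j assume e: "underlying_perm P i = underlying_perm P j"
    have "P $ underlying_perm P i $ i \<noteq> 0" "P $ underlying_perm P i $ j \<noteq> 0"
      using underlying_perm_iff[OF assms] e by auto
    moreover have "\<exists>!j. P $ underlying_perm P i $ j \<noteq> 0" using assms by (simp add: even_signed_perms_def)
    ultimately show "i = j" by blast
  qed
  then show ?thesis by (simp add: bij_def finite_UNIV_inj_surj)
qed

lemma conj_signed_perm:
  assumes P: "P \<in> even_signed_perms" and D: "diagonal_matrix D"
  shows "P ** D ** transpose P = perm_diag (underlying_perm P) D"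
proof -
  let ?\<pi> = "underlying_perm P"
  have E: "diagonal_matrix (perm_diag ?\<pi> D)" by (simp add: diagonal_matrix_def perm_diag_def)
  have "P ** D = perm_diag ?\<pi> D ** P"
    unfolding vec_eq_iff diagonal_mult(1)[OF E] diagonal_mult(2)[OF D]
  proof (intro allI)
    fix i j
    show "P $ i $ j * D $ j $ j = perm_diag ?\<pi> D $ i $ i * P $ i $ j"
    proof (cases "P $ i $ j = 0")
      case False
      then have "i = ?\<pi> j" using underlying_perm_iff[OF P] by simp
      then have "inv ?\<pi> i = j" using bij_underlying_perm[OF P] by (simp add: bij_is_inj)
      then show ?thesis by (simp add: perm_diag_def)
    qed simp
  qed
  then show ?thesis by (simp only: SO_cancel(3)[OF signed_perm_SO[OF P]])
qed

lemma conj_signed_perm_entry: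
  assumes P: "P \<in> even_signed_perms" and D: "diagonal_matrix D"
  shows "(P ** D ** transpose P) $ i $ i = D $ inv (underlying_perm P) i $ inv (underlying_perm P) i"
  by (simp add: conj_signed_perm[OF assms] perm_diag_def)

lemma conj_signed_perm_Diag_plus:
  assumes P: "P \<in> even_signed_perms" and D: "D \<in> Diag_plus"
  shows "P ** D ** transpose P \<in> Diag_plus"
  unfolding conj_signed_perm[OF P Diag_plus_diagonal[OF D]]
  using D by (simp add: Diag_plus_def perm_diag_def)

text \<open>
  Conjugation permutes the logarithmic coordinates of both matrices in the same way.
\<close>

lemma log_dist_conj:
  assumes P: "P \<in> even_signed_perms" and D: "D \<in> Diag_plus" and E: "E \<in> Diag_plus"
  shows "log_dist (P ** D ** transpose P) (P ** E ** transpose P) = log_dist D E"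
proof -
  let ?\<sigma> = "inv (underlying_perm P)"
  let ?v = "log_vec E - log_vec D"
  have bij: "bij ?\<sigma>" using bij_underlying_perm[OF P] by (rule bij_imp_bij_inv)
  have "log_vec (P ** E ** transpose P) - log_vec (P ** D ** transpose P) = (\<chi> i. ?v $ ?\<sigma> i)"
    by (simp add: vec_eq_iff log_vec_def conj_signed_perm_entry[OF P] Diag_plus_diagonal D E)
  moreover have "norm ((\<chi> i. ?v $ ?\<sigma> i)) = norm ?v"
    unfolding norm_eq_sqrt_inner inner_vec_def
    using sum.reindex_bij_betw[OF bij, of "\<lambda>i. ?v $ i \<bullet> ?v $ i"] by (simp only: vec_lambda_beta)
  ultimately show ?thesis by (simp only: log_dist_def)
qed

lemma norm_log_diag:
  assumes D: "D \<in> Diag_plus" and E: "E \<in> Diag_plus"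
  shows "norm (log_diag (matrix_inv D ** E)) = log_dist D E"
proof -
  let ?v = "log_vec E - log_vec D"
  have e: "log_diag (matrix_inv D ** E) $ i $ j = (if i = j then ?v $ i else 0)" for i j
    using Diag_plus_pos[OF D, of j] Diag_plus_pos[OF E, of j]
    by (cases "i = j") (simp_all add: log_diag_def log_vec_def diagonal_mult(1)[OF Diag_plus_inv(2)[OF D]] Diag_plus_inv(3)[OF D] ln_div)
  have "log_diag (matrix_inv D ** E) \<bullet> log_diag (matrix_inv D ** E) = ?v \<bullet> ?v"
  proof -
    have "(if i = j then a i else 0) * (if i = j then a i else 0) = (if j = i then a i * a i else 0 :: real)" for i j :: 'a and a
      by simp
    then show ?thesis unfolding inner_vec_def e by (simp del: vector_minus_component)
  qed
  then show ?thesis by (simp only: norm_eq_sqrt_inner log_dist_def)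
qed

text \<open>
  Some term of the Leibniz expansion of \<open>det W\<close> is nonzero; its permutation matches equal
  entries of \<open>D\<close> and \<open>E\<close>, because \<open>W\<^sub>i\<^sub>j \<noteq> 0\<close> forces \<open>D\<^sub>j\<^sub>j = E\<^sub>i\<^sub>i\<close>. A change of sign in one row makes
  the permutation matrix a rotation.
\<close>

lemma intertwined_diagonals_permuted:
  fixes W :: "real^'n^'n"
  assumes W: "W \<in> SO" and D: "diagonal_matrix D" and E: "diagonal_matrix E" and WD: "W ** D = E ** W"
  obtains P where "P \<in> even_signed_perms" "P ** D ** transpose P = E"
proof -
  have "det W \<noteq> 0" using W by (simp add: SO_iff)
  then obtain p where p: "p permutes UNIV" "(\<Prod>i\<in>UNIV. W $ i $ p i) \<noteq> 0"
    unfolding det_def by (metis (mono_tags, lifting) mem_Collect_eq mult_zero_right sum.neutral)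
  have DE: "D $ p i $ p i = E $ i $ i" for i
  proof -
    have "W $ i $ p i \<noteq> 0" using p(2) by simp
    moreover have "(W ** D) $ i $ p i = (E ** W) $ i $ p i" by (simp only: WD)
    ultimately show ?thesis by (simp add: diagonal_mult(1)[OF E] diagonal_mult(2)[OF D])
  qed
  have pinj: "p i = p j \<longleftrightarrow> i = j" for i j using permutes_inj[OF p(1)] by (simp add: inj_eq)
  have pp: "\<exists>i. p i = j" for j using permutes_surj[OF p(1)] by (metis surjD)
  define P0 :: "real^'n^'n" where "P0 = (\<chi> i j. if p i = j then 1 else 0)"
  have orth: "P0 ** transpose P0 = mat 1"
  proof -
    have "(P0 ** transpose P0) $ i $ j = (if i = j then 1 else 0)" for i j
    proof -
      have "P0 $ i $ k * P0 $ j $ k = (if k = p i then (if i = j then 1 else 0) else 0)" for k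
        by (auto simp: P0_def pinj)
      then show ?thesis by (simp add: matrix_matrix_mult_def transpose_def)
    qed
    then show ?thesis by (simp add: vec_eq_iff mat_def)
  qed
  then have om: "orthogonal_matrix P0" by (simp add: orthogonal_matrix_def matrix_left_right_inverse)
  obtain a :: 'n where True by blast
  \<comment> \<open>A single sign, placed in an arbitrary row \<open>a\<close>, corrects the determinant.\<close>
  define S :: "real^'n^'n" where "S = (\<chi> i j. if i = j then if i = a then det P0 else 1 else 0)"
  have S: "diagonal_matrix S" by (simp add: S_def diagonal_matrix_def)
  have dP0: "det P0 = 1 \<or> det P0 = -1" using det_orthogonal_matrix[OF om] .
  have "det S = (\<Prod>i\<in>UNIV. S $ i $ i)"
    by (rule det_diagonal) (simp add: S_def)
  also have "\<dots> = (\<Prod>i\<in>UNIV. if i = a then det P0 else 1)" by (simp add: S_def)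
  finally have dS: "det S = det P0" by simp
  have "S ** S = mat 1"
    unfolding vec_eq_iff diagonal_mult(1)[OF S] using dP0 by (auto simp: S_def mat_def)
  moreover have St: "transpose S = S" by (auto simp: S_def transpose_def vec_eq_iff)
  ultimately have oS: "orthogonal_matrix S" by (simp add: orthogonal_matrix)
  define P where "P = S ** P0"
  have Pe: "P $ i $ j = (if p i = j then S $ i $ i else 0)" for i j
    by (simp add: P_def diagonal_mult(1)[OF S] P0_def)
  have "P \<in> SO"
    unfolding SO_def rotation_matrix_def P_def
    using oS om dS dP0 by (auto simp: orthogonal_matrix_mul det_mul)
  moreover have "P $ i $ j \<in> {-1, 0, 1}" for i j
    using dP0 by (auto simp: Pe S_def)
  ultimately have "P \<in> even_signed_perms" by (simp only: even_signed_perms_iff simp_thms)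
  moreover have "P ** D = E ** P"
    unfolding vec_eq_iff diagonal_mult(1)[OF E] diagonal_mult(2)[OF D] by (auto simp: Pe DE)
  then have "P ** D ** transpose P = E"
    using SO_cancel(3)[OF \<open>P \<in> SO\<close>, of E] by simp
  ultimately show thesis using that by blast
qed

section \<open>Fibres\<close>

lemma fibre_iff: "(U, D) \<in> fibre X \<longleftrightarrow> U \<in> SO \<and> D \<in> Diag_plus \<and> U ** D ** transpose U = X"
  by (auto simp: fibre_def M_set_def F_def)

lemma stab0_commute: "R \<in> stab0 D \<Longrightarrow> R ** D = D ** R"
  using stab0_subset stab_iff by blast

lemma fibre_translate:
  assumes "(U, D) \<in> fibre X" "R \<in> stab0 D" "P \<in> even_signed_perms"
  shows "(U ** R ** transpose P, P ** D ** transpose P) \<in> fibre X"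
proof -
  have U: "U \<in> SO" and D: "D \<in> Diag_plus" and X: "U ** D ** transpose U = X"
    using assms(1) by (auto simp: fibre_iff)
  have P: "P \<in> SO" and R: "R \<in> SO" using assms stab0_SO signed_perm_SO by auto
  have "(U ** R ** transpose P) ** (P ** D ** transpose P) ** transpose (U ** R ** transpose P)
     = U ** (R ** (transpose P ** (P ** (D ** (transpose P ** (P ** (transpose R ** transpose U)))))))"
    by (simp add: matrix_transpose_mul matrix_mul_assoc)
  also have "\<dots> = U ** ((R ** D) ** (transpose R ** transpose U))"
    by (simp only: SO_cancel(1)[OF P] flip: matrix_mul_assoc)
  also have "\<dots> = U ** (D ** (R ** (transpose R ** transpose U)))"
    by (simp only: stab0_commute[OF assms(2)] matrix_mul_assoc)
  also have "\<dots> = X" by (simp only: SO_cancel(2)[OF R] flip: X matrix_mul_assoc)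
  finally show ?thesis
    using U P R D conj_signed_perm_Diag_plus[OF assms(3) D] by (simp add: fibre_iff SO_mult SO_transpose)
qed

text \<open>
  The rotation \<open>W = U'\<^sup>T U\<close> intertwines \<open>D\<close> and \<open>D'\<close>, so it agrees with a signed permutation
  \<open>P\<^sub>0\<close> up to an element \<open>T\<close> of \<open>G\<^sub>D\<close>. The diagonalisation is applied to \<open>T\<^sup>T\<close> rather than \<open>T\<close>, so
  that the factor in \<open>G\<^sub>D\<^sup>0\<close> comes first in \<open>U\<^sup>T U'\<close> and the diagonal matrix of signs can be absorbed
  into the permutation.
\<close>

lemma fibre_structure:
  assumes "(U, D) \<in> fibre X" "(U', D') \<in> fibre X"
  obtains R P where "R \<in> stab0 D" "P \<in> even_signed_perms"
    "U' = U ** R ** transpose P" "D' = P ** D ** transpose P"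
proof -
  have U: "U \<in> SO" and D: "D \<in> Diag_plus" and X: "U ** D ** transpose U = X"
    and U': "U' \<in> SO" and D': "D' \<in> Diag_plus" and X': "U' ** D' ** transpose U' = X"
    using assms by (auto simp: fibre_iff)
  note dD = Diag_plus_diagonal[OF D] and dD' = Diag_plus_diagonal[OF D']
  define W where "W = transpose U' ** U"
  have W: "W \<in> SO" unfolding W_def by (intro SO_mult SO_transpose U U')
  have WD: "W ** D = D' ** W"
  proof -
    have "W ** D = transpose U' ** (U ** D)" by (simp add: W_def matrix_mul_assoc)
    also have "U ** D = X ** U" by (simp only: SO_cancel(4)[OF U] flip: X)
    also have "X = U' ** (D' ** transpose U')" by (simp add: matrix_mul_assoc flip: X')
    also have "transpose U' ** (U' ** (D' ** transpose U') ** U) = D' ** W"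
      by (simp only: W_def SO_cancel(1)[OF U'] flip: matrix_mul_assoc)
    finally show ?thesis .
  qed
  obtain P0 where P0: "P0 \<in> even_signed_perms" "P0 ** D ** transpose P0 = D'"
    using intertwined_diagonals_permuted[OF W dD dD' WD] by metis
  note P0S = signed_perm_SO[OF P0(1)]
  have P0D: "P0 ** D = D' ** P0" using SO_cancel(4)[OF P0S, of "P0 ** D"] P0(2) by simp
  define T where "T = transpose P0 ** W"
  have "T ** D = D ** T"
  proof -
    have "T ** D = transpose P0 ** (D' ** W)" by (simp add: T_def WD flip: matrix_mul_assoc)
    also have "\<dots> = transpose P0 ** (P0 ** (D ** (transpose P0 ** W)))"
      by (simp add: matrix_mul_assoc flip: P0(2))
    also have "\<dots> = D ** T" by (simp only: SO_cancel(1)[OF P0S] T_def)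
    finally show ?thesis .
  qed
  then have "T \<in> stab D" using W P0S by (simp add: stab_iff T_def SO_mult SO_transpose)
  then obtain Q where Q: "Q \<in> stab0 D" "diagonal_matrix (Q ** transpose T)"
    using stab0_diagonalise[OF dD stab_transpose] by metis
  define A where "A = Q ** transpose T"
  have QS: "Q \<in> SO" using Q(1) by (rule stab0_SO)
  have AS: "A \<in> stab D"
    unfolding A_def using \<open>T \<in> stab D\<close> Q(1) stab0_subset by (intro stab_mult stab_transpose) auto
  then have ASO: "A \<in> SO" by (simp add: stab_iff)
  have "A $ i $ j \<in> {-1, 0, 1}" for i j
    using orthogonal_diagonal_entries[OF ASO Q(2)[folded A_def], of i] Q(2)[folded A_def]
    by (cases "i = j") (auto simp: diagonal_matrix_def)
  then have A: "A \<in> even_signed_perms" using ASO by (simp only: even_signed_perms_iff simp_thms)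
  show thesis
  proof (rule that)
    show "transpose Q \<in> stab0 D" using Q(1) by (rule stab0_transpose)
    show "P0 ** transpose A \<in> even_signed_perms" by (intro signed_perm_mult signed_perm_transpose P0 A)
    have "U ** transpose Q ** transpose (P0 ** transpose A) = U ** ((transpose Q ** A) ** transpose P0)"
      by (simp add: matrix_transpose_mul matrix_mul_assoc)
    also have "transpose Q ** A = transpose T" by (simp only: A_def SO_cancel(1)[OF QS])
    also have "transpose T ** transpose P0 = transpose W"
      by (simp add: T_def matrix_transpose_mul SO_cancel(3)[OF P0S])
    also have "U ** transpose W = U'"
      by (simp add: W_def matrix_transpose_mul SO_cancel(2)[OF U])
    finally show "U' = U ** transpose Q ** transpose (P0 ** transpose A)" by simp
    have "(P0 ** transpose A) ** D ** transpose (P0 ** transpose A)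
       = P0 ** ((transpose A ** D) ** A) ** transpose P0"
      by (simp add: matrix_transpose_mul matrix_mul_assoc)
    also have "transpose A ** D = D ** transpose A" using stab_transpose[OF AS] by (simp add: stab_iff)
    also have "D ** transpose A ** A = D" by (rule SO_cancel(4)[OF ASO])
    finally show "D' = (P0 ** transpose A) ** D ** transpose (P0 ** transpose A)" by (simp add: P0)
  qed
qed

definition perm_action :: "real^'n^'n \<Rightarrow> 'n::finite matrix_pair \<Rightarrow> 'n matrix_pair" where
  "perm_action P m = (fst m ** P, transpose P ** snd m ** P)"

lemma perm_action_isometry:
  assumes P: "P \<in> even_signed_perms"
  shows "bounded_linear (perm_action P)" "perm_action P ` M_set \<subseteq> M_set"
    "m \<in> M_set \<Longrightarrow> g_M k (perm_action P m) (perm_action P v) (perm_action P v) = g_M k m v v"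
    "perm_action (transpose P) (perm_action P m) = m" "perm_action P (perm_action (transpose P) m) = m"
    "m \<in> M_set \<Longrightarrow> F (perm_action P m) = F m"
proof -
  note PS = signed_perm_SO[OF P]
  show "bounded_linear (perm_action P)"
    unfolding perm_action_def linear_conv_bounded_linear[symmetric]
    by (intro linearI) (simp_all add: matrix_ring)
  show M: "perm_action P ` M_set \<subseteq> M_set"
    using conj_signed_perm_Diag_plus[OF signed_perm_transpose[OF P]] PS
    by (auto simp: M_set_def perm_action_def SO_mult)
  show "perm_action (transpose P) (perm_action P m) = m" "perm_action P (perm_action (transpose P) m) = m"
    using SO_cancel[OF PS] SO_transpose_mult[OF PS] SO_mult_transpose[OF PS]
    by (simp_all add: perm_action_def prod_eq_iff matrix_mul_assoc)
  assume m: "m \<in> M_set"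
  obtain U D where mU: "m = (U, D)" "U \<in> SO" "D \<in> Diag_plus" using m by (auto simp: M_set_def)
  obtain A L where v: "v = (A, L)" by (cases v)
  have "(transpose P ** matrix_inv D ** P) ** (transpose P ** D ** P) = mat 1"
  proof -
    have "(transpose P ** matrix_inv D ** P) ** (transpose P ** D ** P)
       = transpose P ** (matrix_inv D ** (P ** (transpose P ** (D ** P))))"
      by (simp add: matrix_mul_assoc)
    also have "\<dots> = transpose P ** ((matrix_inv D ** D) ** P)"
      by (simp only: SO_cancel(2)[OF PS] flip: matrix_mul_assoc)
    also have "matrix_inv D ** D = mat 1"
      unfolding vec_eq_iff diagonal_mult(1)[OF Diag_plus_inv(2)[OF mU(3)]] Diag_plus_inv(3)[OF mU(3)]
      using mU(3) by (auto simp: mat_def Diag_plus_def) (metis less_irrefl)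
    finally show ?thesis by (simp add: SO_transpose_mult[OF PS])
  qed
  then have inv: "matrix_inv (transpose P ** D ** P) = transpose P ** matrix_inv D ** P"
    by (rule matrix_inv_unique)
  have "g_Diag (transpose P ** D ** P) (transpose P ** L ** P) (transpose P ** L ** P) = g_Diag D L L"
  proof -
    let ?W = "matrix_inv D ** (L ** (matrix_inv D ** L))"
    have "(transpose P ** matrix_inv D ** P) ** (transpose P ** L ** P) ** (transpose P ** matrix_inv D ** P)
        ** (transpose P ** L ** P)
      = transpose P ** (matrix_inv D ** (P ** (transpose P ** (L ** (P ** (transpose P ** (matrix_inv D **
         (P ** (transpose P ** (L ** P))))))))))"
      by (simp add: matrix_mul_assoc)
    also have "\<dots> = transpose P ** (?W ** P)"
      by (simp only: SO_cancel(2)[OF PS] flip: matrix_mul_assoc)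
    also have "trace \<dots> = trace ((?W ** P) ** transpose P)" by (rule trace_mul_sym)
    also have "(?W ** P) ** transpose P = ?W" by (rule SO_cancel(3)[OF PS])
    finally show ?thesis by (simp add: g_Diag_def inv matrix_mul_assoc)
  qed
  then show "g_M k (perm_action P m) (perm_action P v) (perm_action P v) = g_M k m v v"
    using right_translation_SO(3)[OF PS mU(2)] by (simp add: mU(1) v perm_action_def g_M_def)
  have "(U ** P) ** (transpose P ** D ** P) ** transpose (U ** P)
     = U ** (P ** (transpose P ** (D ** (P ** (transpose P ** transpose U)))))"
    by (simp add: matrix_transpose_mul matrix_mul_assoc)
  also have "\<dots> = U ** D ** transpose U" by (simp only: SO_cancel(2)[OF PS] flip: matrix_mul_assoc)
  finally show "F (perm_action P m) = F m" by (simp add: F_def perm_action_def mU(1))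
qed

lemma F_minimal_geodesic_perm_action:
  assumes P: "P \<in> even_signed_perms" and \<gamma>: "F_minimal_geodesic k X Y \<gamma>"
  shows "F_minimal_geodesic k X Y (perm_action P \<circ> \<gamma>)"
proof -
  note iso = perm_action_isometry[OF P]
  note iso' = perm_action_isometry[OF signed_perm_transpose[OF P], unfolded transpose_transpose]
  have geo: "geodesic M_set (g_M k) \<gamma>" and "\<gamma> 0 \<in> fibre X" "\<gamma> 1 \<in> fibre Y"
    and len: "curve_length (g_M k) \<gamma> = d_SR k X Y"
    using \<gamma> by (auto simp: F_minimal_geodesic_def)
  then have "perm_action P (\<gamma> 0) \<in> fibre X" "perm_action P (\<gamma> 1) \<in> fibre Y"
    using iso(2,6) by (auto simp: fibre_def)
  moreover have "geodesic M_set (g_M k) (perm_action P \<circ> \<gamma>)"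
    by (rule geodesic_isometry[OF iso(1,2) _ iso'(1,2) _ iso(4,5) geo]) (rule iso(3) iso'(3), assumption)+
  moreover have "curve_length (g_M k) (perm_action P \<circ> \<gamma>) = curve_length (g_M k) \<gamma>"
    by (rule isometry_admissible(2)[OF iso(1,2)]) (rule iso(3), use geo in \<open>auto simp: geodesic_def\<close>)
  ultimately show ?thesis using len by (simp add: F_minimal_geodesic_def)
qed

section \<open>The distance formula\<close>

lemma Gamma0_iff: "h \<in> Gamma0 D \<longleftrightarrow> h \<in> even_signed_perms \<and> h \<in> stab0 D"
  by (simp add: Gamma0_def)

lemma Gamma0_transpose: "h \<in> Gamma0 D \<Longrightarrow> transpose h \<in> Gamma0 D"
  by (simp add: Gamma0_iff signed_perm_transpose stab0_transpose)

lemma minimum_unique: "minimum S m \<Longrightarrow> Inf S = m"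
  unfolding minimum_def by (intro cInf_eq_minimum) auto

lemma d_hat_values_iff:
  assumes "g \<in> even_signed_perms"
  shows "d_hat_values g (U, D) (V, E) =
    {d_SO (U ** R\<^sub>U) (V ** R\<^sub>V ** transpose g) | R\<^sub>U R\<^sub>V. R\<^sub>U \<in> stab0 D \<and> R\<^sub>V \<in> stab0 E}"
  by (simp add: d_hat_values_def SO_matrix_inv[OF signed_perm_SO[OF assms]])

lemma d_hat_attained:
  assumes U: "U \<in> SO" and V: "V \<in> SO" and g: "g \<in> even_signed_perms"
  shows "minimum (d_hat_values g (U, D) (V, E)) (d_hat g (U, D) (V, E))"
proof -
  let ?f = "\<lambda>r. d_SO (U ** fst r) (V ** snd r ** transpose g)"
  have "continuous_on (stab0 D \<times> stab0 E) ?f"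
  proof (rule continuous_on_d_SO)
    show "(\<lambda>r. U ** fst r) ` (stab0 D \<times> stab0 E) \<subseteq> SO"
      using SO_mult[OF U stab0_SO] by fastforce
    show "(\<lambda>r. V ** snd r ** transpose g) ` (stab0 D \<times> stab0 E) \<subseteq> SO"
      using SO_mult[OF SO_mult[OF V stab0_SO] SO_transpose[OF signed_perm_SO[OF g]]] by fastforce
  qed (intro continuous_intros)+
  moreover have "compact (stab0 D \<times> stab0 E)" by (intro compact_Times compact_stab0)
  moreover have "stab0 D \<times> stab0 E \<noteq> {}" using stab0_one by blast
  ultimately obtain r where r: "r \<in> stab0 D \<times> stab0 E" "\<And>s. s \<in> stab0 D \<times> stab0 E \<Longrightarrow> ?f r \<le> ?f s"
    using continuous_attains_inf[of "stab0 D \<times> stab0 E" ?f] by blast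
  have "minimum (d_hat_values g (U, D) (V, E)) (?f r)"
    unfolding minimum_def d_hat_values_iff[OF g]
  proof (intro conjI ballI)
    show "?f r \<in> {d_SO (U ** R\<^sub>U) (V ** R\<^sub>V ** transpose g) | R\<^sub>U R\<^sub>V. R\<^sub>U \<in> stab0 D \<and> R\<^sub>V \<in> stab0 E}"
      using r(1) by (auto simp: mem_Times_iff)
    fix x assume "x \<in> {d_SO (U ** R\<^sub>U) (V ** R\<^sub>V ** transpose g) | R\<^sub>U R\<^sub>V. R\<^sub>U \<in> stab0 D \<and> R\<^sub>V \<in> stab0 E}"
    then obtain R\<^sub>U R\<^sub>V where "x = d_SO (U ** R\<^sub>U) (V ** R\<^sub>V ** transpose g)" "R\<^sub>U \<in> stab0 D" "R\<^sub>V \<in> stab0 E"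
      by blast
    then show "?f r \<le> x" using r(2)[of "(R\<^sub>U, R\<^sub>V)"] by simp
  qed
  then show ?thesis using minimum_unique unfolding d_hat_def by metis
qed

text \<open>
  The factor \<open>h\<^sub>2\<close> is absorbed into \<open>R\<^sub>V\<close>; right translation by \<open>h\<^sub>1\<close>, an isometry of \<open>SO\<close>,
  moves \<open>h\<^sub>1\<close> to the first argument, where it is absorbed into \<open>R\<^sub>U\<close>.
\<close>

lemma d_hat_values_double_coset_subset:
  assumes g: "g \<in> even_signed_perms" and h1: "h1 \<in> Gamma0 D" and h2: "h2 \<in> Gamma0 E"
  shows "d_hat_values (h1 ** g ** h2) (U, D) (V, E) \<subseteq> d_hat_values g (U, D) (V, E)"
proof
  have h: "h1 \<in> even_signed_perms" "h2 \<in> even_signed_perms" "h1 \<in> stab0 D" "h2 \<in> stab0 E"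
    using h1 h2 by (auto simp: Gamma0_iff)
  fix x assume "x \<in> d_hat_values (h1 ** g ** h2) (U, D) (V, E)"
  have "h1 ** g ** h2 \<in> even_signed_perms" using h g by (intro signed_perm_mult)
  from \<open>x \<in> _\<close>[unfolded d_hat_values_iff[OF this]] obtain R\<^sub>U R\<^sub>V where R: "R\<^sub>U \<in> stab0 D" "R\<^sub>V \<in> stab0 E"
    and x: "x = d_SO (U ** R\<^sub>U) (V ** R\<^sub>V ** transpose (h1 ** g ** h2))"
    by blast
  note h1S = stab0_SO[OF h(3)]
  have "x = d_SO (U ** R\<^sub>U ** h1) (V ** R\<^sub>V ** transpose (h1 ** g ** h2) ** h1)"
    unfolding x by (rule d_SO_right[OF h1S, symmetric])
  also have "V ** R\<^sub>V ** transpose (h1 ** g ** h2) ** h1 = V ** (R\<^sub>V ** transpose h2) ** transpose g"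
    by (simp add: matrix_transpose_mul matrix_mul_assoc SO_cancel(4)[OF h1S])
  finally have "x = d_SO (U ** (R\<^sub>U ** h1)) (V ** (R\<^sub>V ** transpose h2) ** transpose g)"
    by (simp add: matrix_mul_assoc)
  moreover have "R\<^sub>U ** h1 \<in> stab0 D" "R\<^sub>V ** transpose h2 \<in> stab0 E"
    using R h by (auto intro!: stab0_mult stab0_transpose)
  ultimately show "x \<in> d_hat_values g (U, D) (V, E)"
    unfolding d_hat_values_iff[OF g] by blast
qed

lemma d_hat_double_coset:
  assumes g: "g \<in> even_signed_perms" and h1: "h1 \<in> Gamma0 D" and h2: "h2 \<in> Gamma0 E"
  shows "d_hat (h1 ** g ** h2) (U, D) (V, E) = d_hat g (U, D) (V, E)"
proof -
  have h: "h1 \<in> even_signed_perms" "h2 \<in> even_signed_perms" using h1 h2 by (auto simp: Gamma0_iff)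
  let ?g' = "h1 ** g ** h2"
  have g': "?g' \<in> even_signed_perms" using h g by (intro signed_perm_mult)
  have "transpose h1 ** ?g' ** transpose h2 = transpose h1 ** (h1 ** (g ** h2)) ** transpose h2"
    by (simp add: matrix_mul_assoc)
  also have "\<dots> = g"
    by (simp only: SO_cancel(1)[OF signed_perm_SO[OF h(1)]] SO_cancel(3)[OF signed_perm_SO[OF h(2)]])
  finally have "d_hat_values g (U, D) (V, E) \<subseteq> d_hat_values ?g' (U, D) (V, E)"
    using d_hat_values_double_coset_subset[OF g' Gamma0_transpose[OF h1] Gamma0_transpose[OF h2]] by simp
  with d_hat_values_double_coset_subset[OF assms, of U V] show ?thesis
    by (simp add: d_hat_def subset_antisym)
qed

text \<open>
  Here \<open>h\<^sub>2\<close> fixes \<open>E\<close>, and \<open>h\<^sub>1\<close> fixes \<open>D\<close>, so both arguments can be conjugated by \<open>h\<^sub>1\<close>.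
\<close>

lemma log_dist_double_coset:
  assumes g: "g \<in> even_signed_perms" and h1: "h1 \<in> Gamma0 D" and h2: "h2 \<in> Gamma0 E"
    and D: "D \<in> Diag_plus" and E: "E \<in> Diag_plus"
  shows "log_dist D ((h1 ** g ** h2) ** E ** transpose (h1 ** g ** h2)) = log_dist D (g ** E ** transpose g)"
proof -
  have h: "h1 \<in> even_signed_perms" "h1 \<in> stab D" "h2 \<in> stab E"
    using h1 h2 stab0_subset by (auto simp: Gamma0_iff)
  have "(h1 ** g ** h2) ** E ** transpose (h1 ** g ** h2)
     = h1 ** (g ** (h2 ** E ** transpose h2) ** transpose g) ** transpose h1"
    by (simp add: matrix_transpose_mul matrix_mul_assoc)
  also have "h2 ** E ** transpose h2 = E" using h(3) by (simp add: stab_def)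
  finally have "log_dist D ((h1 ** g ** h2) ** E ** transpose (h1 ** g ** h2))
     = log_dist (h1 ** D ** transpose h1) (h1 ** (g ** E ** transpose g) ** transpose h1)"
    using h(2) by (simp add: stab_def)
  also have "\<dots> = log_dist D (g ** E ** transpose g)"
    by (rule log_dist_conj[OF h(1) D conj_signed_perm_Diag_plus[OF g E]])
  finally show ?thesis .
qed

text \<open>
  Only \<open>P\<^sup>T Q\<close> enters, because \<open>P\<close> acts on both points by the same isometry.
\<close>

lemma d_M_fibres:
  assumes k: "k > 0" and U: "U \<in> SO" and V: "V \<in> SO" and D: "D \<in> Diag_plus" and E: "E \<in> Diag_plus"
    and P: "P \<in> even_signed_perms" and Q: "Q \<in> even_signed_perms"
  shows "d_M k (U ** transpose P, P ** D ** transpose P) (V ** transpose Q, Q ** E ** transpose Q)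
    = sqrt (k * (d_SO U (V ** transpose (transpose P ** Q)))\<^sup>2
        + (log_dist D ((transpose P ** Q) ** E ** transpose (transpose P ** Q)))\<^sup>2)"
proof -
  let ?g = "transpose P ** Q"
  note PS = signed_perm_SO[OF P] and QS = signed_perm_SO[OF Q]
  have g: "?g \<in> even_signed_perms" using P Q by (intro signed_perm_mult signed_perm_transpose)
  have "d_SO (U ** transpose P) (V ** transpose Q) = d_SO (U ** transpose P ** P) (V ** transpose Q ** P)"
    by (rule d_SO_right[OF PS, symmetric])
  also have "\<dots> = d_SO U (V ** transpose ?g)"
    by (simp add: SO_cancel(4)[OF PS] matrix_transpose_mul matrix_mul_assoc)
  finally have 1: "d_SO (U ** transpose P) (V ** transpose Q) = d_SO U (V ** transpose ?g)" .
  have "P ** (?g ** E ** transpose ?g) ** transpose P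
     = P ** (transpose P ** (Q ** (E ** (transpose Q ** (P ** transpose P)))))"
    by (simp add: matrix_transpose_mul matrix_mul_assoc)
  also have "\<dots> = Q ** E ** transpose Q"
    by (simp only: SO_cancel(2)[OF PS] SO_mult_transpose[OF PS] matrix_mul_rid) (simp only: matrix_mul_assoc)
  finally have 2: "log_dist (P ** D ** transpose P) (Q ** E ** transpose Q) = log_dist D (?g ** E ** transpose ?g)"
    using log_dist_conj[OF P D conj_signed_perm_Diag_plus[OF g E]] by simp
  show ?thesis
    using d_M_eq[OF k, of "U ** transpose P" "V ** transpose Q" "P ** D ** transpose P" "Q ** E ** transpose Q"]
      U V PS QS conj_signed_perm_Diag_plus[OF P D] conj_signed_perm_Diag_plus[OF Q E]
    by (simp add: 1 2 SO_mult SO_transpose)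
qed

lemma fibre_component:
  assumes "(U, D) \<in> fibre X" "R \<in> stab0 D"
  shows "(U ** R, D) \<in> connected_component_set (fibre X) (U, D)"
proof -
  let ?C = "(\<lambda>R. (U ** R, D)) ` stab0 D"
  have "connected ?C" by (intro connected_continuous_image continuous_intros connected_stab0)
  moreover have "?C \<subseteq> fibre X"
    using fibre_translate[OF assms(1) _ signed_perm_one] by auto
  moreover have "(U, D) \<in> ?C" using stab0_one by (intro image_eqI[of _ _ "mat 1"]) auto
  ultimately have "?C \<subseteq> connected_component_set (fibre X) (U, D)"
    by (rule connected_component_maximal[rotated])
  then show ?thesis using assms(2) by blast
qed

lemma representative_exists:
  assumes Z: "set_of_representatives Z (double_cosets (Gamma0 D) even_signed_perms (Gamma0 E))"
    and g: "g \<in> even_signed_perms"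
  obtains z h1 h2 where "z \<in> Z" "h1 \<in> Gamma0 D" "h2 \<in> Gamma0 E" "z = h1 ** g ** h2"
proof -
  let ?r = "{(g\<^sub>1, g\<^sub>2). g\<^sub>1 \<in> even_signed_perms \<and> g\<^sub>2 \<in> even_signed_perms \<and>
     (\<exists>h\<^sub>1\<in>Gamma0 D. \<exists>h\<^sub>2\<in>Gamma0 E. g\<^sub>2 = h\<^sub>1 ** g\<^sub>1 ** h\<^sub>2)}"
  have "?r `` {g} \<in> double_cosets (Gamma0 D) even_signed_perms (Gamma0 E)"
    unfolding double_cosets_def using g by (rule quotientI)
  then obtain z where "z \<in> Z" "z \<in> ?r `` {g}"
    using Z unfolding set_of_representatives_def by (metis (no_types, lifting) IntE)
  then show thesis using that by auto
qed

lemma representatives_subset: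
  assumes "set_of_representatives Z (double_cosets H1 G H2)"
  shows "Z \<subseteq> G"
  using assms unfolding set_of_representatives_def double_cosets_def quotient_def by auto

theorem proposition3p7:
  fixes X Y U V D \<Lambda> :: "real^'n^'n" and k :: real and Z :: "(real^'n^'n) set"
  assumes "CARD('n) \<ge> 2" and "k > 0"
    and "X \<in> Sym_plus" and "Y \<in> Sym_plus"
    and "(U, D) \<in> fibre X" and "(V, \<Lambda>) \<in> fibre Y"
    and "set_of_representatives Z (double_cosets (Gamma0 D) even_signed_perms (Gamma0 \<Lambda>))"
  shows "(\<forall>g\<in>Z. minimum (d_hat_values g (U, D) (V, \<Lambda>)) (d_hat g (U, D) (V, \<Lambda>))) \<and>
    minimum
      {k * (d_hat g (U, D) (V, \<Lambda>))\<^sup>2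
         + (norm (log_diag (matrix_inv D ** perm_diag (underlying_perm g) \<Lambda>)))\<^sup>2 | g. g \<in> Z}
      ((d_SR k X Y)\<^sup>2) \<and>
    (\<forall>\<eta>. MSSR_curve k X Y \<eta> \<longrightarrow>
      (\<exists>a b. minimal_pair k X Y a b \<and> corresponds_to_pair k X Y \<eta> a b \<and>
             a \<in> connected_component_set (fibre X) (U, D)))"
proof (intro conjI)
  note k = \<open>k > 0\<close> and X = \<open>(U, D) \<in> fibre X\<close> and Y = \<open>(V, \<Lambda>) \<in> fibre Y\<close> and Z = assms(7)
  have SO: "U \<in> SO" "V \<in> SO" and Dg: "D \<in> Diag_plus" "\<Lambda> \<in> Diag_plus"
    using X Y by (auto simp: fibre_iff)
  note ZG = representatives_subset[OF Z]
  show "\<forall>g\<in>Z. minimum (d_hat_values g (U, D) (V, \<Lambda>)) (d_hat g (U, D) (V, \<Lambda>))"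
    using d_hat_attained[OF SO] ZG by blast
  define cost where "cost g = k * (d_hat g (U, D) (V, \<Lambda>))\<^sup>2 + (log_dist D (g ** \<Lambda> ** transpose g))\<^sup>2" for g
  have cost_eq: "k * (d_hat g (U, D) (V, \<Lambda>))\<^sup>2
         + (norm (log_diag (matrix_inv D ** perm_diag (underlying_perm g) \<Lambda>)))\<^sup>2 = cost g" if "g \<in> Z" for g
  proof -
    have g: "g \<in> even_signed_perms" using that ZG by blast
    show ?thesis
      using conj_signed_perm[OF g Diag_plus_diagonal[OF Dg(2)]] norm_log_diag[OF Dg(1) conj_signed_perm_Diag_plus[OF g Dg(2)]]
      by (simp add: cost_def)
  qed
  have "finite Z" using ZG finite_signed_perms by (rule finite_subset)
  moreover have "Z \<noteq> {}" using representative_exists[OF Z signed_perm_one] by blast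
  ultimately have "Min (cost ` Z) \<in> cost ` Z" and Mle: "\<And>g. g \<in> Z \<Longrightarrow> Min (cost ` Z) \<le> cost g" by simp_all
  then obtain z where z: "z \<in> Z" "\<And>g. g \<in> Z \<Longrightarrow> cost z \<le> cost g" by auto
  have zG: "z \<in> even_signed_perms" using z ZG by blast
  have cost0: "cost g \<ge> 0" for g using k by (simp add: cost_def)
  have dh0: "d_hat g (U, D) (V, \<Lambda>) \<ge> 0" if "g \<in> even_signed_perms" for g
  proof -
    have "d_hat g (U, D) (V, \<Lambda>) \<in> d_hat_values g (U, D) (V, \<Lambda>)"
      using d_hat_attained[OF SO that] by (simp add: minimum_def)
    then obtain R\<^sub>U R\<^sub>V where R: "R\<^sub>U \<in> stab0 D" "R\<^sub>V \<in> stab0 \<Lambda>"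
      and eq: "d_hat g (U, D) (V, \<Lambda>) = d_SO (U ** R\<^sub>U) (V ** R\<^sub>V ** transpose g)"
      unfolding d_hat_values_iff[OF \<open>g \<in> _\<close>] by blast
    show ?thesis
      unfolding eq
      by (intro d_SO_nonneg SO_mult SO_transpose SO stab0_SO[OF R(1)] stab0_SO[OF R(2)] signed_perm_SO[OF that])
  qed
  have "d_SR k X Y = sqrt (cost z)"
    unfolding d_SR_def
  proof (rule cInf_eq_minimum)
    have "d_hat z (U, D) (V, \<Lambda>) \<in> d_hat_values z (U, D) (V, \<Lambda>)"
      using d_hat_attained[OF SO zG] by (simp add: minimum_def)
    then obtain R\<^sub>U R\<^sub>V where R: "R\<^sub>U \<in> stab0 D" "R\<^sub>V \<in> stab0 \<Lambda>"
      "d_hat z (U, D) (V, \<Lambda>) = d_SO (U ** R\<^sub>U) (V ** R\<^sub>V ** transpose z)"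
      unfolding d_hat_values_iff[OF zG] by blast
    have "d_M k (U ** R\<^sub>U ** transpose (mat 1), mat 1 ** D ** transpose (mat 1)) (V ** R\<^sub>V ** transpose z, z ** \<Lambda> ** transpose z)
       = sqrt (cost z)"
      using d_M_fibres[OF k SO_mult[OF SO(1) stab0_SO[OF R(1)]] SO_mult[OF SO(2) stab0_SO[OF R(2)]] Dg signed_perm_one zG]
      by (simp add: cost_def R(3))
    then show "sqrt (cost z) \<in> {d_M k a b | a b. a \<in> fibre X \<and> b \<in> fibre Y}"
      using fibre_translate[OF X R(1) signed_perm_one] fibre_translate[OF Y R(2) zG] by (metis (mono_tags, lifting) mem_Collect_eq)
  next
    fix x assume "x \<in> {d_M k a b | a b. a \<in> fibre X \<and> b \<in> fibre Y}"
    then obtain U' D' V' \<Lambda>' where x: "x = d_M k (U', D') (V', \<Lambda>')" "(U', D') \<in> fibre X" "(V', \<Lambda>') \<in> fibre Y"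
      by (auto simp: fibre_def)
    obtain R P where R: "R \<in> stab0 D" and P: "P \<in> even_signed_perms"
      and UD: "U' = U ** R ** transpose P" "D' = P ** D ** transpose P"
      using fibre_structure[OF X x(2)] by metis
    obtain T Q where T: "T \<in> stab0 \<Lambda>" and Q: "Q \<in> even_signed_perms"
      and VL: "V' = V ** T ** transpose Q" "\<Lambda>' = Q ** \<Lambda> ** transpose Q"
      using fibre_structure[OF Y x(3)] by metis
    let ?g = "transpose P ** Q"
    have g: "?g \<in> even_signed_perms" using P Q by (intro signed_perm_mult signed_perm_transpose)
    obtain g' h1 h2 where g': "g' \<in> Z" "h1 \<in> Gamma0 D" "h2 \<in> Gamma0 \<Lambda>" "g' = h1 ** ?g ** h2"
      using representative_exists[OF Z g] by metis
    have "cost z \<le> cost g'" using z g' by blast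
    also have "cost g' = cost ?g"
      unfolding cost_def g'(4) d_hat_double_coset[OF g g'(2,3)] log_dist_double_coset[OF g g'(2,3) Dg] ..
    also have "cost ?g \<le> k * (d_SO (U ** R) (V ** T ** transpose ?g))\<^sup>2 + (log_dist D (?g ** \<Lambda> ** transpose ?g))\<^sup>2"
    proof -
      have "d_SO (U ** R) (V ** T ** transpose ?g) \<in> d_hat_values ?g (U, D) (V, \<Lambda>)"
        unfolding d_hat_values_iff[OF g] using R T by blast
      then have "d_hat ?g (U, D) (V, \<Lambda>) \<le> d_SO (U ** R) (V ** T ** transpose ?g)"
        using d_hat_attained[OF SO g] by (simp add: minimum_def)
      then show ?thesis
        unfolding cost_def using k dh0[OF g] by (intro add_right_mono mult_left_mono power_mono) auto
    qed
    finally have "sqrt (cost z) \<le> sqrt (k * (d_SO (U ** R) (V ** T ** transpose ?g))\<^sup>2 + (log_dist D (?g ** \<Lambda> ** transpose ?g))\<^sup>2)"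
      by (rule real_sqrt_le_mono)
    also have "\<dots> = x"
      unfolding x(1) UD VL
      by (rule d_M_fibres[OF k SO_mult[OF SO(1) stab0_SO[OF R]] SO_mult[OF SO(2) stab0_SO[OF T]] Dg P Q, symmetric])
    finally show "sqrt (cost z) \<le> x" .
  qed
  then have dSR: "(d_SR k X Y)\<^sup>2 = cost z" using cost0 by simp
  have "{k * (d_hat g (U, D) (V, \<Lambda>))\<^sup>2
         + (norm (log_diag (matrix_inv D ** perm_diag (underlying_perm g) \<Lambda>)))\<^sup>2 | g. g \<in> Z} = cost ` Z"
    unfolding image_def using cost_eq by (intro Collect_cong) metis
  then show "minimum
      {k * (d_hat g (U, D) (V, \<Lambda>))\<^sup>2
         + (norm (log_diag (matrix_inv D ** perm_diag (underlying_perm g) \<Lambda>)))\<^sup>2 | g. g \<in> Z}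
      ((d_SR k X Y)\<^sup>2)"
    unfolding dSR using z by (simp add: minimum_def)
  show "\<forall>\<eta>. MSSR_curve k X Y \<eta> \<longrightarrow>
      (\<exists>a b. minimal_pair k X Y a b \<and> corresponds_to_pair k X Y \<eta> a b \<and>
             a \<in> connected_component_set (fibre X) (U, D))"
  proof (intro allI impI)
    fix \<eta> assume "MSSR_curve k X Y \<eta>"
    then obtain \<gamma> where \<gamma>: "F_minimal_geodesic k X Y \<gamma>" "\<forall>t\<in>{0..1}. \<eta> t = F (\<gamma> t)"
      by (auto simp: MSSR_curve_def)
    have \<gamma>0: "\<gamma> 0 \<in> fibre X" and \<gamma>M: "\<gamma> ` {0..1} \<subseteq> M_set"
      using \<gamma>(1) by (auto simp: F_minimal_geodesic_def geodesic_def admissible_curve_def)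
    obtain R P where R: "R \<in> stab0 D" and P: "P \<in> even_signed_perms"
      and e: "fst (\<gamma> 0) = U ** R ** transpose P" "snd (\<gamma> 0) = P ** D ** transpose P"
      using fibre_structure[OF X, of "fst (\<gamma> 0)" "snd (\<gamma> 0)"] \<gamma>0 by auto
    note PS = signed_perm_SO[OF P]
    let ?\<delta> = "perm_action P \<circ> \<gamma>"
    have \<delta>: "F_minimal_geodesic k X Y ?\<delta>" by (rule F_minimal_geodesic_perm_action[OF P \<gamma>(1)])
    have \<eta>: "\<forall>t\<in>{0..1}. \<eta> t = F (?\<delta> t)"
      using \<gamma>(2) \<gamma>M perm_action_isometry(6)[OF P] by (simp add: image_subset_iff)
    have "?\<delta> 0 = (U ** R, D)"
    proof -
      have "transpose P ** (P ** D ** transpose P) ** P = transpose P ** (P ** (D ** (transpose P ** P)))"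
        by (simp add: matrix_mul_assoc)
      then have "transpose P ** (P ** D ** transpose P) ** P = D"
        by (simp only: SO_cancel(1)[OF PS] SO_transpose_mult[OF PS] matrix_mul_rid)
      then show ?thesis by (simp only: perm_action_def o_def e SO_cancel(4)[OF PS])
    qed
    then have "?\<delta> 0 \<in> connected_component_set (fibre X) (U, D)"
      using fibre_component[OF X R] by simp
    then show "\<exists>a b. minimal_pair k X Y a b \<and> corresponds_to_pair k X Y \<eta> a b \<and>
             a \<in> connected_component_set (fibre X) (U, D)"
      using \<delta> \<eta> by (intro exI[of _ "?\<delta> 0"] exI[of _ "?\<delta> 1"]) (auto simp: minimal_pair_def corresponds_to_pair_def)
  qed
qed

end
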